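(* Let $t\in\mathbb{N}$ be a (fixed) positive integer. There is an algorithm that, given a $P_t$-free graph $G$ on $n$ vertices and a list assignment $L\colon V(G)\to 2^{\{1,2,3\}}$, computes the number of equitable proper list $3$-colorings of $(G,L)$ in time $2^{O(\sqrt{n\log n})}\cdot \mathrm{poly}(n)$.
   Context: Graphs are finite, without loops or parallel edges. $P_t$ is the path on $t$ vertices; a graph is $P_t$-free if it does not contain $P_t$ as an induced subgraph. A (proper) list $3$-coloring of $(G,L)$ is a map $\varphi:V(G)\to\{1,2,3\}$ with $\varphi(v)\in L(v)$ for every vertex $v$ and $\varphi(u)\neq\varphi(v)$ for every edge $uv$. It is equitable if $\bigl||\varphi^{-1}(i)|-|\varphi^{-1}(j)|\bigr|\le 1$ for all $i,j\in\{1,2,3\}$. The integer $t$ is a constant, so the constant hidden in the $O(\cdot)$-notation may depend on $t$. *)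

theory Defs
  imports
    Complex_Main
    "HOL-Library.FuncSet"
    "HOL-Library.Landau_Symbols"
    "HOL-Computational_Algebra.Polynomial"
begin

section \<open>Graphs and equitable list 3-colorings\<close>

type_synonym 'a graph = "'a set \<times> 'a set set"

definition simple_graph :: "'a graph \<Rightarrow> bool" where
  "simple_graph G \<longleftrightarrow> finite (fst G) \<and> (\<forall>e \<in> snd G. e \<subseteq> fst G \<and> card e = 2)"

definition path_graph :: "nat \<Rightarrow> nat graph" where
  "path_graph t = ({..<t}, {{i, Suc i} | i. Suc i < t})"

definition has_induced_copy :: "'a graph \<Rightarrow> 'b graph \<Rightarrow> bool" where
  "has_induced_copy G H \<longleftrightarrow>
     (\<exists>f. inj_on f (fst H) \<and> f ` fst H \<subseteq> fst G \<and>
          (\<forall>x \<in> fst H. \<forall>y \<in> fst H. {f x, f y} \<in> snd G \<longleftrightarrow> {x, y} \<in> snd H))"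

definition path_free :: "nat \<Rightarrow> 'a graph \<Rightarrow> bool" where
  "path_free t G \<longleftrightarrow> \<not> has_induced_copy G (path_graph t)"

definition list_assignment3 :: "'a graph \<Rightarrow> ('a \<Rightarrow> nat set) \<Rightarrow> bool" where
  "list_assignment3 G L \<longleftrightarrow> (\<forall>v \<in> fst G. L v \<subseteq> {1, 2, 3})"

text \<open>Colorings are extensional functions (\<open>\<rightarrow>\<^sub>E\<close>), so that each map on the vertex set is
  represented, and hence counted, exactly once.\<close>

definition list_colorings3 :: "'a graph \<Rightarrow> ('a \<Rightarrow> nat set) \<Rightarrow> ('a \<Rightarrow> nat) set" where
  "list_colorings3 G L =
     {\<phi> \<in> fst G \<rightarrow>\<^sub>E {1, 2, 3}.
        (\<forall>v \<in> fst G. \<phi> v \<in> L v) \<and> (\<forall>u v. {u, v} \<in> snd G \<longrightarrow> \<phi> u \<noteq> \<phi> v)}"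

definition equitable3 :: "'a graph \<Rightarrow> ('a \<Rightarrow> nat) \<Rightarrow> bool" where
  "equitable3 G \<phi> \<longleftrightarrow>
     (\<forall>i \<in> {1, 2, 3}. \<forall>j \<in> {1, 2, 3}.
        \<bar>int (card {v \<in> fst G. \<phi> v = i}) - int (card {v \<in> fst G. \<phi> v = j})\<bar> \<le> 1)"

definition num_equitable_list_colorings3 :: "'a graph \<Rightarrow> ('a \<Rightarrow> nat set) \<Rightarrow> nat" where
  "num_equitable_list_colorings3 G L = card {\<phi> \<in> list_colorings3 G L. equitable3 G \<phi>}"


section \<open>The machine model\<close>

text \<open>
  Algorithms are programs of a deterministic random access machine with registers and an
  indirectly addressed memory, both holding natural numbers. Every instruction, test and
  procedure call takes one unit of time. The only arithmetic is addition and truncated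
  subtraction: one step lengthens the largest stored number by at most one bit, so a run of
  \<open>k\<close> steps only handles numbers of \<open>O(k)\<close> bits beyond the size of the input and of the program
  constants. Unit cost and bit cost therefore differ by a polynomial factor in the running time,
  which does not affect bounds of the form \<open>2 ^ O(sqrt (n log n)) * poly(n)\<close>.

  A program is a finite list of parameterless, possibly mutually recursive procedures, which
  all work on the same registers and memory; execution starts with procedure \<open>0\<close>. A procedure
  index outside the list has no execution.
\<close>

datatype com =
    Skip
  | Const nat nat         \<comment> \<open>\<open>R[r] := k\<close>\<close>
  | Copy nat nat          \<comment> \<open>\<open>R[r] := R[a]\<close>\<close>
  | Add nat nat nat       \<comment> \<open>\<open>R[r] := R[a] + R[b]\<close>\<close>
  | Sub nat nat nat       \<comment> \<open>\<open>R[r] := R[a] - R[b]\<close>, truncated at \<open>0\<close>\<close>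
  | Load nat nat          \<comment> \<open>\<open>R[r] := M[R[a]]\<close>\<close>
  | Store nat nat         \<comment> \<open>\<open>M[R[a]] := R[b]\<close>\<close>
  | Seq com com
  | IfNZ nat com com      \<comment> \<open>branch on \<open>R[a] \<noteq> 0\<close>\<close>
  | WhileNZ nat com       \<comment> \<open>loop as long as \<open>R[a] \<noteq> 0\<close>\<close>
  | Call nat

type_synonym program = "com list"

type_synonym state = "(nat \<Rightarrow> nat) \<times> (nat \<Rightarrow> nat)"

text \<open>\<open>exec P c s k s'\<close>: started in \<open>s\<close>, the command \<open>c\<close> halts in \<open>s'\<close> after exactly \<open>k\<close> steps.\<close>

inductive exec :: "program \<Rightarrow> com \<Rightarrow> state \<Rightarrow> nat \<Rightarrow> state \<Rightarrow> bool" for P :: program where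
  Skip: "exec P Skip s 1 s"
| Const: "exec P (Const r k) (R, M) 1 (R(r := k), M)"
| Copy: "exec P (Copy r a) (R, M) 1 (R(r := R a), M)"
| Add: "exec P (Add r a b) (R, M) 1 (R(r := R a + R b), M)"
| Sub: "exec P (Sub r a b) (R, M) 1 (R(r := R a - R b), M)"
| Load: "exec P (Load r a) (R, M) 1 (R(r := M (R a)), M)"
| Store: "exec P (Store a b) (R, M) 1 (R, M(R a := R b))"
| Seq: "exec P c1 s1 k1 s2 \<Longrightarrow> exec P c2 s2 k2 s3 \<Longrightarrow> exec P (Seq c1 c2) s1 (k1 + k2) s3"
| IfTrue: "fst s a \<noteq> 0 \<Longrightarrow> exec P c1 s k s' \<Longrightarrow> exec P (IfNZ a c1 c2) s (k + 1) s'"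
| IfFalse: "fst s a = 0 \<Longrightarrow> exec P c2 s k s' \<Longrightarrow> exec P (IfNZ a c1 c2) s (k + 1) s'"
| WhileFalse: "fst s a = 0 \<Longrightarrow> exec P (WhileNZ a c) s 1 s"
| WhileTrue: "fst s1 a \<noteq> 0 \<Longrightarrow> exec P c s1 k1 s2 \<Longrightarrow> exec P (WhileNZ a c) s2 k2 s3 \<Longrightarrow>
    exec P (WhileNZ a c) s1 (k1 + k2 + 1) s3"
| Call: "i < length P \<Longrightarrow> exec P (P ! i) s k s' \<Longrightarrow> exec P (Call i) s (k + 1) s'"

inductive_cases exec_elims:
  "exec P Skip s k s'" "exec P (Const r x) s k s'" "exec P (Copy r a) s k s'"
  "exec P (Add r a b) s k s'" "exec P (Sub r a b) s k s'" "exec P (Load r a) s k s'"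
  "exec P (Store a b) s k s'" "exec P (Seq c1 c2) s k s'" "exec P (IfNZ a c1 c2) s k s'"
  "exec P (Call i) s k s'"

inductive_cases exec_WhileE: "exec P (WhileNZ a c) s k s'"

theorem exec_deterministic:
  "exec P c s k s' \<Longrightarrow> exec P c s l s'' \<Longrightarrow> l = k \<and> s'' = s'"
proof (induction arbitrary: l s'' rule: exec.induct)
  case (Seq c1 s1 k1 s2 c2 k2 s3)
  from Seq.prems obtain m1 m2 u
    where u: "l = m1 + m2" "exec P c1 s1 m1 u" "exec P c2 u m2 s''"
    by (rule exec_elims(8))
  from Seq.IH(1)[OF u(2)] have "m1 = k1" "u = s2" by simp_all
  with Seq.IH(2) u show ?case by simp
next
  case (WhileTrue s1 a c k1 s2 k2 s3)
  from WhileTrue.prems show ?case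
  proof (rule exec_WhileE)
    assume "fst s1 a = 0"
    with WhileTrue.hyps show ?thesis by simp
  next
    fix m1 u m2
    assume u: "l = Suc (m1 + m2)" "exec P c s1 m1 u" "exec P (WhileNZ a c) u m2 s''"
    from WhileTrue.IH(1)[OF u(2)] have "m1 = k1" "u = s2" by simp_all
    with WhileTrue.IH(2) u show ?thesis by simp
  qed
next
  case (WhileFalse s a c)
  from WhileFalse.prems show ?case
    by (rule exec_WhileE) (simp_all add: WhileFalse.hyps)
next
  case (IfTrue s a c1 k s' c2)
  from IfTrue.prems show ?case
    by (rule exec_elims(9)) (auto simp: IfTrue.hyps dest: IfTrue.IH)
next
  case (IfFalse s a c2 k s' c1)
  from IfFalse.prems show ?case
    by (rule exec_elims(9)) (auto simp: IfFalse.hyps dest: IfFalse.IH)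
next
  case (Call i s k s')
  from Call.prems show ?case
    by (rule exec_elims(10)) (auto dest: Call.IH)
qed (auto elim: exec_elims(1-7))

definition computes_within :: "program \<Rightarrow> state \<Rightarrow> nat \<Rightarrow> real \<Rightarrow> bool" where
  "computes_within P s result T \<longleftrightarrow>
     (\<exists>k s'. exec P (Call 0) s k s' \<and> real k \<le> T \<and> fst s' 0 = result)"

text \<open>
  Input convention for a graph on the vertices \<open>0, \<dots>, n - 1\<close> with edge set \<open>E\<close> and lists \<open>L\<close>:
  register \<open>0\<close> holds \<open>n\<close>, memory holds the adjacency matrix row by row, followed by three bits
  for each vertex (whether the colors \<open>1, 2, 3\<close> are in its list); everything else is \<open>0\<close>.
\<close>

definition input_memory :: "nat \<Rightarrow> nat set set \<Rightarrow> (nat \<Rightarrow> nat set) \<Rightarrow> nat \<Rightarrow> nat" where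
  "input_memory n E L x =
     (if x < n * n then of_bool ({x div n, x mod n} \<in> E)
      else if x < n * n + 3 * n then of_bool ((x - n * n) mod 3 + 1 \<in> L ((x - n * n) div 3))
      else 0)"

definition input_state :: "nat \<Rightarrow> nat set set \<Rightarrow> (nat \<Rightarrow> nat set) \<Rightarrow> state" where
  "input_state n E L = ((\<lambda>_. 0)(0 := n), input_memory n E L)"

end

theory Submission
  imports Defs "HOL-Real_Asymp.Real_Asymp"
begin

text \<open>
  The recursion passes along an accumulator: a call on the instance \<open>I\<close> multiplies register \<open>rW\<close> by
  \<open>Z I\<close>, the sum over the list colourings of \<open>I\<close> of \<open>2 ^ (K * a + K\<^sup>2 * b)\<close>, where \<open>a\<close> and \<open>b\<close> count the
  vertices of colour \<open>2\<close> and \<open>3\<close>. Thus \<open>Z\<close> is multiplicative over the parts of a disconnected graph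
  although the machine cannot multiply, and as \<open>3 ^ n < 2 ^ K\<close>, the base \<open>2 ^ K\<close> digits of the result are
  the numbers of colourings with given class sizes.

  Phase 1 branches on pairs \<open>(v, c)\<close>, either giving \<open>v\<close> the colour \<open>c\<close> or deleting \<open>c\<close> from its list,
  such that at least \<open>D \<approx> sqrt (n log n)\<close> neighbours of \<open>v\<close> have \<open>c\<close> in their lists. With the total
  list size as measure this takes \<open>2 ^ O(n log n / D)\<close> branches. As two lists with at least two of the
  three colours meet, all degrees are at most \<open>3 D\<close> afterwards.

  Phase 2 colours the neighbourhood of a pivot \<open>u\<close>, splits the rest into parts, and continues in each
  part with a neighbour of \<open>u\<close> as pivot. Successive pivots form an induced path, hence in a graph
  without an induced path on \<open>t\<close> vertices only \<open>O(t D)\<close> vertices are coloured on each branch of the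
  recursion.
\<close>

section \<open>A structured language over the machine\<close>

text \<open>The machine can neither multiply nor shift, and stored numbers become huge. Still a
  recursion node costs only a polynomial in \<open>n\<close>: loop limits and multipliers are
  \<open>rN\<close> and \<open>rK\<close>, never the accumulator. So it is enough to count nodes.
  The parts of a graph are solved one after the other, hence their node counts add up; a budget
  \<open>(a + 1) * 2 ^ (b + 1)\<close>, for \<open>a\<close> vertices and \<open>b\<close> list
  entries still to be branched on, is superadditive in \<open>a\<close> and doubles with
  \<open>b\<close>, so it survives splitting as well as branching. With degrees at most
  \<open>3 * D\<close> a neighbourhood has at most \<open>9 * D\<close> list entries, so
  \<open>t\<close> pivots need a reserve of \<open>t * 9 * D\<close>. Thus phase 1 costs an exponent
  of order \<open>n log n / D\<close>, phase 2 one of order \<open>t D\<close>, and \<open>D\<close>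
  balances the two. A new pivot is adjacent to the last one, but to no earlier one: it was still
  uncoloured when the neighbourhoods of those had been used up. Adjacency is made reflexive. The
  first pivot of a part is then its own neighbour, is coloured with its neighbourhood, and needs no
  separate treatment.\<close>

datatype aexp = AVar nat | ANum nat | AAdd aexp aexp (infixl "\<oplus>" 65) | ASub aexp aexp (infixl "\<ominus>" 65)
  | AMul aexp nat (infixl "\<otimes>" 70) | AMem aexp

primrec val :: "aexp \<Rightarrow> state \<Rightarrow> nat" where
  "val (AVar a) s = fst s a"
| "val (ANum k) s = k"
| "val (a \<oplus> b) s = val a s + val b s"
| "val (a \<ominus> b) s = val a s - val b s"
| "val (a \<otimes> l) s = val a s * fst s l"
| "val (AMem a) s = snd s (val a s)"

primrec evars :: "aexp \<Rightarrow> nat set" where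
  "evars (AVar a) = {a}"
| "evars (ANum k) = {}"
| "evars (a \<oplus> b) = evars a \<union> evars b"
| "evars (a \<ominus> b) = evars a \<union> evars b"
| "evars (a \<otimes> l) = insert l (evars a)"
| "evars (AMem a) = evars a"

text \<open>A product compiles to as many additions as its second factor says, so this factor has to
  be a register. The values of these registers alone govern the cost of an expression; time bounds
  are stated relative to a bound \<open>X\<close> on them.\<close>

primrec elims :: "aexp \<Rightarrow> nat set" where
  "elims (AVar a) = {}"
| "elims (ANum k) = {}"
| "elims (a \<oplus> b) = elims a \<union> elims b"
| "elims (a \<ominus> b) = elims a \<union> elims b"
| "elims (a \<otimes> l) = insert l (elims a)"
| "elims (AMem a) = elims a"

lemma elims_subset: "elims e \<subseteq> evars e"
  by (induction e) auto

text \<open>The value ends up in \<open>r\<close>; registers above \<open>r\<close> are scratch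
  space and those below stay intact, so the temporaries behave like an evaluation stack.\<close>

primrec ecomp :: "aexp \<Rightarrow> nat \<Rightarrow> com" where
  "ecomp (AVar a) r = Copy r a"
| "ecomp (ANum k) r = Const r k"
| "ecomp (a \<oplus> b) r = Seq (ecomp a r) (Seq (ecomp b (r + 1)) (Add r r (r + 1)))"
| "ecomp (a \<ominus> b) r = Seq (ecomp a r) (Seq (ecomp b (r + 1)) (Sub r r (r + 1)))"
| "ecomp (a \<otimes> l) r = Seq (ecomp a r) (Seq (Copy (r + 1) l) (Seq (Const (r + 2) 0)
     (Seq (WhileNZ (r + 1) (Seq (Add (r + 2) (r + 2) r) (Seq (Const (r + 3) 1) (Sub (r + 1) (r + 1) (r + 3)))))
       (Copy r (r + 2)))))"
| "ecomp (AMem a) r = Seq (ecomp a r) (Load r r)"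

primrec etime :: "aexp \<Rightarrow> nat \<Rightarrow> nat" where
  "etime (AVar a) X = 1"
| "etime (ANum k) X = 1"
| "etime (a \<oplus> b) X = etime a X + etime b X + 1"
| "etime (a \<ominus> b) X = etime a X + etime b X + 1"
| "etime (a \<otimes> l) X = etime a X + 4 * X + 4"
| "etime (AMem a) X = etime a X + 1"

text \<open>Registers below \<open>100\<close> are program variables, the others serve as temporaries.\<close>

definition agree :: "(nat \<Rightarrow> nat) \<Rightarrow> (nat \<Rightarrow> nat) \<Rightarrow> bool" where
  "agree R R' \<longleftrightarrow> (\<forall>r<100. R r = R' r)"

lemma agree_refl [simp]: "agree R R"
  by (simp add: agree_def)

lemma val_cong: "evars e \<subseteq> {..<100} \<Longrightarrow> agree R R' \<Longrightarrow> val e (R, M) = val e (R', M)"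
  by (induction e) (auto simp: agree_def)

lemma exec_mul_loop:
  "R (r + 1) = m \<Longrightarrow> \<exists>R'. exec P (WhileNZ (r + 1) (Seq (Add (r + 2) (r + 2) r)
      (Seq (Const (r + 3) 1) (Sub (r + 1) (r + 1) (r + 3))))) (R, M) (4 * m + 1) (R', M) \<and>
    R' (r + 2) = R (r + 2) + m * R r \<and> (\<forall>q<r. R' q = R q)"
proof (induction m arbitrary: R)
  case 0
  have "exec P (WhileNZ (r + 1) (Seq (Add (r + 2) (r + 2) r)
      (Seq (Const (r + 3) 1) (Sub (r + 1) (r + 1) (r + 3))))) (R, M) 1 (R, M)"
    by (rule exec.WhileFalse) (use 0 in simp)
  then show ?case by (intro exI[of _ R]) simp
next
  case (Suc m)
  define R1 where "R1 = R(r + 2 := R (r + 2) + R r)"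
  define R2 where "R2 = R1(r + 3 := 1)"
  define R3 where "R3 = R2(r + 1 := R2 (r + 1) - R2 (r + 3))"
  have e: "exec P (Seq (Add (r + 2) (r + 2) r) (Seq (Const (r + 3) 1) (Sub (r + 1) (r + 1) (r + 3))))
      (R, M) (1 + (1 + 1)) (R3, M)"
    unfolding R3_def R2_def R1_def
    by (rule exec.Seq, rule exec.Add, rule exec.Seq, rule exec.Const, rule exec.Sub)
  have "R3 (r + 1) = m" using Suc.prems by (simp add: R3_def R2_def R1_def)
  from Suc.IH[of R3, OF this] obtain R' where R':
    "exec P (WhileNZ (r + 1) (Seq (Add (r + 2) (r + 2) r)
      (Seq (Const (r + 3) 1) (Sub (r + 1) (r + 1) (r + 3))))) (R3, M) (4 * m + 1) (R', M)"
    "R' (r + 2) = R3 (r + 2) + m * R3 r" "\<forall>q<r. R' q = R3 q" by blast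
  have "exec P (WhileNZ (r + 1) (Seq (Add (r + 2) (r + 2) r)
      (Seq (Const (r + 3) 1) (Sub (r + 1) (r + 1) (r + 3))))) (R, M) ((1 + (1 + 1)) + (4 * m + 1) + 1) (R', M)"
    by (rule exec.WhileTrue[OF _ e R'(1)]) (use Suc.prems in simp)
  moreover have "(1 + (1 + 1)) + (4 * m + 1) + 1 = 4 * Suc m + 1" by simp
  ultimately have "exec P (WhileNZ (r + 1) (Seq (Add (r + 2) (r + 2) r)
      (Seq (Const (r + 3) 1) (Sub (r + 1) (r + 1) (r + 3))))) (R, M) (4 * Suc m + 1) (R', M)"
    by (simp only:)
  moreover have "R' (r + 2) = R (r + 2) + Suc m * R r" "\<forall>q<r. R' q = R q"
    using R'(2,3) by (auto simp: R3_def R2_def R1_def)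
  ultimately show ?case by blast
qed

lemma exec_ecomp:
  assumes "evars e \<subseteq> {..<100}" "100 \<le> r" "\<forall>l\<in>elims e. R l \<le> X"
  shows "\<exists>k R'. exec P (ecomp e r) (R, M) k (R', M) \<and> k \<le> etime e X \<and>
    R' r = val e (R, M) \<and> (\<forall>q<r. R' q = R q)"
  using assms
proof (induction e arbitrary: r R)
  case (AVar a)
  have "exec P (ecomp (AVar a) r) (R, M) 1 (R(r := R a), M)" unfolding ecomp.simps by (rule exec.Copy)
  then show ?case by (intro exI[of _ 1] exI) auto
next
  case (ANum k)
  have "exec P (ecomp (ANum k) r) (R, M) 1 (R(r := k), M)" unfolding ecomp.simps by (rule exec.Const)
  then show ?case by (intro exI[of _ 1] exI) auto
next
  case (AAdd a b)
  from AAdd.IH(1)[of r R] AAdd.prems obtain k1 R1 where 1: "exec P (ecomp a r) (R, M) k1 (R1, M)"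
    "k1 \<le> etime a X" "R1 r = val a (R, M)" "\<forall>q<r. R1 q = R q" by auto
  have "\<forall>l\<in>elims b. l < 100" using AAdd.prems(1) elims_subset[of b] by auto
  with AAdd.IH(2)[of "r+1" R1] AAdd.prems 1(4) obtain k2 R2 where 2: "exec P (ecomp b (r+1)) (R1, M) k2 (R2, M)"
    "k2 \<le> etime b X" "R2 (r+1) = val b (R1, M)" "\<forall>q<r+1. R2 q = R1 q" by fastforce
  have v: "val b (R1, M) = val b (R, M)"
    by (rule val_cong) (use AAdd.prems 1(4) in \<open>auto simp: agree_def\<close>)
  have "exec P (ecomp (a \<oplus> b) r) (R, M) (k1 + (k2 + 1)) (R2(r := R2 r + R2 (r+1)), M)"
    by (auto intro!: exec.Seq[OF 1(1)] exec.Seq[OF 2(1)] exec.Add simp del: One_nat_def)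
  then show ?case using 1 2 v by (intro exI[of _ "k1 + (k2 + 1)"] exI) auto
next
  case (ASub a b)
  from ASub.IH(1)[of r R] ASub.prems obtain k1 R1 where 1: "exec P (ecomp a r) (R, M) k1 (R1, M)"
    "k1 \<le> etime a X" "R1 r = val a (R, M)" "\<forall>q<r. R1 q = R q" by auto
  have "\<forall>l\<in>elims b. l < 100" using ASub.prems(1) elims_subset[of b] by auto
  with ASub.IH(2)[of "r+1" R1] ASub.prems 1(4) obtain k2 R2 where 2: "exec P (ecomp b (r+1)) (R1, M) k2 (R2, M)"
    "k2 \<le> etime b X" "R2 (r+1) = val b (R1, M)" "\<forall>q<r+1. R2 q = R1 q" by fastforce
  have v: "val b (R1, M) = val b (R, M)"
    by (rule val_cong) (use ASub.prems 1(4) in \<open>auto simp: agree_def\<close>)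
  have "exec P (ecomp (a \<ominus> b) r) (R, M) (k1 + (k2 + 1)) (R2(r := R2 r - R2 (r+1)), M)"
    by (auto intro!: exec.Seq[OF 1(1)] exec.Seq[OF 2(1)] exec.Sub simp del: One_nat_def)
  then show ?case using 1 2 v by (intro exI[of _ "k1 + (k2 + 1)"] exI) auto
next
  case (AMul a l)
  from AMul.IH[of r R] AMul.prems obtain k1 R1 where 1: "exec P (ecomp a r) (R, M) k1 (R1, M)"
    "k1 \<le> etime a X" "R1 r = val a (R, M)" "\<forall>q<r. R1 q = R q" by auto
  define R2 where "R2 = R1(r + 1 := R1 l)"
  define R3 where "R3 = R2(r + 2 := 0)"
  have l: "R1 l = R l" "R l \<le> X" using AMul.prems 1(4) by auto
  have e2: "exec P (Copy (r + 1) l) (R1, M) 1 (R2, M)" unfolding R2_def by (rule exec.Copy)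
  have e3: "exec P (Const (r + 2) 0) (R2, M) 1 (R3, M)" unfolding R3_def by (rule exec.Const)
  have "R3 (r + 1) = R l" using l by (simp add: R3_def R2_def)
  from exec_mul_loop[of R3 r "R l" P M, OF this] obtain R4 where 4:
    "exec P (WhileNZ (r + 1) (Seq (Add (r + 2) (r + 2) r)
      (Seq (Const (r + 3) 1) (Sub (r + 1) (r + 1) (r + 3))))) (R3, M) (4 * R l + 1) (R4, M)"
    "R4 (r + 2) = R3 (r + 2) + R l * R3 r" "\<forall>q<r. R4 q = R3 q" by blast
  have "exec P (ecomp (a \<otimes> l) r) (R, M) (k1 + (1 + (1 + ((4 * R l + 1) + 1)))) (R4(r := R4 (r + 2)), M)"
    unfolding ecomp.simps
    by (intro exec.Seq[OF 1(1)] exec.Seq[OF e2] exec.Seq[OF e3] exec.Seq[OF 4(1)] exec.Copy)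
  moreover have "R4 (r + 2) = val (a \<otimes> l) (R, M)" using 4(2) 1(3) by (simp add: R3_def R2_def)
  moreover have "\<forall>q<r. R4 q = R q" using 4(3) 1(4) by (simp add: R3_def R2_def)
  ultimately show ?case using l 1(2) by (intro exI[of _ "k1 + (1 + (1 + ((4 * R l + 1) + 1)))"] exI) auto
next
  case (AMem a)
  from AMem.IH[of r R] AMem.prems obtain k1 R1 where 1: "exec P (ecomp a r) (R, M) k1 (R1, M)"
    "k1 \<le> etime a X" "R1 r = val a (R, M)" "\<forall>q<r. R1 q = R q" by auto
  have "exec P (ecomp (AMem a) r) (R, M) (k1 + 1) (R1(r := M (R1 r)), M)"
    unfolding ecomp.simps by (intro exec.Seq[OF 1(1)] exec.Load)
  then show ?case using 1 by (intro exI[of _ "k1 + 1"] exI) auto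
qed

section \<open>Structured statements with bounded loops: semantics, cost and compilation\<close>

datatype stm = Nop | Asg nat aexp (infix "\<leftarrow>" 60) | Sto aexp aexp | Sq stm stm (infixr ";;" 55)
  | Cond aexp stm stm | For nat nat stm

primrec sem :: "stm \<Rightarrow> state \<Rightarrow> state" where
  "sem Nop s = s"
| "sem (r \<leftarrow> e) s = ((fst s)(r := val e s), snd s)"
| "sem (Sto a e) s = (fst s, (snd s)(val a s := val e s))"
| "sem (a ;; b) s = sem b (sem a s)"
| "sem (Cond e a b) s = (if val e s \<noteq> 0 then sem a s else sem b s)"
| "sem (For i l b) s = (((\<lambda>s'. ((fst s')(i := Suc (fst s' i)), snd s')) \<circ> sem b) ^^ fst s l)
     ((fst s)(i := 0), snd s)"

primrec mods :: "stm \<Rightarrow> nat set" where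
  "mods Nop = {}"
| "mods (r \<leftarrow> e) = {r}"
| "mods (Sto a e) = {}"
| "mods (a ;; b) = mods a \<union> mods b"
| "mods (Cond e a b) = mods a \<union> mods b"
| "mods (For i l b) = insert i (mods b)"

primrec lims :: "stm \<Rightarrow> nat set" where
  "lims Nop = {}"
| "lims (r \<leftarrow> e) = elims e"
| "lims (Sto a e) = elims a \<union> elims e"
| "lims (a ;; b) = lims a \<union> lims b"
| "lims (Cond e a b) = elims e \<union> lims a \<union> lims b"
| "lims (For i l b) = insert l (lims b)"

text \<open>A loop body changes neither the counter nor the limit, so the number of rounds is fixed
  on entry. There are no calls at this level, which makes \<open>sem\<close> a plain function;
  recursion is added around compiled statements.\<close>

primrec wfs :: "stm \<Rightarrow> bool" where
  "wfs Nop = True"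
| "wfs (r \<leftarrow> e) = (r < 100 \<and> evars e \<subseteq> {..<100})"
| "wfs (Sto a e) = (evars a \<subseteq> {..<100} \<and> evars e \<subseteq> {..<100})"
| "wfs (a ;; b) = (wfs a \<and> wfs b)"
| "wfs (Cond e a b) = (evars e \<subseteq> {..<100} \<and> wfs a \<and> wfs b)"
| "wfs (For i l b) = (i < 100 \<and> l < 100 \<and> i \<noteq> l \<and> i \<notin> mods b \<and> l \<notin> mods b \<and> wfs b)"

primrec pure :: "stm \<Rightarrow> bool" where
  "pure Nop = True"
| "pure (r \<leftarrow> e) = True"
| "pure (Sto a e) = False"
| "pure (a ;; b) = (pure a \<and> pure b)"
| "pure (Cond e a b) = (pure a \<and> pure b)"
| "pure (For i l b) = pure b"

text \<open>Register \<open>100\<close>, which the compiled loop tests, is recomputed after each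
  round as the number of rounds left.\<close>

primrec comp :: "stm \<Rightarrow> com" where
  "comp Nop = Skip"
| "comp (r \<leftarrow> e) = Seq (ecomp e 100) (Copy r 100)"
| "comp (Sto a e) = Seq (ecomp a 100) (Seq (ecomp e 101) (Store 100 101))"
| "comp (a ;; b) = Seq (comp a) (comp b)"
| "comp (Cond e a b) = Seq (ecomp e 100) (IfNZ 100 (comp a) (comp b))"
| "comp (For i l b) = Seq (Const i 0) (Seq (Sub 100 l i)
     (WhileNZ 100 (Seq (comp b) (Seq (Const 100 1) (Seq (Add i i 100) (Sub 100 l i))))))"

primrec time :: "stm \<Rightarrow> nat \<Rightarrow> nat" where
  "time Nop X = 1"
| "time (r \<leftarrow> e) X = etime e X + 1"
| "time (Sto a e) X = etime a X + etime e X + 1"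
| "time (a ;; b) X = time a X + time b X"
| "time (Cond e a b) X = etime e X + time a X + time b X + 1"
| "time (For i l b) X = X * (time b X + 4) + 3"

lemma sem_mods: "r \<notin> mods c \<Longrightarrow> fst (sem c s) r = fst s r"
proof (induction c arbitrary: s)
  case (For i l b)
  have "fst ((((\<lambda>s'. ((fst s')(i := Suc (fst s' i)), snd s')) \<circ> sem b) ^^ m) u) r = fst u r" for m u
    using For by (induction m) auto
  then show ?case using For.prems by simp
qed auto

lemma sem_pure: "pure c \<Longrightarrow> snd (sem c s) = snd s"
proof (induction c arbitrary: s)
  case (For i l b)
  have "snd ((((\<lambda>s'. ((fst s')(i := Suc (fst s' i)), snd s')) \<circ> sem b) ^^ m) u) = snd u" for m u
    using For by (induction m) auto
  then show ?case by simp
qed auto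

lemma lims_subset: "wfs c \<Longrightarrow> lims c \<subseteq> {..<100}"
proof (induction c)
  case (Asg x1 x2) then show ?case using elims_subset[of x2] by auto
next
  case (Sto x1 x2) then show ?case using elims_subset[of x2] elims_subset[of x1] by auto
next
  case (Cond e a b) then show ?case using elims_subset[of e] by auto
qed auto

text \<open>The start registers \<open>R\<close> need to match \<open>R0\<close> on the variables
  only, because earlier code leaves arbitrary temporaries. No loop limit or multiplier is modified,
  so all of them stay below \<open>X\<close> and \<open>time c X\<close> bounds the cost however
  large the other numbers grow.\<close>

lemma exec_comp:
  assumes "wfs c" "lims c \<inter> mods c = {}" "\<forall>l\<in>lims c. R l \<le> X" "agree R R0"
  shows "\<exists>k R'. exec P (comp c) (R, M) k (R', snd (sem c (R0, M))) \<and> k \<le> time c X \<and>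
    agree R' (fst (sem c (R0, M)))"
  using assms
proof (induction c arbitrary: R R0 M)
  case Nop
  have "exec P (comp Nop) (R, M) 1 (R, M)" unfolding comp.simps by (rule exec.Skip)
  with Nop show ?case by (intro exI[of _ 1] exI[of _ R]) simp
next
  case (Asg r e)
  from exec_ecomp[of e 100 R X P M] Asg.prems obtain k R1 where 1:
    "exec P (ecomp e 100) (R, M) k (R1, M)" "k \<le> etime e X" "R1 100 = val e (R, M)" "\<forall>q<100. R1 q = R q"
    by auto
  have "exec P (comp (r \<leftarrow> e)) (R, M) (k + 1) (R1(r := R1 100), M)"
    unfolding comp.simps by (intro exec.Seq[OF 1(1)] exec.Copy)
  moreover have "k + 1 \<le> time (r \<leftarrow> e) X" using 1(2) by simp
  moreover have "val e (R, M) = val e (R0, M)" using Asg.prems by (intro val_cong) auto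
  then have "agree (R1(r := R1 100)) (fst (sem (r \<leftarrow> e) (R0, M)))"
    using 1(3,4) Asg.prems(4) by (auto simp: agree_def)
  ultimately show ?case unfolding sem.simps snd_conv by blast
next
  case (Sto a e)
  from exec_ecomp[of a 100 R X P M] Sto.prems obtain k R1 where 1:
    "exec P (ecomp a 100) (R, M) k (R1, M)" "k \<le> etime a X" "R1 100 = val a (R, M)" "\<forall>q<100. R1 q = R q"
    by auto
  have "R1 l \<le> X" if "l \<in> elims e" for l
  proof -
    have "l < 100" using that Sto.prems(1) elims_subset[of e] by auto
    then show ?thesis using that 1(4) Sto.prems(3) by auto
  qed
  then have "\<forall>l\<in>elims e. R1 l \<le> X" by blast
  with exec_ecomp[of e 101 R1 X P M] Sto.prems obtain k2 R2 where 2: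
    "exec P (ecomp e 101) (R1, M) k2 (R2, M)" "k2 \<le> etime e X" "R2 101 = val e (R1, M)" "\<forall>q<101. R2 q = R1 q"
    by auto
  have "exec P (comp (Sto a e)) (R, M) (k + (k2 + 1)) (R2, M(R2 100 := R2 101))"
    unfolding comp.simps by (intro exec.Seq[OF 1(1)] exec.Seq[OF 2(1)] exec.Store)
  moreover have "val a (R, M) = val a (R0, M)" using Sto.prems by (intro val_cong) auto
  moreover have "val e (R1, M) = val e (R0, M)" using Sto.prems 1(4)
    by (intro val_cong) (auto simp: agree_def)
  moreover have "R2 100 = val a (R, M)" "R2 101 = val e (R1, M)" using 1 2 by auto
  moreover have "agree R2 R0" using 1 2 Sto.prems(4) by (auto simp: agree_def)
  moreover have "k + (k2 + 1) \<le> time (Sto a e) X" using 1(2) 2(2) by simp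
  ultimately show ?case unfolding sem.simps fst_conv snd_conv by metis
next
  case (Sq a b)
  from Sq.IH(1)[of R R0 M] Sq.prems obtain k1 R1 where 1:
    "exec P (comp a) (R, M) k1 (R1, snd (sem a (R0, M)))" "k1 \<le> time a X"
    "agree R1 (fst (sem a (R0, M)))" by auto
  have "R1 l \<le> X" if "l \<in> lims b" for l
  proof -
    have "l < 100" using that lims_subset[of b] Sq.prems(1) by auto
    then have "R1 l = fst (sem a (R0, M)) l" using 1(3) by (simp add: agree_def)
    also have "fst (sem a (R0, M)) l = fst (R0, M) l"
      by (rule sem_mods) (use that Sq.prems(2) in auto)
    also have "fst (R0, M) l = R l" using \<open>l < 100\<close> Sq.prems(4) by (simp add: agree_def)
    finally show ?thesis using that Sq.prems(3) by auto
  qed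
  with Sq.IH(2)[of R1 "fst (sem a (R0, M))" "snd (sem a (R0, M))"] Sq.prems 1(3) obtain k2 R2 where 2:
    "exec P (comp b) (R1, snd (sem a (R0, M))) k2 (R2, snd (sem b (sem a (R0, M))))" "k2 \<le> time b X"
    "agree R2 (fst (sem b (sem a (R0, M))))" by auto
  show ?case using exec.Seq[OF 1(1) 2(1)] 1(2) 2(2,3)
    by (intro exI[of _ "k1 + k2"] exI[of _ R2]) auto
next
  case (Cond e a b)
  from exec_ecomp[of e 100 R X P M] Cond.prems obtain k R1 where 1:
    "exec P (ecomp e 100) (R, M) k (R1, M)" "k \<le> etime e X" "R1 100 = val e (R, M)" "\<forall>q<100. R1 q = R q"
    by auto
  have v: "val e (R, M) = val e (R0, M)" using Cond.prems by (intro val_cong) auto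
  have ag: "agree R1 R0" using 1(4) Cond.prems(4) by (auto simp: agree_def)
  have "R1 l \<le> X" if "l \<in> lims a \<union> lims b" for l
  proof -
    have "l < 100" using that Cond.prems(1) lims_subset[of a] lims_subset[of b] by auto
    then show ?thesis using that 1(4) Cond.prems(3) by auto
  qed
  then have l: "\<forall>l\<in>lims a \<union> lims b. R1 l \<le> X" by blast
  show ?case
  proof (cases "val e (R0, M) = 0")
    case False
    from Cond.IH(1)[of R1 R0 M] Cond.prems ag l obtain k2 R2 where 2:
      "exec P (comp a) (R1, M) k2 (R2, snd (sem a (R0, M)))" "k2 \<le> time a X"
      "agree R2 (fst (sem a (R0, M)))" by auto
    have "exec P (comp (Cond e a b)) (R, M) (k + (k2 + 1)) (R2, snd (sem a (R0, M)))"
      unfolding comp.simps by (rule exec.Seq[OF 1(1)], rule exec.IfTrue[OF _ 2(1)]) (use 1 v False in auto)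
    with 1 2 False show ?thesis by (intro exI[of _ "k + (k2 + 1)"] exI[of _ R2]) auto
  next
    case True
    from Cond.IH(2)[of R1 R0 M] Cond.prems ag l obtain k2 R2 where 2:
      "exec P (comp b) (R1, M) k2 (R2, snd (sem b (R0, M)))" "k2 \<le> time b X"
      "agree R2 (fst (sem b (R0, M)))" by auto
    have "exec P (comp (Cond e a b)) (R, M) (k + (k2 + 1)) (R2, snd (sem b (R0, M)))"
      unfolding comp.simps by (rule exec.Seq[OF 1(1)], rule exec.IfFalse[OF _ 2(1)]) (use 1 v True in auto)
    with 1 2 True show ?thesis by (intro exI[of _ "k + (k2 + 1)"] exI[of _ R2]) auto
  qed
next
  case (For i l b)
  let ?f = "(\<lambda>s'. ((fst s')(i := Suc (fst s' i)), snd s')) \<circ> sem b"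
  let ?body = "Seq (comp b) (Seq (Const 100 1) (Seq (Add i i 100) (Sub 100 l i)))"
  \<comment> \<open>Generalised to every intermediate state with \<open>m\<close> rounds left; both
    the tested register and the difference of limit and counter must equal \<open>m\<close>.\<close>
  have loop: "\<exists>k R'. exec P (WhileNZ 100 ?body) (Ra, Ma) k (R', snd ((?f ^^ m) (Rb, Ma))) \<and>
      k \<le> m * (time b X + 4) + 1 \<and> agree R' (fst ((?f ^^ m) (Rb, Ma)))"
    if "Ra 100 = m" "agree Ra Rb" "Ra l - Ra i = m" "\<forall>l\<in>lims b. Ra l \<le> X" for m Ra Rb Ma
    using that
  proof (induction m arbitrary: Ra Rb Ma)
    case 0
    have "exec P (WhileNZ 100 ?body) (Ra, Ma) 1 (Ra, Ma)"
      by (rule exec.WhileFalse) (use 0 in simp)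
    with 0 show ?case by (intro exI[of _ 1] exI[of _ Ra]) simp
  next
    case (Suc m)
    from For.IH[of Ra Rb Ma] For.prems Suc.prems obtain k1 R1 where 1:
      "exec P (comp b) (Ra, Ma) k1 (R1, snd (sem b (Rb, Ma)))" "k1 \<le> time b X"
      "agree R1 (fst (sem b (Rb, Ma)))" by auto
    have keep: "R1 r = Ra r" if "r \<notin> mods b" "r < 100" for r
      using that 1(3) Suc.prems(2) sem_mods[OF that(1), of "(Rb, Ma)"] by (simp add: agree_def)
    define R2 where "R2 = R1(100 := 1)"
    define R3 where "R3 = R2(i := R2 i + R2 100)"
    define R4 where "R4 = R3(100 := R3 l - R3 i)"
    let ?M1 = "snd (sem b (Rb, Ma))"
    have il: "i < 100" "l < 100" "i \<noteq> l" "i \<notin> mods b" "l \<notin> mods b" using For.prems(1) by auto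
    have e: "exec P ?body (Ra, Ma) (k1 + (1 + (1 + 1))) (R4, ?M1)"
      unfolding R4_def R3_def R2_def
      by (rule exec.Seq[OF 1(1)], rule exec.Seq, rule exec.Const, rule exec.Seq, rule exec.Add, rule exec.Sub)
    have 4: "R4 100 = m" "R4 l - R4 i = m"
      using Suc.prems il keep[of i] keep[of l] by (auto simp: R4_def R3_def R2_def)
    have ag: "agree R4 (fst (?f (Rb, Ma)))"
      using 1(3) il by (auto simp: agree_def R4_def R3_def R2_def)
    have lim: "\<forall>l\<in>lims b. R4 l \<le> X"
    proof
      fix q assume q: "q \<in> lims b"
      then have "q < 100" "q \<notin> mods b" "q \<noteq> i" using lims_subset For.prems(1,2) by auto
      then show "R4 q \<le> X" using keep[of q] Suc.prems(4) q by (auto simp: R4_def R3_def R2_def)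
    qed
    from Suc.IH[OF 4(1) ag 4(2) lim, of ?M1] obtain k R' where R':
      "exec P (WhileNZ 100 ?body) (R4, ?M1) k (R', snd ((?f ^^ m) (fst (?f (Rb, Ma)), ?M1)))"
      "k \<le> m * (time b X + 4) + 1" "agree R' (fst ((?f ^^ m) (fst (?f (Rb, Ma)), ?M1)))" by blast
    have eq: "(fst (?f (Rb, Ma)), ?M1) = ?f (Rb, Ma)" by (simp add: prod_eq_iff)
    have "exec P (WhileNZ 100 ?body) (Ra, Ma) ((k1 + (1 + (1 + 1))) + k + 1) (R', snd ((?f ^^ Suc m) (Rb, Ma)))"
      unfolding funpow_Suc_right o_apply[of "?f ^^ m"] using R'(1) Suc.prems(1)
      unfolding eq by (intro exec.WhileTrue[OF _ e]) auto
    moreover have "agree R' (fst ((?f ^^ Suc m) (Rb, Ma)))"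
      unfolding funpow_Suc_right o_apply[of "?f ^^ m"] using R'(3) unfolding eq .
    moreover have "(k1 + (1 + (1 + 1))) + k + 1 \<le> Suc m * (time b X + 4) + 1"
      using R'(2) 1(2) by simp
    ultimately show ?case by blast
  qed
  define Ra where "Ra = R(i := 0)"
  define Rb where "Rb = Ra(100 := Ra l - Ra i)"
  have il: "i < 100" "l < 100" "i \<noteq> l" using For.prems(1) by auto
  have h: "Rb 100 = R0 l" "agree Rb (R0(i := 0))" "Rb l - Rb i = R0 l"
    using il For.prems(4) by (auto simp: Rb_def Ra_def agree_def)
  have lim: "\<forall>l\<in>lims b. Rb l \<le> X"
  proof
    fix q assume q: "q \<in> lims b"
    then have "q < 100" "q \<noteq> i" using lims_subset For.prems(1,2) by auto
    then show "Rb q \<le> X" using For.prems(3) q by (auto simp: Rb_def Ra_def)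
  qed
  from loop[OF h(1,2,3) lim, of M] obtain k R' where R':
    "exec P (WhileNZ 100 ?body) (Rb, M) k (R', snd ((?f ^^ R0 l) (R0(i := 0), M)))"
    "k \<le> R0 l * (time b X + 4) + 1" "agree R' (fst ((?f ^^ R0 l) (R0(i := 0), M)))" by blast
  have "exec P (comp (For i l b)) (R, M) (1 + (1 + k)) (R', snd ((?f ^^ R0 l) (R0(i := 0), M)))"
    unfolding comp.simps using R'(1) unfolding Rb_def Ra_def
    by - (rule exec.Seq, rule exec.Const, rule exec.Seq, rule exec.Sub)
  moreover have "R0 l \<le> X" using For.prems(3,4) il by (auto simp: agree_def)
  then have "R0 l * (time b X + 4) \<le> X * (time b X + 4)" by (rule mult_le_mono1)
  then have "1 + (1 + k) \<le> time (For i l b) X" using R'(2) unfolding time.simps by linarith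
  ultimately show ?case using R'(3) by (intro exI[of _ "1 + (1 + k)"] exI[of _ R']) simp
qed

text \<open>The invariant rule for loops. A round may use that the counter is \<open>j\<close> and
  that registers outside \<open>mods\<close> keep their initial values, so an invariant has to
  mention only what changes.\<close>

lemma sem_For:
  assumes "wfs (For i l b)"
    and "Inv 0 (R(i := 0)) M"
    and "\<And>j R' M'. j < R l \<Longrightarrow> Inv j R' M' \<Longrightarrow> R' i = j \<Longrightarrow> (\<And>r. r \<noteq> i \<Longrightarrow> r \<notin> mods b \<Longrightarrow> R' r = R r) \<Longrightarrow>
      Inv (Suc j) ((fst (sem b (R', M')))(i := Suc j)) (snd (sem b (R', M')))"
  obtains R2 M2 where "sem (For i l b) (R, M) = (R2, M2)" "Inv (R l) R2 M2"
    "\<And>r. r \<notin> mods (For i l b) \<Longrightarrow> R2 r = R r"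
proof -
  define f where "f = (\<lambda>s'. ((fst s')(i := Suc (fst s' i)), snd s')) \<circ> sem b"
  have f: "f s = ((fst (sem b s))(i := Suc (fst (sem b s) i)), snd (sem b s))" for s
    by (simp add: f_def)
  define R0 where "R0 = R(i := 0)"
  have R0: "Inv 0 R0 M" "R0 i = 0" "\<And>r. r \<noteq> i \<Longrightarrow> R0 r = R r"
    using assms(2) by (simp_all add: R0_def)
  have "j \<le> R l \<Longrightarrow> Inv j (fst ((f ^^ j) (R0, M))) (snd ((f ^^ j) (R0, M))) \<and>
     fst ((f ^^ j) (R0, M)) i = j \<and>
     (\<forall>r. r \<noteq> i \<longrightarrow> r \<notin> mods b \<longrightarrow> fst ((f ^^ j) (R0, M)) r = R r)" for j
  proof (induction j)
    case 0
    then show ?case using R0 by simp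
  next
    case (Suc j)
    let ?s = "(f ^^ j) (R0, M)"
    have "Inv (Suc j) ((fst (sem b (fst ?s, snd ?s)))(i := Suc j)) (snd (sem b (fst ?s, snd ?s)))"
      by (rule assms(3)) (use Suc in simp_all)
    then have 1: "Inv (Suc j) ((fst (sem b ?s))(i := Suc j)) (snd (sem b ?s))" by simp
    have "fst (sem b ?s) i = fst ?s i" using assms(1) by (intro sem_mods) simp
    then have "fst (sem b ?s) i = j" using Suc by simp
    then have 2: "(f ^^ Suc j) (R0, M) = ((fst (sem b ?s))(i := Suc j), snd (sem b ?s))"
      using f[of ?s] by (metis funpow.simps(2) o_apply)
    have "fst (sem b ?s) r = R r" if "r \<noteq> i" "r \<notin> mods b" for r
      using sem_mods[OF that(2), of ?s] Suc that by simp
    with 1 show ?case unfolding 2 fst_conv snd_conv by (simp del: fun_upd_apply) simp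
  qed
  from this[of "R l"] have 3: "Inv (R l) (fst ((f ^^ R l) (R0, M))) (snd ((f ^^ R l) (R0, M)))"
    "r \<noteq> i \<Longrightarrow> r \<notin> mods b \<Longrightarrow> fst ((f ^^ R l) (R0, M)) r = R r" for r by blast+
  have 4: "sem (For i l b) (R, M) = (f ^^ R l) (R0, M)" by (simp only: f_def R0_def sem.simps fst_conv snd_conv)
  show thesis
    by (rule that[OF _ 3(1)]) (use 3(2) 4 in auto)
qed

text \<open>A loop multiplies the cost of its body by \<open>X\<close> and a product adds a multiple
  of \<open>X\<close>, so every fixed statement has a polynomial cost.\<close>

lemma time_poly: "\<exists>p :: real poly. \<forall>X. real (time c X) = poly p (real X)"
proof -
  have e: "\<exists>p :: real poly. \<forall>X. real (etime a X) = poly p (real X)" for a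
  proof (induction a)
    case (AAdd a b)
    then obtain p q :: "real poly" where
      "\<forall>X. real (etime a X) = poly p (real X)" "\<forall>X. real (etime b X) = poly q (real X)" by blast
    then show ?case by (intro exI[of _ "p + q + 1"]) auto
  next
    case (ASub a b)
    then obtain p q :: "real poly" where
      "\<forall>X. real (etime a X) = poly p (real X)" "\<forall>X. real (etime b X) = poly q (real X)" by blast
    then show ?case by (intro exI[of _ "p + q + 1"]) auto
  next
    case (AMul a l)
    then obtain p :: "real poly" where "\<forall>X. real (etime a X) = poly p (real X)" by blast
    then show ?case by (intro exI[of _ "p + [:4, 4:]"]) auto
  next
    case (AMem a)
    then obtain p :: "real poly" where "\<forall>X. real (etime a X) = poly p (real X)" by blast
    then show ?case by (intro exI[of _ "p + 1"]) auto
  qed (auto intro!: exI[of _ "1"])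
  show ?thesis
  proof (induction c)
    case Nop
    show ?case by (intro exI[of _ "1"]) auto
  next
    case (Asg r a)
    from e[of a] obtain p :: "real poly" where "\<forall>X. real (etime a X) = poly p (real X)" by blast
    then show ?case by (intro exI[of _ "p + 1"]) auto
  next
    case (Sto a b)
    from e[of a] e[of b] obtain p q :: "real poly" where
      "\<forall>X. real (etime a X) = poly p (real X)" "\<forall>X. real (etime b X) = poly q (real X)" by blast
    then show ?case by (intro exI[of _ "p + q + 1"]) auto
  next
    case (Sq a b)
    then obtain p q :: "real poly" where
      "\<forall>X. real (time a X) = poly p (real X)" "\<forall>X. real (time b X) = poly q (real X)" by blast
    then show ?case by (intro exI[of _ "p + q"]) auto
  next
    case (Cond c a b)
    from Cond e[of c] obtain p q r :: "real poly" where
      "\<forall>X. real (time a X) = poly p (real X)" "\<forall>X. real (time b X) = poly q (real X)"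
      "\<forall>X. real (etime c X) = poly r (real X)" by blast
    then show ?case by (intro exI[of _ "p + q + r + 1"]) auto
  next
    case (For i l b)
    then obtain p :: "real poly" where "\<forall>X. real (time b X) = poly p (real X)" by blast
    then show ?case by (intro exI[of _ "[:0, 1:] * (p + [:4:]) + [:3:]"]) (auto simp: algebra_simps)
  qed
qed

section \<open>Weighted counting of list colourings\<close>

text \<open>The condition \<open>x \<noteq> y\<close> is there because \<open>adj\<close> will be
  reflexive.\<close>

definition cols :: "(nat \<Rightarrow> nat \<Rightarrow> bool) \<Rightarrow> nat set \<Rightarrow> (nat \<Rightarrow> nat \<Rightarrow> bool) \<Rightarrow> (nat \<Rightarrow> nat) set" where
  "cols adj A ls = {\<phi> \<in> A \<rightarrow>\<^sub>E {1, 2, 3}. (\<forall>v\<in>A. ls (\<phi> v) v) \<and>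
     (\<forall>x\<in>A. \<forall>y\<in>A. x \<noteq> y \<longrightarrow> adj x y \<longrightarrow> \<phi> x \<noteq> \<phi> y)}"

definition wcount :: "(nat \<Rightarrow> nat) \<Rightarrow> (nat \<Rightarrow> nat \<Rightarrow> bool) \<Rightarrow> nat set \<Rightarrow> (nat \<Rightarrow> nat \<Rightarrow> bool) \<Rightarrow> nat" where
  "wcount w adj A ls = (\<Sum>\<phi>\<in>cols adj A ls. \<Prod>v\<in>A. w (\<phi> v))"

lemma finite_cols: "finite A \<Longrightarrow> finite (cols adj A ls)"
  unfolding cols_def by (rule finite_subset[of _ "A \<rightarrow>\<^sub>E {1, 2, 3}"]) (auto intro!: finite_PiE)

lemma wcount_empty [simp]: "wcount w adj {} ls = 1"
  by (simp add: wcount_def cols_def)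

lemma wcount_no_color: "v \<in> A \<Longrightarrow> \<forall>c\<in>{1, 2, 3}. \<not> ls c v \<Longrightarrow> wcount w adj A ls = 0"
proof -
  assume v: "v \<in> A" "\<forall>c\<in>{1, 2, 3}. \<not> ls c v"
  have False if "\<phi> \<in> cols adj A ls" for \<phi>
  proof -
    have "\<phi> v \<in> {1, 2, 3}" "ls (\<phi> v) v" using that v(1) by (auto simp: cols_def dest: PiE_mem)
    with v(2) show False by blast
  qed
  then have "cols adj A ls = {}" by blast
  then show ?thesis by (simp add: wcount_def)
qed

text \<open>Case distinction on whether \<open>v\<close> has colour \<open>c\<close>. If so,
  deleting \<open>v\<close> gives a colouring of the rest with \<open>c\<close> struck from the
  lists of the neighbours; if not, the colouring survives striking \<open>c\<close> from the list of
  \<open>v\<close>.\<close>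

lemma wcount_branch:
  assumes "finite A" "v \<in> A" "c \<in> {1, 2, 3}" "ls c v" "\<And>x y. adj x y \<Longrightarrow> adj y x"
  shows "wcount w adj A ls = w c * wcount w adj (A - {v}) (\<lambda>d y. ls d y \<and> \<not> (d = c \<and> adj v y)) +
    wcount w adj A (\<lambda>d y. ls d y \<and> \<not> (d = c \<and> y = v))"
proof -
  define C1 where "C1 = {\<phi> \<in> cols adj A ls. \<phi> v = c}"
  define C2 where "C2 = {\<phi> \<in> cols adj A ls. \<phi> v \<noteq> c}"
  define B where "B = cols adj (A - {v}) (\<lambda>d y. ls d y \<and> \<not> (d = c \<and> adj v y))"
  have C: "cols adj A ls = C1 \<union> C2" "C1 \<inter> C2 = {}" by (auto simp: C1_def C2_def)
  have fin: "finite C1" "finite C2" using finite_cols[OF assms(1), of adj ls] by (simp_all add: C(1))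
  have 2: "C2 = cols adj A (\<lambda>d y. ls d y \<and> \<not> (d = c \<and> y = v))"
    using assms(2) by (auto simp: C2_def cols_def)
  \<comment> \<open>Colourings are extensional, so forgetting the colour of \<open>v\<close> means
    resetting it to \<open>undefined\<close>.\<close>
  have 1: "(\<Sum>\<phi>\<in>C1. \<Prod>u\<in>A. w (\<phi> u)) = (\<Sum>\<phi>\<in>B. w c * (\<Prod>u\<in>A - {v}. w (\<phi> u)))"
  proof (rule sum.reindex_bij_witness[of _ "\<lambda>\<psi>. \<psi>(v := c)" "\<lambda>\<phi>. \<phi>(v := undefined)"])
    fix \<phi> assume \<phi>: "\<phi> \<in> C1"
    then show "(\<phi>(v := undefined))(v := c) = \<phi>" by (auto simp: C1_def)
    have ph: "\<phi> \<in> A \<rightarrow>\<^sub>E {1, 2, 3}" "\<forall>u\<in>A. ls (\<phi> u) u"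
      "\<forall>x\<in>A. \<forall>y\<in>A. x \<noteq> y \<longrightarrow> adj x y \<longrightarrow> \<phi> x \<noteq> \<phi> y" "\<phi> v = c"
      using \<phi> by (auto simp: C1_def cols_def)
    have e: "\<phi>(v := undefined) \<in> (A - {v}) \<rightarrow>\<^sub>E {1, 2, 3}"
    proof (rule PiE_I)
      show "(\<phi>(v := undefined)) x \<in> {1, 2, 3}" if "x \<in> A - {v}" for x
        using that PiE_mem[OF ph(1), of x] by simp
      show "(\<phi>(v := undefined)) x = undefined" if "x \<notin> A - {v}" for x
        using that PiE_arb[OF ph(1), of x] by auto
    qed
    show "\<phi>(v := undefined) \<in> B"
      unfolding B_def cols_def using e ph(2,3,4) assms(2) by (auto simp: eq_commute)
    have "(\<Prod>u\<in>A. w (\<phi> u)) = w (\<phi> v) * (\<Prod>u\<in>A - {v}. w (\<phi> u))"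
      using assms(1,2) by (rule prod.remove)
    also have "(\<Prod>u\<in>A - {v}. w (\<phi> u)) = (\<Prod>u\<in>A - {v}. w ((\<phi>(v := undefined)) u))"
      by (rule prod.cong) auto
    finally show "w c * (\<Prod>u\<in>A - {v}. w ((\<phi>(v := undefined)) u)) = (\<Prod>u\<in>A. w (\<phi> u))"
      using ph(4) by simp
  next
    fix \<psi> assume \<psi>: "\<psi> \<in> B"
    have ps: "\<psi> \<in> (A - {v}) \<rightarrow>\<^sub>E {1, 2, 3}" "\<forall>u\<in>A - {v}. ls (\<psi> u) u \<and> \<not> (\<psi> u = c \<and> adj v u)"
      "\<forall>x\<in>A - {v}. \<forall>y\<in>A - {v}. x \<noteq> y \<longrightarrow> adj x y \<longrightarrow> \<psi> x \<noteq> \<psi> y"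
      using \<psi> by (auto simp: B_def cols_def)
    have "\<psi> v = undefined" using ps(1) by (auto simp: PiE_def extensional_def)
    then show "(\<psi>(v := c))(v := undefined) = \<psi>" by auto
    have e: "\<psi>(v := c) \<in> A \<rightarrow>\<^sub>E {1, 2, 3}"
    proof (rule PiE_I)
      show "(\<psi>(v := c)) x \<in> {1, 2, 3}" if "x \<in> A" for x
        using that PiE_mem[OF ps(1), of x] assms(3) by simp
      show "(\<psi>(v := c)) x = undefined" if "x \<notin> A" for x
        using that PiE_arb[OF ps(1), of x] assms(2) by auto
    qed
    have "(\<psi>(v := c)) x \<noteq> (\<psi>(v := c)) y" if "x \<in> A" "y \<in> A" "x \<noteq> y" "adj x y" for x y
      using that ps(2,3) assms(5)[of x y] by (cases "x = v"; cases "y = v") auto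
    moreover have "ls ((\<psi>(v := c)) u) u" if "u \<in> A" for u using that ps(2) assms(4) by auto
    ultimately show "\<psi>(v := c) \<in> C1" using e unfolding C1_def cols_def by auto
  qed
  have "wcount w adj A ls = (\<Sum>\<phi>\<in>C1. \<Prod>u\<in>A. w (\<phi> u)) + (\<Sum>\<phi>\<in>C2. \<Prod>u\<in>A. w (\<phi> u))"
    unfolding wcount_def C(1) using fin C(2) by (rule sum.union_disjoint)
  then show ?thesis unfolding 1 unfolding 2 by (simp add: wcount_def B_def sum_distrib_left)
qed

text \<open>Colourings of the two sides are independent and can be glued, and weights multiply. This
  is the identity that two consecutive calls on one accumulator realise.\<close>

lemma wcount_split:
  assumes "finite A" "C \<subseteq> A" "\<And>x y. x \<in> C \<Longrightarrow> y \<in> A - C \<Longrightarrow> \<not> adj x y \<and> \<not> adj y x"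
  shows "wcount w adj A ls = wcount w adj C ls * wcount w adj (A - C) ls"
proof -
  have "wcount w adj C ls * wcount w adj (A - C) ls =
    (\<Sum>(\<phi>, \<psi>)\<in>cols adj C ls \<times> cols adj (A - C) ls. (\<Prod>v\<in>C. w (\<phi> v)) * (\<Prod>v\<in>A - C. w (\<psi> v)))"
    unfolding wcount_def by (simp add: sum_product sum.cartesian_product)
  also have "\<dots> = wcount w adj A ls"
    unfolding wcount_def
  proof (rule sum.reindex_bij_witness[of _ "\<lambda>\<chi>. (restrict \<chi> C, restrict \<chi> (A - C))"
        "\<lambda>(\<phi>, \<psi>) v. if v \<in> C then \<phi> v else \<psi> v"])
    fix p assume "p \<in> cols adj C ls \<times> cols adj (A - C) ls"
    then obtain \<phi> \<psi> where p: "p = (\<phi>, \<psi>)" "\<phi> \<in> cols adj C ls" "\<psi> \<in> cols adj (A - C) ls" by auto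
    have ph: "\<phi> \<in> C \<rightarrow>\<^sub>E {1, 2, 3}" "\<psi> \<in> (A - C) \<rightarrow>\<^sub>E {1, 2, 3}" using p by (auto simp: cols_def)
    let ?c = "\<lambda>v. if v \<in> C then \<phi> v else \<psi> v"
    have "restrict ?c C = \<phi>" "restrict ?c (A - C) = \<psi>"
      using ph by (auto simp: PiE_def extensional_def restrict_def fun_eq_iff)
    then show "(restrict ((\<lambda>(\<phi>, \<psi>) v. if v \<in> C then \<phi> v else \<psi> v) p) C,
        restrict ((\<lambda>(\<phi>, \<psi>) v. if v \<in> C then \<phi> v else \<psi> v) p) (A - C)) = p"
      by (simp add: p(1))
    have e: "?c \<in> A \<rightarrow>\<^sub>E {1, 2, 3}"
    proof (rule PiE_I)
      show "?c x \<in> {1, 2, 3}" if "x \<in> A" for x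
        using that PiE_mem[OF ph(1), of x] PiE_mem[OF ph(2), of x] by simp
      show "?c x = undefined" if "x \<notin> A" for x
        using that PiE_arb[OF ph(2), of x] assms(2) by auto
    qed
    have "?c x \<noteq> ?c y" if "x \<in> A" "y \<in> A" "x \<noteq> y" "adj x y" for x y
      using that p(2,3) assms(3)[of x y] assms(3)[of y x] by (auto simp: cols_def)
    moreover have "ls (?c x) x" if "x \<in> A" for x using that p(2,3) by (auto simp: cols_def)
    ultimately show "(\<lambda>(\<phi>, \<psi>) v. if v \<in> C then \<phi> v else \<psi> v) p \<in> cols adj A ls"
      using e by (simp add: p(1) cols_def)
    have "(\<Prod>v\<in>A. w (?c v)) = (\<Prod>v\<in>A - C. w (?c v)) * (\<Prod>v\<in>C. w (?c v))"
      using assms(2,1) by (rule prod.subset_diff)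
    also have "(\<Prod>v\<in>A - C. w (?c v)) = (\<Prod>v\<in>A - C. w (\<psi> v))" by (rule prod.cong) auto
    finally show "(\<Prod>v\<in>A. w ((\<lambda>(\<phi>, \<psi>) v. if v \<in> C then \<phi> v else \<psi> v) p v)) =
      (case p of (\<phi>, \<psi>) \<Rightarrow> (\<Prod>v\<in>C. w (\<phi> v)) * (\<Prod>v\<in>A - C. w (\<psi> v)))"
      by (simp add: p(1) mult.commute)
  next
    fix \<chi> assume c: "\<chi> \<in> cols adj A ls"
    then have e: "\<chi> \<in> A \<rightarrow>\<^sub>E {1, 2, 3}" by (simp add: cols_def)
    then show "(\<lambda>(\<phi>, \<psi>) v. if v \<in> C then \<phi> v else \<psi> v) (restrict \<chi> C, restrict \<chi> (A - C)) = \<chi>"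
      using assms(2) by (auto simp: fun_eq_iff PiE_def extensional_def)
    have "restrict \<chi> C \<in> C \<rightarrow>\<^sub>E {1, 2, 3}" "restrict \<chi> (A - C) \<in> (A - C) \<rightarrow>\<^sub>E {1, 2, 3}"
      using e assms(2) by (auto dest: PiE_mem)
    then show "(restrict \<chi> C, restrict \<chi> (A - C)) \<in> cols adj C ls \<times> cols adj (A - C) ls"
      using c assms(2) unfolding cols_def by (simp add: subset_iff)
  qed
  finally show ?thesis by simp
qed

section \<open>The program\<close>

text \<open>
  An instance occupies a frame of \<open>rK = 4 * n + 1\<close> cells starting at \<open>rF\<close>: block \<open>0\<close> of \<open>n\<close> cells holds
  the marks of the vertices, block \<open>c\<close> the bits telling whether colour \<open>c\<close> is still in their lists, and
  the last cell saves the accumulator. The marks are \<open>0\<close> for deleted vertices, \<open>1\<close> and \<open>3\<close> for those still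
  to be coloured, and \<open>2\<close> for coloured vertices; in phase 2, \<open>3\<close> and \<open>2\<close> are the neighbours of the current
  pivot. A call may change its own frame and everything above it, but nothing below.
\<close>

abbreviation (input) "rN \<equiv> 19 :: nat"
abbreviation (input) "rK \<equiv> 2 :: nat"
abbreviation (input) "rD \<equiv> 3 :: nat"
abbreviation (input) "rF \<equiv> 4 :: nat"
abbreviation (input) "rW \<equiv> 5 :: nat"
abbreviation (input) "rV \<equiv> 6 :: nat"
abbreviation (input) "rC \<equiv> 7 :: nat"
abbreviation (input) "rX \<equiv> 8 :: nat"
abbreviation (input) "rY \<equiv> 9 :: nat"
abbreviation (input) "rZ \<equiv> 10 :: nat"
abbreviation (input) "rT \<equiv> 11 :: nat"
abbreviation (input) "rI \<equiv> 12 :: nat"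
abbreviation (input) "rA \<equiv> 13 :: nat"
abbreviation (input) "rB \<equiv> 14 :: nat"
abbreviation (input) "rG \<equiv> 15 :: nat"
abbreviation (input) "rQ \<equiv> 16 :: nat"
abbreviation (input) "rE \<equiv> 17 :: nat"
abbreviation (input) "rL \<equiv> 18 :: nat"

text \<open>\<open>own\<close> and \<open>child\<close> are addresses in the current frame and in
  the one directly above it; \<open>edge\<close> reads the adjacency matrix, which stays at address
  \<open>0\<close>. As subtraction is truncated, \<open>neq\<close> is the absolute
  difference.\<close>

definition "own b y = AVar rF \<oplus> b \<otimes> rN \<oplus> y"
definition "child b y = AVar rF \<oplus> AVar rK \<oplus> b \<otimes> rN \<oplus> y"
definition "edge x y = AMem (x \<otimes> rN \<oplus> y)"
definition "neq a b = (a \<ominus> b) \<oplus> (b \<ominus> a)"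

definition "copy_frame =
  For rI rK (Sto (AVar rF \<oplus> AVar rK \<oplus> AVar rI) (AMem (AVar rF \<oplus> AVar rI)))"

text \<open>The mark \<open>m\<close> is \<open>0\<close> in phase 1, where a coloured vertex leaves
  the graph for good, and \<open>2\<close> in phase 2, where it remains as a candidate for the next
  pivot.\<close>

definition "assign m =
  Sto (child (ANum 0) (AVar rV)) (ANum m) ;;
  For rI rN (Cond (edge (AVar rV) (AVar rI)) (Sto (child (AVar rC) (AVar rI)) (ANum 0)) Nop)"

definition "double_W = rW \<leftarrow> AVar rW \<oplus> AVar rW"

text \<open>All weights are powers of two, so multiplying by them is repeated doubling:
  \<open>rK\<close> times for colour \<open>2\<close>, \<open>rK * rK\<close> times for colour
  \<open>3\<close>.\<close>

definition "weigh =
  Cond (AVar rC \<ominus> ANum 1)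
    (Cond (AVar rC \<ominus> ANum 2) (For rA rK (For rI rK double_W)) (For rI rK double_W)) Nop"

text \<open>Both calls of a branching must start from the same accumulator. The last cell of the
  frame holds it during the first call and holds the result of the first call during the second. The
  second call also gets a copy of the frame, made after \<open>c\<close> was struck from the list of
  \<open>v\<close>, since running in place could destroy the saved cell.\<close>

definition "pre_branch m =
  copy_frame ;; assign m ;; Sto (own (AVar rC) (AVar rV)) (ANum 0) ;;
  Sto (own (ANum 4) (ANum 0)) (AVar rW) ;; weigh ;; rF \<leftarrow> AVar rF \<oplus> AVar rK"

definition "mid_branch =
  rF \<leftarrow> AVar rF \<ominus> AVar rK ;; rT \<leftarrow> AMem (own (ANum 4) (ANum 0)) ;;
  Sto (own (ANum 4) (ANum 0)) (AVar rW) ;; rW \<leftarrow> AVar rT ;; copy_frame ;; rF \<leftarrow> AVar rF \<oplus> AVar rK"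

definition "post_branch =
  rF \<leftarrow> AVar rF \<ominus> AVar rK ;; rW \<leftarrow> AVar rW \<oplus> AMem (own (ANum 4) (ANum 0))"

definition branch :: "nat \<Rightarrow> nat \<Rightarrow> com" where
  "branch p m = Seq (comp (pre_branch m)) (Seq (Call p) (Seq (comp mid_branch) (Seq (Call p) (comp post_branch))))"

definition "find_mark m =
  For rI rN (Cond (neq (AMem (own (ANum 0) (AVar rI))) (ANum m)) Nop (rV \<leftarrow> AVar rI ;; rX \<leftarrow> ANum 1))"

definition "try_color c = Cond (AMem (own (ANum c) (AVar rV))) (rC \<leftarrow> ANum c ;; rX \<leftarrow> ANum 1) Nop"
definition "find_color = rX \<leftarrow> ANum 0 ;; try_color 1 ;; try_color 2 ;; try_color 3"

definition "seed =
  For rI rN (Cond (edge (AVar rV) (AVar rI))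
    (Cond (neq (AMem (own (ANum 0) (AVar rI))) (ANum 1)) (Sto (child (ANum 0) (AVar rI)) (ANum 0))
      (Sto (child (ANum 0) (AVar rI)) (ANum 3)))
    (Sto (child (ANum 0) (AVar rI)) (ANum 0)))"

definition "spread =
  For rI rN (Cond (AMem (child (ANum 0) (AVar rI))) Nop
    (Cond (neq (AMem (own (ANum 0) (AVar rI))) (ANum 1)) Nop
      (Cond (edge (AVar rB) (AVar rI)) (Sto (child (ANum 0) (AVar rI)) (ANum 1)) Nop)))"

definition "closure_round = For rB rN (Cond (AMem (child (ANum 0) (AVar rB))) spread Nop)"

definition "erase =
  For rI rN (Cond (AMem (child (ANum 0) (AVar rI))) (Sto (own (ANum 0) (AVar rI)) (ANum 0)) Nop)"

text \<open>The search builds the part in the child frame; \<open>erase\<close> then removes it from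
  the own frame, and so does the last store with the pivot, which is used up.\<close>

definition "split_off =
  copy_frame ;; seed ;; For rA rN closure_round ;; erase ;;
  Sto (own (ANum 0) (AVar rV)) (ANum 0) ;; rF \<leftarrow> AVar rF \<oplus> AVar rK"

definition color_step :: com where
  "color_step = Seq (comp find_color) (IfNZ rX (branch 2 2) (comp (rW \<leftarrow> ANum 0)))"

text \<open>The second call runs in place: nothing is needed afterwards, and it continues with the
  accumulator that the first call left, which multiplies the two values.\<close>

definition split_step :: com where
  "split_step = Seq (comp split_off) (Seq (Call 2) (Seq (comp (rF \<leftarrow> AVar rF \<ominus> AVar rK)) (Call 2)))"

text \<open>\<open>find_mark 2\<close> comes after \<open>find_mark 1\<close> and overrides its
  answer, so an uncoloured vertex becomes a pivot only if there is no candidate.\<close>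

definition rec2 :: com where
  "rec2 = Seq (comp (rX \<leftarrow> ANum 0 ;; find_mark 3)) (IfNZ rX color_step
     (Seq (comp (rX \<leftarrow> ANum 0 ;; find_mark 1 ;; find_mark 2)) (IfNZ rX split_step (comp Nop))))"

definition "pick = rV \<leftarrow> AVar rA ;; rC \<leftarrow> AVar rB ;; rX \<leftarrow> ANum 1"

definition "count_nbrs =
  For rI rN (Cond (AMem (own (ANum 0) (AVar rI))) (Cond (AMem (own (AVar rB) (AVar rI)))
    (Cond (edge (AVar rA) (AVar rI)) (rT \<leftarrow> AVar rT \<oplus> ANum 1) Nop) Nop) Nop)"

text \<open>The last colour of a list is also branched on, even with few neighbours, so that phase 2
  starts with lists of at least two colours.\<close>

definition "try_pair c =
  rB \<leftarrow> ANum c ;; Cond (AMem (own (ANum c) (AVar rA)))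
    (rT \<leftarrow> ANum 0 ;; count_nbrs ;; Cond (neq (AVar rZ) (ANum 1)) (Cond (AVar rD \<ominus> AVar rT) Nop pick) pick) Nop"

definition "list_size c = Cond (AMem (own (ANum c) (AVar rA))) (rZ \<leftarrow> AVar rZ \<oplus> ANum 1) Nop"

definition "select =
  rX \<leftarrow> ANum 0 ;; rY \<leftarrow> ANum 0 ;;
  For rA rN (Cond (AMem (own (ANum 0) (AVar rA)))
    (rZ \<leftarrow> ANum 0 ;; list_size 1 ;; list_size 2 ;; list_size 3 ;; Cond (AVar rZ) Nop (rY \<leftarrow> ANum 1) ;;
     try_pair 1 ;; try_pair 2 ;; try_pair 3) Nop)"

definition rec1 :: com where
  "rec1 = Seq (comp select) (IfNZ rY (comp (rW \<leftarrow> ANum 0)) (IfNZ rX (branch 1 0) (Call 2)))"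

section \<open>Code for initialisation and for reading off the result\<close>

definition "init_size = rN \<leftarrow> AVar 0 ;; rK \<leftarrow> AVar 0 \<oplus> AVar 0 \<oplus> AVar 0 \<oplus> AVar 0 \<oplus> ANum 1"

text \<open>Logarithm and square root are obtained by counting: the first loop counts the powers of
  two up to \<open>n\<close>, the second the squares below \<open>n\<close> times that number. The
  squares are kept up to date by adding \<open>2 * i + 1\<close>.\<close>

definition "init_degree =
  rX \<leftarrow> ANum 0 ;; rT \<leftarrow> ANum 1 ;;
  For rI rN (Cond (AVar rT \<ominus> AVar rN) Nop (rX \<leftarrow> AVar rX \<oplus> ANum 1) ;; rT \<leftarrow> AVar rT \<oplus> AVar rT) ;;
  rY \<leftarrow> AVar rX \<otimes> rN ;; rD \<leftarrow> ANum 1 ;; rZ \<leftarrow> ANum 0 ;;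
  For rI rN (Cond (AVar rY \<ominus> AVar rZ) (rD \<leftarrow> AVar rD \<oplus> ANum 1) Nop ;;
    rZ \<leftarrow> AVar rZ \<oplus> AVar rI \<oplus> AVar rI \<oplus> ANum 1)"

definition "init_list c =
  Sto (own (ANum (Suc c)) (AVar rI)) (AMem (AVar rN \<otimes> rN \<oplus> (AVar rI \<oplus> AVar rI \<oplus> AVar rI) \<oplus> ANum c))"

text \<open>The first loop sets the diagonal of the adjacency matrix, which makes adjacency
  reflexive. The first frame starts right after the input, so the list bits can still be read while
  they are copied.\<close>

definition "init_frame =
  For rI rN (Sto (AVar rI \<otimes> rN \<oplus> AVar rI) (ANum 1)) ;;
  rF \<leftarrow> AVar rN \<otimes> rN \<oplus> AVar rN \<oplus> AVar rN \<oplus> AVar rN ;;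
  For rI rN (Sto (own (ANum 0) (AVar rI)) (ANum 1) ;; init_list 0 ;; init_list 1 ;; init_list 2) ;;
  rW \<leftarrow> ANum 1"

text \<open>Three nested loops leave room for \<open>rK ^ 3\<close> doublings, enough for every bit
  position of the final accumulator; rounds after \<open>rZ\<close> has reached \<open>0\<close> do
  nothing.\<close>

definition "compute_power =
  rQ \<leftarrow> ANum 1 ;; rZ \<leftarrow> AVar rE ;;
  For rX rK (For rY rK (For rI rK
    (Cond (AVar rZ) (rQ \<leftarrow> AVar rQ \<oplus> AVar rQ ;; rZ \<leftarrow> AVar rZ \<ominus> ANum 1) Nop)))"

text \<open>Without shifts, bits are read from the top: compare with \<open>2 ^ rE\<close>, subtract
  if possible, and append the answer to \<open>rT\<close>. The test is nonzero exactly if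
  \<open>rQ\<close> is at most \<open>rW\<close>.\<close>

definition "next_digit =
  rT \<leftarrow> ANum 0 ;; For rG rK (rE \<leftarrow> AVar rE \<ominus> ANum 1 ;; compute_power ;; rT \<leftarrow> AVar rT \<oplus> AVar rT ;;
    Cond (ANum 1 \<oplus> AVar rW \<ominus> AVar rQ) (rW \<leftarrow> AVar rW \<ominus> AVar rQ ;; rT \<leftarrow> AVar rT \<oplus> ANum 1) Nop)"

definition "far a b = neq (AVar a) (AVar b) \<ominus> ANum 1"

text \<open>The highest digit comes first, so \<open>rA\<close> and \<open>rB\<close> count down the
  sizes of the classes of colours \<open>3\<close> and \<open>2\<close>; the size of the third class
  follows from \<open>n\<close>.\<close>

definition "extract =
  rE \<leftarrow> ANum 1 \<otimes> rK \<otimes> rK \<otimes> rK ;; 0 \<leftarrow> ANum 0 ;;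
  For rA rK (For rB rK (next_digit ;;
    rC \<leftarrow> AVar rK \<ominus> ANum 1 \<ominus> AVar rA ;; rV \<leftarrow> AVar rK \<ominus> ANum 1 \<ominus> AVar rB ;;
    rL \<leftarrow> AVar rN \<ominus> AVar rC \<ominus> AVar rV ;;
    Cond (far rC rV \<oplus> far rC rL \<oplus> far rV rL) Nop (0 \<leftarrow> AVar 0 \<oplus> AVar rT)))"

text \<open>\<open>init_size\<close> is compiled separately because it sets the registers that are
  loop limits in all later code, while a compiled statement must not modify its own limits.\<close>

definition main :: com where
  "main = Seq (comp init_size) (Seq (comp (init_degree ;; init_frame)) (Seq (Call 1) (comp extract)))"

text \<open>One program serves all \<open>t\<close>; the excluded path enters the analysis of the
  running time only.\<close>

definition prog :: program where
  "prog = [main, rec1, rec2]"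

section \<open>Total correctness with a time bound\<close>

definition runs :: "com \<Rightarrow> state \<Rightarrow> real \<Rightarrow> (state \<Rightarrow> bool) \<Rightarrow> bool" where
  "runs c s T Q \<longleftrightarrow> (\<exists>k s'. exec prog c s k s' \<and> real k \<le> T \<and> Q s')"

lemma runs_mono: "runs c s T Q \<Longrightarrow> T \<le> T' \<Longrightarrow> (\<And>s'. Q s' \<Longrightarrow> Q' s') \<Longrightarrow> runs c s T' Q'"
  unfolding runs_def by (meson order_trans)

lemma runs_Seq:
  assumes "runs c1 s T1 Q1" "\<And>s'. Q1 s' \<Longrightarrow> runs c2 s' T2 Q"
  shows "runs (Seq c1 c2) s (T1 + T2) Q"
proof -
  obtain k s1 where 1: "exec prog c1 s k s1" "real k \<le> T1" "Q1 s1" using assms(1) by (auto simp: runs_def)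
  obtain l s2 where 2: "exec prog c2 s1 l s2" "real l \<le> T2" "Q s2"
    using assms(2)[OF 1(3)] by (auto simp: runs_def)
  show ?thesis unfolding runs_def
    by (rule exI[of _ "k + l"], rule exI[of _ s2]) (use 1 2 exec.Seq[OF 1(1) 2(1)] in auto)
qed

lemma runs_IfNZ:
  assumes "fst s a \<noteq> 0 \<Longrightarrow> runs c1 s T Q" "fst s a = 0 \<Longrightarrow> runs c2 s T Q"
  shows "runs (IfNZ a c1 c2) s (T + 1) Q"
proof (cases "fst s a = 0")
  case True
  then obtain k s1 where 1: "exec prog c2 s k s1" "real k \<le> T" "Q s1" using assms(2) by (auto simp: runs_def)
  show ?thesis unfolding runs_def
    by (rule exI[of _ "k + 1"], rule exI[of _ s1]) (use 1 exec.IfFalse[OF True 1(1)] in auto)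
next
  case False
  then obtain k s1 where 1: "exec prog c1 s k s1" "real k \<le> T" "Q s1" using assms(1) by (auto simp: runs_def)
  show ?thesis unfolding runs_def
    by (rule exI[of _ "k + 1"], rule exI[of _ s1]) (use 1 exec.IfTrue[OF False 1(1)] in auto)
qed

lemma runs_Call:
  assumes "i < length prog" "runs (prog ! i) s T Q"
  shows "runs (Call i) s (T + 1) Q"
proof -
  obtain k s1 where 1: "exec prog (prog ! i) s k s1" "real k \<le> T" "Q s1"
    using assms(2) by (auto simp: runs_def)
  show ?thesis unfolding runs_def
    by (rule exI[of _ "k + 1"], rule exI[of _ s1]) (use 1 exec.Call[OF assms(1) 1(1)] in auto)
qed

lemma runs_comp:
  assumes "wfs c" "lims c \<inter> mods c = {}" "\<forall>l\<in>lims c. R l \<le> X"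
    "\<And>R1. agree R1 (fst (sem c (R, M))) \<Longrightarrow> Q (R1, snd (sem c (R, M)))"
  shows "runs (comp c) (R, M) (real (time c X)) Q"
  using exec_comp[OF assms(1-3) agree_refl, of prog M] assms(4) unfolding runs_def by (metis of_nat_le_iff)

section \<open>Addresses within frames\<close>

lemma addr_eq_iff:
  fixes n :: nat
  assumes "y < n" "y' < n"
  shows "d * n + y = d' * n + y' \<longleftrightarrow> d = d' \<and> y = y'"
proof
  assume e: "d * n + y = d' * n + y'"
  have "d = (d * n + y) div n" "d' = (d' * n + y') div n" using assms by auto
  then have "d = d'" using e by simp
  with e show "d = d' \<and> y = y'" by simp
qed auto

lemma addr_less:
  fixes n :: nat
  assumes "d < k" "y < n"
  shows "d * n + y < k * n"
proof -
  have "d * n + y < Suc d * n" using assms(2) by simp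
  also have "\<dots> \<le> k * n" using assms(1) by (intro mult_le_mono1) simp
  finally show ?thesis .
qed

lemmas expr_defs = own_def child_def edge_def neq_def

definition shifted :: "nat \<Rightarrow> nat \<Rightarrow> nat \<Rightarrow> (nat \<Rightarrow> nat) \<Rightarrow> nat \<Rightarrow> nat" where
  "shifted F K k M = (\<lambda>a. if F + K \<le> a \<and> a < F + K + k then M (a - K) else M a)"

lemma sem_copy_frame:
  obtains R' where "sem copy_frame (R, M) = (R', shifted (R rF) (R rK) (R rK) M)"
    "\<And>r. r \<noteq> rI \<Longrightarrow> R' r = R r"
proof -
  let ?b = "Sto (AVar rF \<oplus> AVar rK \<oplus> AVar rI) (AMem (AVar rF \<oplus> AVar rI))"
  have wf: "wfs (For rI rK ?b)" by simp
  show thesis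
  proof (rule sem_For[OF wf, of "\<lambda>j R' M'. M' = shifted (R rF) (R rK) j M" R M], goal_cases)
    case 1
    show ?case by (auto simp: shifted_def fun_eq_iff)
  next
    case (2 j R' M')
    have "R' rF = R rF" "R' rK = R rK" using 2(4)[of rF] 2(4)[of rK] by simp_all
    then show ?case using 2(1-3) by (auto simp: shifted_def fun_eq_iff)
  next
    case (3 R2 M2)
    show ?case
      by (rule that[of R2]) (use 3 in \<open>auto simp: copy_frame_def simp del: sem.simps\<close>)
  qed
qed

section \<open>Correctness of the blocks\<close>

text \<open>Kronecker substitution: the generating polynomial of the sizes of two colour classes is
  evaluated at \<open>2 ^ K\<close> and \<open>2 ^ (K * K)\<close>, from which its coefficients can
  be read off.\<close>

definition wt :: "nat \<Rightarrow> nat \<Rightarrow> nat" where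
  "wt K c = (if c = 2 then 2 ^ K else if c = 3 then 2 ^ (K * K) else 1)"

text \<open>Edges and lists are determined by cells being nonzero. The bound
  \<open>n * n \<le> F\<close> keeps the adjacency matrix below every frame, and the last cell of
  the frame is left free for saving the accumulator.\<close>

definition encodes :: "nat \<Rightarrow> (nat \<Rightarrow> nat \<Rightarrow> bool) \<Rightarrow> nat \<Rightarrow> (nat \<Rightarrow> nat) \<Rightarrow> (nat \<Rightarrow> nat) \<Rightarrow> (nat \<Rightarrow> nat \<Rightarrow> bool) \<Rightarrow> bool" where
  "encodes n adj F M mk ls \<longleftrightarrow> n * n \<le> F \<and> (\<forall>x<n. \<forall>y<n. M (x * n + y) \<noteq> 0 \<longleftrightarrow> adj x y) \<and>
     (\<forall>y<n. M (F + y) = mk y) \<and> (\<forall>d\<in>{1, 2, 3}. \<forall>y<n. M (F + (d * n + y)) \<noteq> 0 \<longleftrightarrow> ls d y)"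

lemma encodesD:
  assumes "encodes n adj F M mk ls"
  shows "n * n \<le> F" "x < n \<Longrightarrow> y < n \<Longrightarrow> M (x * n + y) \<noteq> 0 \<longleftrightarrow> adj x y"
    "y < n \<Longrightarrow> M (F + y) = mk y" "d \<in> {1, 2, 3} \<Longrightarrow> y < n \<Longrightarrow> M (F + (d * n + y)) \<noteq> 0 \<longleftrightarrow> ls d y"
    "x < n \<Longrightarrow> y < n \<Longrightarrow> x * n + y < F"
proof -
  show "x < n \<Longrightarrow> y < n \<Longrightarrow> x * n + y < F"
    using addr_less[of x n y n] assms by (auto simp: encodes_def)
qed (use assms in \<open>auto simp: encodes_def\<close>)

lemma sem_assign:
  fixes R M
  defines "n \<equiv> R rN" and "B \<equiv> R rF + R rK" and "v \<equiv> R rV" and "c \<equiv> R rC"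
  assumes "\<And>y. y < n \<Longrightarrow> v * n + y < B" "v < n"
  obtains R' where "sem (assign m) (R, M) = (R', \<lambda>a. if \<exists>y<n. a = B + (c * n + y) \<and> M (v * n + y) \<noteq> 0 then 0
      else if a = B + v then m else M a)" "\<And>r. r \<noteq> rI \<Longrightarrow> R' r = R r"
proof -
  define M1 where "M1 = M(B + v := m)"
  define Mj where "Mj j a = (if \<exists>y<j. a = B + (c * n + y) \<and> M (v * n + y) \<noteq> 0 then 0 else M1 a)" for j :: nat and a
  let ?b = "Cond (edge (AVar rV) (AVar rI)) (Sto (child (AVar rC) (AVar rI)) (ANum 0)) Nop"
  have 1: "sem (Sto (child (ANum 0) (AVar rV)) (ANum m)) (R, M) = (R, M1)"
    by (simp add: expr_defs M1_def B_def v_def)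
  have wf: "wfs (For rI rN ?b)" by (simp add: expr_defs)
  obtain R2 M2 where 2: "sem (For rI rN ?b) (R, M1) = (R2, M2)" "M2 = Mj (R rN)"
    "\<And>r. r \<notin> mods (For rI rN ?b) \<Longrightarrow> R2 r = R r"
  proof (rule sem_For[OF wf, of "\<lambda>j R' M'. M' = Mj j" R M1])
    show "M1 = Mj 0" by (simp add: Mj_def fun_eq_iff)
    fix j R' M'
    assume j: "j < R rN" "M' = Mj j" "R' rI = j" and keep: "\<And>r. r \<noteq> rI \<Longrightarrow> r \<notin> mods ?b \<Longrightarrow> R' r = R r"
    have R': "R' rV = v" "R' rC = c" "R' rN = n" "R' rF + R' rK = B"
      using keep[of rV] keep[of rC] keep[of rN] keep[of rF] keep[of rK] by (simp_all add: n_def B_def v_def c_def)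
    have "v * n + j < B" using assms(5) j(1) by (simp add: n_def)
    then have e: "M' (v * n + j) = M (v * n + j)" by (auto simp: j(2) Mj_def M1_def)
    have "snd (sem ?b (R', M')) = (if M (v * n + j) \<noteq> 0 then M'(B + (c * n + j) := 0) else M')"
      using R' j(3) e by (simp add: edge_def child_def add.assoc[symmetric])
    also have "\<dots> = Mj (Suc j)"
      unfolding j(2) Mj_def by (auto simp: fun_eq_iff less_Suc_eq)
    finally show "snd (sem ?b (R', M')) = Mj (Suc j)" .
  qed blast
  have "sem (assign m) (R, M) = (R2, Mj n)" unfolding assign_def using 1 2 by (simp add: n_def)
  moreover have "Mj n = (\<lambda>a. if \<exists>y<n. a = B + (c * n + y) \<and> M (v * n + y) \<noteq> 0 then 0
      else if a = B + v then m else M a)" unfolding Mj_def M1_def fun_upd_def by (rule refl)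
  moreover have "R2 r = R r" if "r \<noteq> rI" for r using 2(3) that by simp
  ultimately show thesis using that by simp
qed

lemma sem_weigh:
  obtains R' where "sem weigh (R, M) = (R', M)" "R rC \<in> {1, 2, 3} \<Longrightarrow> R' rW = R rW * wt (R rK) (R rC)"
    "\<And>r. r \<notin> {rI, rA, rW} \<Longrightarrow> R' r = R r"
proof -
  have wf: "wfs (For rI rK double_W)" "wfs (For rA rK (For rI rK double_W))" by (simp_all add: double_W_def)
  have pu: "pure (For rI rK double_W)" "pure weigh" by (simp_all add: double_W_def weigh_def)
  have 1: "fst (sem (For rI rK double_W) (R, M)) rW = R rW * 2 ^ R rK" for R M
  proof (rule sem_For[OF wf(1), of "\<lambda>j R' M'. R' rW = R rW * 2 ^ j" R M])
  qed (auto simp: double_W_def)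
  have 2: "fst (sem (For rA rK (For rI rK double_W)) (R, M)) rW = R rW * 2 ^ (R rK * R rK)" for R M
  proof (rule sem_For[OF wf(2), of "\<lambda>j R' M'. R' rW = R rW * 2 ^ (j * R rK)" R M])
    fix j R' M'
    assume h: "j < R rK" "R' rW = R rW * 2 ^ (j * R rK)" "R' rA = j"
      "\<And>r. r \<noteq> rA \<Longrightarrow> r \<notin> mods (For rI rK double_W) \<Longrightarrow> R' r = R r"
    have "R' rK = R rK" using h(4)[of rK] by (simp add: double_W_def)
    then show "((fst (sem (For rI rK double_W) (R', M')))(rA := Suc j)) rW = R rW * 2 ^ (Suc j * R rK)"
      using 1[of R' M'] h(2) by (simp add: power_add mult.assoc del: sem.simps)
  qed auto
  have "fst (sem weigh (R, M)) r = R r" if "r \<notin> {rI, rA, rW}" for r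
    using sem_mods[of r weigh "(R, M)"] that by (simp add: weigh_def double_W_def)
  moreover have "fst (sem weigh (R, M)) rW = R rW * wt (R rK) (R rC)" if "R rC \<in> {1, 2, 3}"
    using that 1[of R M] 2[of R M] by (auto simp: weigh_def wt_def simp del: sem.simps(6))
  moreover have "sem weigh (R, M) = (fst (sem weigh (R, M)), M)"
    using sem_pure[OF pu(2), of "(R, M)"] by (simp add: prod_eq_iff)
  ultimately show thesis using that by blast
qed

text \<open>Both subinstances are present at once, the coloured one in the child frame and the one
  without \<open>c\<close> at \<open>v\<close> in the own frame. Cells of different blocks or frames
  have different addresses, so the content of each can be determined separately.\<close>

lemma sem_pre_branch:
  assumes enc: "encodes n adj F M mk ls" and R: "R rF = F" "R rN = n" "R rK = 4 * n + 1"
    and v: "R rV = v" "v < n" and c: "R rC = c" "c \<in> {1, 2, 3}"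
  obtains R' M' where "sem (pre_branch m) (R, M) = (R', M')"
    "encodes n adj (F + R rK) M' (mk(v := m)) (\<lambda>d y. ls d y \<and> \<not> (d = c \<and> adj v y))"
    "encodes n adj F M' mk (\<lambda>d y. ls d y \<and> \<not> (d = c \<and> y = v))"
    "M' (F + 4 * n) = R rW" "\<And>a. a < F \<Longrightarrow> M' a = M a" "R' rF = F + R rK" "R' rW = R rW * wt (R rK) c"
    "R' rN = n" "R' rK = R rK" "R' rD = R rD"
proof -
  define K where "K = R rK"
  have K: "K = 4 * n + 1" using R by (simp add: K_def)
  note e = encodesD[OF enc]
  obtain R1 where 1: "sem copy_frame (R, M) = (R1, shifted F K K M)" "\<And>r. r \<noteq> rI \<Longrightarrow> R1 r = R r"
    by (rule sem_copy_frame[of R M, unfolded R(1) K_def[symmetric]]) blast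
  define M1 where "M1 = shifted F K K M"
  have M1: "M1 (v * n + y) = M (v * n + y)" if "y < n" for y
    using e(5)[OF v(2) that] by (simp add: M1_def shifted_def)
  have lt: "v * n + y < F + K" if "y < n" for y using e(5)[OF v(2) that] by simp
  have R1eq: "R1 rN = n" "R1 rF + R1 rK = F + K" "R1 rV = v" "R1 rC = c"
    using 1(2) R v c by (simp_all add: K_def)
  obtain R2 where 2: "sem (assign m) (R1, M1) = (R2, \<lambda>a. if \<exists>y<n. a = F + K + (c * n + y) \<and> M1 (v * n + y) \<noteq> 0 then 0
      else if a = F + K + v then m else M1 a)" "\<And>r. r \<noteq> rI \<Longrightarrow> R2 r = R1 r"
    apply (rule sem_assign[where R = R1 and M = M1 and m = m, unfolded R1eq, OF lt v(2)])
     apply assumption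
    subgoal premises p for R' by (rule p(1)[OF p(2,3)])
    done
  define M2 where "M2 = (\<lambda>a. if \<exists>y<n. a = F + K + (c * n + y) \<and> M1 (v * n + y) \<noteq> 0 then 0
      else if a = F + K + v then m else M1 a)"
  have R2: "R2 r = R r" if "r \<noteq> rI" for r using 1(2) 2(2) that by simp
  define M3 where "M3 = M2(F + (c * n + v) := 0, F + 4 * n := R rW)"
  have R2eq: "R2 rK = K" "R2 rC = c" "R2 rW = R rW" using R2 c by (simp_all add: K_def)
  obtain R3 where 3: "sem weigh (R2, M3) = (R3, M3)" "R3 rW = R rW * wt K c" "\<And>r. r \<notin> {rI, rA, rW} \<Longrightarrow> R3 r = R2 r"
    using c by (rule_tac sem_weigh[of R2 M3, unfolded R2eq]) blast
  have "sem (pre_branch m) (R, M) = (R3(rF := R3 rF + R3 rK), M3)"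
    unfolding pre_branch_def sem.simps(4) 1(1) M1_def[symmetric] 2(1) M2_def[symmetric]
    using 3(1) R2 R v c by (simp add: own_def M3_def add.assoc)
  moreover have R3: "R3 r = R r" if "r \<notin> {rI, rA, rW}" for r using 3(3) R2 that by simp
  have cn: "d * n + y < K" if "d < 4" "y < n" for d y
    using addr_less[of d 4 y n] that K by auto
  have low: "M3 a = M a" if "a < F" for a
    using that by (simp add: M3_def M2_def M1_def shifted_def)
  have edge: "M3 (x * n + y) \<noteq> 0 \<longleftrightarrow> adj x y" if "x < n" "y < n" for x y
    using low[OF e(5)[OF that]] e(2)[OF that] by simp
  have chi: "M3 (F + K + (d * n + y)) = (if d = c \<and> adj v y then 0 else if d = 0 \<and> y = v then m else M (F + (d * n + y)))"
    if d: "d < 4" "y < n" for d y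
  proof -
    have "F + K + (d * n + y) \<noteq> F + (c * n + v)" "F + K + (d * n + y) \<noteq> F + 4 * n"
      using cn[of c v] c(2) v(2) K by auto
    then have "M3 (F + K + (d * n + y)) = M2 (F + K + (d * n + y))" by (simp add: M3_def)
    also have "\<dots> = (if d = c \<and> M1 (v * n + y) \<noteq> 0 then 0 else if d * n + y = v then m else M1 (F + K + (d * n + y)))"
    proof -
      have "(\<exists>y'<n. F + K + (d * n + y) = F + K + (c * n + y') \<and> M1 (v * n + y') \<noteq> 0) \<longleftrightarrow> d = c \<and> M1 (v * n + y) \<noteq> 0"
        using addr_eq_iff[of y n] d(2) by auto
      then show ?thesis unfolding M2_def by simp
    qed
    also have "d * n + y = v \<longleftrightarrow> d = 0 \<and> y = v" using addr_eq_iff[of y n v d 0] d(2) v(2) by simp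
    also have "M1 (F + K + (d * n + y)) = M (F + (d * n + y))"
      using cn[OF d] by (simp add: M1_def shifted_def)
    also have "M1 (v * n + y) \<noteq> 0 \<longleftrightarrow> adj v y" using M1[OF d(2)] e(2)[OF v(2) d(2)] by simp
    finally show ?thesis .
  qed
  have own: "M3 (F + (d * n + y)) = (if d = c \<and> y = v then 0 else M (F + (d * n + y)))"
    if d: "d < 4" "y < n" for d y
  proof -
    have "F + (d * n + y) \<noteq> F + 4 * n" using addr_less[OF d] by simp
    moreover have "M2 (F + (d * n + y)) = M (F + (d * n + y))"
      using cn[OF d] by (simp add: M2_def M1_def shifted_def)
    moreover have "F + (d * n + y) = F + (c * n + v) \<longleftrightarrow> d = c \<and> y = v"
      using addr_eq_iff[OF d(2) v(2), of d c] by simp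
    ultimately show ?thesis by (simp add: M3_def)
  qed
  \<comment> \<open>Colours start at \<open>1\<close>, so updates of lists never hit block
    \<open>0\<close>, which holds the marks.\<close>
  have c4: "c < 4" "c \<noteq> 0" using c by auto
  have "encodes n adj (F + K) M3 (mk(v := m)) (\<lambda>d y. ls d y \<and> \<not> (d = c \<and> adj v y))"
    unfolding encodes_def
  proof (intro conjI allI impI ballI)
    show "n * n \<le> F + K" using e(1) by simp
    show "M3 (F + K + y) = (mk(v := m)) y" if "y < n" for y
      using chi[of 0 y] e(3)[of y] that c4 by simp
    show "M3 (F + K + (d * n + y)) \<noteq> 0 \<longleftrightarrow> ls d y \<and> \<not> (d = c \<and> adj v y)" if "d \<in> {1, 2, 3}" "y < n" for d y
    proof -
      have "d < 4" "d \<noteq> 0" using that(1) by auto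
      with chi[of d y] e(4)[OF that] that(2) show ?thesis by simp
    qed
  qed (use edge in auto)
  moreover have "encodes n adj F M3 mk (\<lambda>d y. ls d y \<and> \<not> (d = c \<and> y = v))"
    unfolding encodes_def
  proof (intro conjI allI impI ballI)
    show "n * n \<le> F" using e(1) by simp
    show "M3 (F + y) = mk y" if "y < n" for y
      using own[of 0 y] e(3)[of y] that c4 by simp
    show "M3 (F + (d * n + y)) \<noteq> 0 \<longleftrightarrow> ls d y \<and> \<not> (d = c \<and> y = v)" if "d \<in> {1, 2, 3}" "y < n" for d y
    proof -
      have "d < 4" using that(1) by auto
      with own[of d y] e(4)[OF that] that(2) show ?thesis by simp
    qed
  qed (use edge in auto)
  moreover have "M3 (F + 4 * n) = R rW" by (simp add: M3_def)
  ultimately show thesis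
    using that[of "R3(rF := R3 rF + R3 rK)" M3] low R3 R 3(2) by (simp add: K_def)
qed

lemma sem_mid_branch:
  assumes enc: "encodes n adj F M mk ls" and R: "R rF = F + R rK" "R rN = n" "R rK = 4 * n + 1"
  obtains R' M' where "sem mid_branch (R, M) = (R', M')"
    "encodes n adj (F + R rK) M' mk ls" "M' (F + 4 * n) = R rW" "\<And>a. a < F \<Longrightarrow> M' a = M a"
    "R' rF = F + R rK" "R' rW = M (F + 4 * n)" "R' rN = n" "R' rK = R rK" "R' rD = R rD"
proof -
  define K where "K = R rK"
  have K: "K = 4 * n + 1" using R by (simp add: K_def)
  note e = encodesD[OF enc]
  define R1 where "R1 = R(rF := F, rT := M (F + 4 * n), rW := M (F + 4 * n))"
  define M1 where "M1 = M(F + 4 * n := R rW)"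
  have R1: "R1 rF = F" "R1 rK = K" by (simp_all add: R1_def K_def)
  obtain R2 where 2: "sem copy_frame (R1, M1) = (R2, shifted F K K M1)" "\<And>r. r \<noteq> rI \<Longrightarrow> R2 r = R1 r"
    by (rule sem_copy_frame[of R1 M1, unfolded R1]) blast
  define M2 where "M2 = shifted F K K M1"
  have "sem mid_branch (R, M) = (R2(rF := R2 rF + R2 rK), M2)"
    unfolding mid_branch_def sem.simps(4) M2_def 2(1)[symmetric]
    using R 2(1) by (simp add: own_def R1_def M1_def fun_upd_twist)
  moreover have low: "M2 a = M a" if "a < F" for a
    using that by (simp add: M2_def M1_def shifted_def)
  moreover have "encodes n adj (F + K) M2 mk ls"
    unfolding encodes_def
  proof (intro conjI allI impI ballI)
    show "n * n \<le> F + K" using e(1) by simp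
    show "M2 (x * n + y) \<noteq> 0 \<longleftrightarrow> adj x y" if "x < n" "y < n" for x y
      using low[OF e(5)[OF that]] e(2)[OF that] by simp
    show "M2 (F + K + y) = mk y" if "y < n" for y
      using that K e(3)[of y] by (simp add: M2_def M1_def shifted_def)
    show "M2 (F + K + (d * n + y)) \<noteq> 0 \<longleftrightarrow> ls d y" if "d \<in> {1, 2, 3}" "y < n" for d y
    proof -
      have "d * n + y < 4 * n" by (rule addr_less) (use that in auto)
      then show ?thesis using K e(4)[OF that] by (simp add: M2_def M1_def shifted_def)
    qed
  qed
  moreover have "M2 (F + 4 * n) = R rW" using K by (simp add: M2_def M1_def shifted_def)
  ultimately show thesis
    using that[of "R2(rF := R2 rF + R2 rK)" M2] 2(2) R by (simp add: R1_def K_def)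
qed

lemma sem_post_branch:
  "R rF = F + R rK \<Longrightarrow> sem post_branch (R, M) = (R(rF := F, rW := R rW + M (F + 4 * R rN)), M)"
  by (simp add: post_branch_def own_def fun_upd_twist)

section \<open>Searching for marks, colours and branching pairs\<close>

lemma sem_find_mark:
  obtains R' where "sem (find_mark m) (R, M) = (R', M)"
    "(\<exists>v<R rN. M (R rF + v) = m \<and> R' rX = 1 \<and> R' rV = v) \<or>
     (\<forall>y<R rN. M (R rF + y) \<noteq> m) \<and> R' rX = R rX \<and> R' rV = R rV"
    "\<And>r. r \<notin> {rI, rV, rX} \<Longrightarrow> R' r = R r"
proof -
  let ?b = "Cond (neq (AMem (own (ANum 0) (AVar rI))) (ANum m)) Nop (rV \<leftarrow> AVar rI ;; rX \<leftarrow> ANum 1)"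
  have wf: "wfs (For rI rN ?b)" by (simp add: expr_defs)
  show thesis
  proof (rule sem_For[OF wf, of "\<lambda>j R' M'. M' = M \<and> ((\<exists>v<j. M (R rF + v) = m \<and> R' rX = 1 \<and> R' rV = v) \<or>
     (\<forall>y<j. M (R rF + y) \<noteq> m) \<and> R' rX = R rX \<and> R' rV = R rV)" R M], goal_cases)
    case (2 j R' M')
    have "R' rF = R rF" using 2(4)[of rF] by simp
    then have "val (neq (AMem (own (ANum 0) (AVar rI))) (ANum m)) (R', M') = 0 \<longleftrightarrow> M (R rF + j) = m"
      using 2(2,3) by (auto simp: expr_defs)
    then show ?case using 2(2,3) by (auto simp: less_Suc_eq)
  next
    case (3 R2 M2)
    show ?case
      by (rule that[of R2]) (use 3 in \<open>auto simp: find_mark_def\<close>)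
  qed simp
qed

lemma sem_find_color:
  obtains R' where "sem find_color (R, M) = (R', M)"
    "(\<exists>c\<in>{1, 2, 3}. M (R rF + (c * R rN + R rV)) \<noteq> 0 \<and> R' rX = 1 \<and> R' rC = c) \<or>
     (\<forall>c\<in>{1, 2, 3}. M (R rF + (c * R rN + R rV)) = 0) \<and> R' rX = 0"
    "\<And>r. r \<notin> {rC, rX} \<Longrightarrow> R' r = R r"
  by (rule that[of "fst (sem find_color (R, M))"])
    (auto simp: find_color_def try_color_def own_def prod_eq_iff add.assoc)

text \<open>With a reflexive \<open>adj\<close>, this set contains \<open>v\<close> itself if
  \<open>v\<close> is present and has \<open>c\<close> in its list.\<close>

definition nbrs :: "nat \<Rightarrow> (nat \<Rightarrow> nat \<Rightarrow> bool) \<Rightarrow> (nat \<Rightarrow> nat) \<Rightarrow> (nat \<Rightarrow> nat \<Rightarrow> bool) \<Rightarrow> nat \<Rightarrow> nat \<Rightarrow> nat set" where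
  "nbrs n adj mk ls v c = {y. y < n \<and> mk y \<noteq> 0 \<and> ls c y \<and> adj v y}"

definition colors :: "(nat \<Rightarrow> nat \<Rightarrow> bool) \<Rightarrow> nat \<Rightarrow> nat set" where
  "colors ls v = {c \<in> {1, 2, 3}. ls c v}"

lemma finite_colors [simp]: "finite (colors ls v)"
  by (simp add: colors_def)

lemma sem_count_nbrs:
  assumes enc: "encodes n adj F M mk ls" and R: "R rF = F" "R rN = n" "R rA < n" "R rB \<in> {1, 2, 3}" "R rT = 0"
  obtains R' where "sem count_nbrs (R, M) = (R', M)" "R' rT = card (nbrs n adj mk ls (R rA) (R rB))"
    "\<And>r. r \<notin> {rI, rT} \<Longrightarrow> R' r = R r"
proof -
  note e = encodesD[OF enc]
  let ?b = "Cond (AMem (own (ANum 0) (AVar rI))) (Cond (AMem (own (AVar rB) (AVar rI)))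
    (Cond (edge (AVar rA) (AVar rI)) (rT \<leftarrow> AVar rT \<oplus> ANum 1) Nop) Nop) Nop"
  let ?S = "\<lambda>j. {y. y < j \<and> mk y \<noteq> 0 \<and> ls (R rB) y \<and> adj (R rA) y}"
  have wf: "wfs (For rI rN ?b)" by (simp add: expr_defs)
  show thesis
  proof (rule sem_For[OF wf, of "\<lambda>j R' M'. M' = M \<and> R' rT = card (?S j)" R M], goal_cases)
    case 1
    then show ?case using R by simp
  next
    case (2 j R' M')
    have k: "R' rF = F" "R' rA = R rA" "R' rB = R rB" "R' rN = n" "j < n"
      using 2(4)[of rF] 2(4)[of rA] 2(4)[of rB] 2(4)[of rN] 2(1) R by simp_all
    have 3: "val (AMem (own (ANum 0) (AVar rI))) (R', M') = mk j"
      using 2(2,3) k e(3) by (simp add: own_def)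
    have 4: "val (AMem (own (AVar rB) (AVar rI))) (R', M') \<noteq> 0 \<longleftrightarrow> ls (R rB) j"
      using 2(2,3) k e(4)[OF R(4), of j] by (simp add: own_def add.assoc)
    have 5: "val (edge (AVar rA) (AVar rI)) (R', M') \<noteq> 0 \<longleftrightarrow> adj (R rA) j"
      using 2(2,3) k e(2)[OF R(3), of j] by (simp add: edge_def)
    have "?S (Suc j) = (if mk j \<noteq> 0 \<and> ls (R rB) j \<and> adj (R rA) j then insert j (?S j) else ?S j)"
      by (auto simp: less_Suc_eq)
    then have "card (?S (Suc j)) = card (?S j) + (if mk j \<noteq> 0 \<and> ls (R rB) j \<and> adj (R rA) j then 1 else 0)"
      by simp
    then show ?case using 2(2,3) 3 4 5 unfolding sem.simps by simp
  next
    case (3 R2 M2)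
    show ?case
      by (rule that[of R2]) (use 3 R in \<open>auto simp: count_nbrs_def nbrs_def\<close>)
  qed
qed

lemma sem_try_pair:
  assumes enc: "encodes n adj F M mk ls" and R: "R rF = F" "R rN = n" "R rA < n" and c: "c \<in> {1, 2, 3}"
  defines "ok \<equiv> ls c (R rA) \<and> (R rZ = 1 \<or> R rD \<le> card (nbrs n adj mk ls (R rA) c))"
  obtains R' where "sem (try_pair c) (R, M) = (R', M)"
    "R' rV = (if ok then R rA else R rV)" "R' rC = (if ok then c else R rC)" "R' rX = (if ok then 1 else R rX)"
    "\<And>r. r \<notin> {rB, rT, rI, rV, rC, rX} \<Longrightarrow> R' r = R r"
proof -
  note e = encodesD[OF enc]
  define R1 where "R1 = R(rB := c, rT := 0)"
  obtain R2 where 2: "sem count_nbrs (R1, M) = (R2, M)" "R2 rT = card (nbrs n adj mk ls (R1 rA) (R1 rB))"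
    "\<And>r. r \<notin> {rI, rT} \<Longrightarrow> R2 r = R1 r"
    by (rule sem_count_nbrs[OF enc, of R1]) (use R c in \<open>auto simp: R1_def\<close>)
  have ls: "M (F + (c * n + R rA)) \<noteq> 0 \<longleftrightarrow> ls c (R rA)" using e(4)[OF c R(3)] .
  have R2: "R2 r = R r" if "r \<notin> {rI, rT, rB}" for r using 2(3) that by (simp add: R1_def)
  have R2T: "R2 rT = card (nbrs n adj mk ls (R rA) c)" using 2(2) by (simp add: R1_def)
  define R3 where "R3 = (if ls c (R rA) then (if ok then R2(rV := R rA, rC := c, rX := 1) else R2) else R(rB := c))"
  have "sem (rB \<leftarrow> ANum c) (R, M) = (R(rB := c), M)" by simp
  moreover have "val (AMem (own (ANum c) (AVar rA))) (R(rB := c), M) = M (F + (c * n + R rA))"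
    using R by (simp add: own_def add.assoc)
  moreover have "sem (rT \<leftarrow> ANum 0) (R(rB := c), M) = (R1, M)" by (simp add: R1_def)
  moreover have "R2 rB = c" using 2(3)[of rB] by (simp add: R1_def)
  then have "sem (Cond (neq (AVar rZ) (ANum 1)) (Cond (AVar rD \<ominus> AVar rT) Nop pick) pick) (R2, M) = (R3, M)"
    if "ls c (R rA)"
    using that R2T R2[of rZ] R2[of rD] R2[of rA]
    by (auto simp: neq_def pick_def R3_def ok_def not_le)
  ultimately have "sem (try_pair c) (R, M) = (R3, M)"
    using ls 2(1) unfolding try_pair_def sem.simps(4,5) by (auto simp: R3_def)
  then show thesis
    by (rule that) (use R2 in \<open>auto simp: R3_def ok_def\<close>)
qed

lemma sem_select:
  assumes enc: "encodes n adj F M mk ls" and R: "R rF = F" "R rN = n"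
  obtains R' where "sem select (R, M) = (R', M)"
    "R' rY = 0 \<longleftrightarrow> (\<forall>v<n. mk v \<noteq> 0 \<longrightarrow> colors ls v \<noteq> {})"
    "\<And>v c. R' rX = 0 \<Longrightarrow> v < n \<Longrightarrow> mk v \<noteq> 0 \<Longrightarrow> c \<in> colors ls v \<Longrightarrow>
       card (colors ls v) \<noteq> 1 \<and> card (nbrs n adj mk ls v c) < R rD"
    "R' rX \<noteq> 0 \<Longrightarrow> R' rV < n \<and> mk (R' rV) \<noteq> 0 \<and> R' rC \<in> colors ls (R' rV) \<and>
       (card (colors ls (R' rV)) = 1 \<or> R rD \<le> card (nbrs n adj mk ls (R' rV) (R' rC)))"
    "\<And>r. r \<in> {rN, rK, rD, rF, rW} \<Longrightarrow> R' r = R r"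
proof -
  note e = encodesD[OF enc]
  let ?s = "rZ \<leftarrow> ANum 0 ;; list_size 1 ;; list_size 2 ;; list_size 3 ;; Cond (AVar rZ) Nop (rY \<leftarrow> ANum 1)"
  let ?b = "Cond (AMem (own (ANum 0) (AVar rA)))
    (rZ \<leftarrow> ANum 0 ;; list_size 1 ;; list_size 2 ;; list_size 3 ;; Cond (AVar rZ) Nop (rY \<leftarrow> ANum 1) ;;
     try_pair 1 ;; try_pair 2 ;; try_pair 3) Nop"
  \<comment> \<open>The pairs that phase 1 has to branch on; that \<open>rX\<close> is still
    \<open>0\<close> at the end certifies that there are none.\<close>
  define bad where "bad v c \<longleftrightarrow> ls c v \<and> (card (colors ls v) = 1 \<or> R rD \<le> card (nbrs n adj mk ls v c))" for v c
  define I where "I j R' M' \<longleftrightarrow> M' = M \<and> (R' rY = 0 \<longleftrightarrow> (\<forall>v<j. mk v \<noteq> 0 \<longrightarrow> colors ls v \<noteq> {})) \<and>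
    (R' rX = 0 \<longrightarrow> (\<forall>v<j. mk v \<noteq> 0 \<longrightarrow> (\<forall>c\<in>{1, 2, 3}. \<not> bad v c))) \<and>
    (R' rX \<noteq> 0 \<longrightarrow> R' rV < n \<and> mk (R' rV) \<noteq> 0 \<and> R' rC \<in> {1, 2, 3} \<and> bad (R' rV) (R' rC))"
    for j :: nat and R' M' :: "nat \<Rightarrow> nat"
  have cs: "colors ls v = (if ls 1 v then {1} else {}) \<union> (if ls 2 v then {2} else {}) \<union> (if ls 3 v then {3} else {})" for v
    by (auto simp: colors_def)
  have card: "card (colors ls v) = of_bool (ls 1 v) + of_bool (ls 2 v) + of_bool (ls 3 v)" for v
    unfolding cs by auto
  have ne: "colors ls v = {} \<longleftrightarrow> card (colors ls v) = 0" for v by simp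
  have wf: "wfs (For rA rN ?b)"
    by (simp add: expr_defs list_size_def try_pair_def pick_def count_nbrs_def)
  define R0 where "R0 = R(rX := 0, rY := 0)"
  have R0: "R0 rF = F" "R0 rN = n" "R0 rD = R rD" using R by (simp_all add: R0_def)
  show thesis
  proof (rule sem_For[OF wf, of I R0 M], goal_cases)
    case 1
    then show ?case by (simp add: I_def R0_def)
  next
    case (2 j R' M')
    have M': "M' = M" using 2(2) by (simp add: I_def)
    have k: "R' rF = F" "R' rN = n" "R' rD = R rD" "j < n"
      using 2(4)[of rF] 2(4)[of rN] 2(4)[of rD] 2(1) R0
      by (simp_all add: list_size_def try_pair_def pick_def count_nbrs_def)
    have L: "M (F + (c * n + j)) \<noteq> 0 \<longleftrightarrow> ls c j" if "c \<in> {1, 2, 3}" for c using e(4)[OF that k(4)] .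
    have mkj: "val (AMem (own (ANum 0) (AVar rA))) (R', M') = mk j"
      using 2(3) k e(3)[OF k(4)] M' by (simp add: own_def)
    have tp: "\<exists>R2. sem (try_pair c) (R1, M) = (R2, M) \<and> R2 rV = (if bad j c then j else R1 rV) \<and>
        R2 rC = (if bad j c then c else R1 rC) \<and> R2 rX = (if bad j c then 1 else R1 rX) \<and>
        (\<forall>r. r \<notin> {rB, rT, rI, rV, rC, rX} \<longrightarrow> R2 r = R1 r)"
      if R1: "R1 rF = F" "R1 rN = n" "R1 rA = j" "R1 rD = R rD" "R1 rZ = card (colors ls j)" and c: "c \<in> {1, 2, 3}"
      for R1 c
    proof -
      have bad: "ls c j \<and> (R1 rZ = 1 \<or> R1 rD \<le> card (nbrs n adj mk ls j c)) \<longleftrightarrow> bad j c"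
        by (simp add: R1 bad_def)
      have "R1 rA < n" using R1 k by simp
      show ?thesis
      proof (rule sem_try_pair[OF enc R1(1,2) \<open>R1 rA < n\<close> c, unfolded bad R1(3)])
        fix R2
        assume "sem (try_pair c) (R1, M) = (R2, M)" "R2 rV = (if bad j c then j else R1 rV)"
          "R2 rC = (if bad j c then c else R1 rC)" "R2 rX = (if bad j c then 1 else R1 rX)"
          "\<And>r. r \<notin> {rB, rT, rI, rV, rC, rX} \<Longrightarrow> R2 r = R1 r"
        then show ?thesis by (intro exI[of _ R2] conjI allI impI)
      qed
    qed
    define R1 where "R1 = R'(rZ := card (colors ls j), rY := (if colors ls j = {} then 1 else R' rY))"
    have s: "sem ?s (R', M') = (R1, M)"
    proof -
      have 1: "sem (list_size c) (R'(rZ := z), M) = (R'(rZ := z + of_bool (ls c j)), M)" if "c \<in> {1, 2, 3}" for c z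
        using L[OF that] k(1,2) 2(3) by (simp add: list_size_def own_def add.assoc)
      have "sem (Cond (AVar rZ) Nop (rY \<leftarrow> ANum 1)) (R'(rZ := card (colors ls j)), M) = (R1, M)"
        by (auto simp: R1_def fun_eq_iff)
      moreover have "sem (rZ \<leftarrow> ANum 0) (R', M') = (R'(rZ := 0), M)" by (simp add: M')
      ultimately show ?thesis
        using 1[of 1 0] 1[of 2 "0 + of_bool (ls 1 j)"] 1[of 3 "0 + of_bool (ls 1 j) + of_bool (ls 2 j)"]
        unfolding sem.simps(4) by (simp add: card del: sem.simps)
    qed
    have R1: "R1 rF = F" "R1 rN = n" "R1 rA = j" "R1 rD = R rD" "R1 rZ = card (colors ls j)" "R1 rA < n"
      using k 2(3) by (simp_all add: R1_def)
    obtain R2 where 3: "sem (try_pair 1) (R1, M) = (R2, M)"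
      "R2 rV = (if bad j 1 then j else R1 rV)" "R2 rC = (if bad j 1 then 1 else R1 rC)" "R2 rX = (if bad j 1 then 1 else R1 rX)"
      "\<And>r. r \<notin> {rB, rT, rI, rV, rC, rX} \<Longrightarrow> R2 r = R1 r"
      using tp[OF R1(1-5), of 1] by auto
    have R2: "R2 rF = F" "R2 rN = n" "R2 rA = j" "R2 rD = R rD" "R2 rZ = card (colors ls j)" "R2 rA < n" "R2 rY = R1 rY"
      using 3(5) R1 by simp_all
    obtain R3 where 4: "sem (try_pair 2) (R2, M) = (R3, M)"
      "R3 rV = (if bad j 2 then j else R2 rV)" "R3 rC = (if bad j 2 then 2 else R2 rC)" "R3 rX = (if bad j 2 then 1 else R2 rX)"
      "\<And>r. r \<notin> {rB, rT, rI, rV, rC, rX} \<Longrightarrow> R3 r = R2 r"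
      using tp[OF R2(1-5), of 2] by auto
    have R3: "R3 rF = F" "R3 rN = n" "R3 rA = j" "R3 rD = R rD" "R3 rZ = card (colors ls j)" "R3 rA < n" "R3 rY = R1 rY"
      using 4(5) R2 by simp_all
    obtain R4 where 5: "sem (try_pair 3) (R3, M) = (R4, M)"
      "R4 rV = (if bad j 3 then j else R3 rV)" "R4 rC = (if bad j 3 then 3 else R3 rC)" "R4 rX = (if bad j 3 then 1 else R3 rX)"
      "\<And>r. r \<notin> {rB, rT, rI, rV, rC, rX} \<Longrightarrow> R4 r = R3 r"
      using tp[OF R3(1-5), of 3] by auto
    have R4Y: "R4 rY = R1 rY" using 5(5) R3 by simp
    have b: "sem ?b (R', M') = (if mk j \<noteq> 0 then (R4, M) else (R', M))"
      using s 3(1) 4(1) 5(1) mkj M' unfolding sem.simps(1,4,5) by auto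
    show ?case
    proof (cases "mk j = 0")
      case True
      then show ?thesis using 2(2) b by (simp add: I_def less_Suc_eq)
    next
      case False
      have Y: "R4 rY = 0 \<longleftrightarrow> R' rY = 0 \<and> colors ls j \<noteq> {}" using R4Y by (simp add: R1_def)
      have "R4 rX = 0 \<longleftrightarrow> R' rX = 0 \<and> (\<forall>c\<in>{1, 2, 3}. \<not> bad j c)"
        using 3(4) 4(4) 5(4) by (simp add: R1_def)
      moreover have "R4 rV < n \<and> mk (R4 rV) \<noteq> 0 \<and> R4 rC \<in> {1, 2, 3} \<and> bad (R4 rV) (R4 rC)" if "R4 rX \<noteq> 0"
        using that 3(2-4) 4(2-4) 5(2-4) False k(4) 2(2) by (auto simp: R1_def I_def split: if_splits)
      ultimately show ?thesis using 2(2) b False Y by (auto simp: I_def less_Suc_eq)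
    qed
  next
    case (3 R2 M2)
    have s: "sem select (R, M) = (R2, M)" using 3(1,2) by (simp add: select_def R0_def I_def)
    show ?case
    proof (rule that[OF s])
      show "R2 rY = 0 \<longleftrightarrow> (\<forall>v<n. mk v \<noteq> 0 \<longrightarrow> colors ls v \<noteq> {})"
        using 3(2) R0 by (simp add: I_def)
      show "R2 rX = 0 \<Longrightarrow> v < n \<Longrightarrow> mk v \<noteq> 0 \<Longrightarrow> c \<in> colors ls v \<Longrightarrow>
         card (colors ls v) \<noteq> 1 \<and> card (nbrs n adj mk ls v c) < R rD" for v c
        using 3(2) R0 by (auto simp: I_def colors_def bad_def not_le)
      show "R2 rX \<noteq> 0 \<Longrightarrow> R2 rV < n \<and> mk (R2 rV) \<noteq> 0 \<and> R2 rC \<in> colors ls (R2 rV) \<and>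
         (card (colors ls (R2 rV)) = 1 \<or> R rD \<le> card (nbrs n adj mk ls (R2 rV) (R2 rC)))"
        using 3(2) by (auto simp: I_def colors_def bad_def)
      show "R2 r = R r" if "r \<in> {rN, rK, rD, rF, rW}" for r
        using 3(3)[of r] that by (auto simp: R0_def list_size_def try_pair_def pick_def count_nbrs_def)
    qed
  qed
qed

section \<open>Reachability and splitting off a part\<close>

definition put :: "nat \<Rightarrow> nat \<Rightarrow> (nat \<Rightarrow> nat) \<Rightarrow> (nat \<Rightarrow> nat) \<Rightarrow> nat \<Rightarrow> nat" where
  "put B n g M a = (if B \<le> a \<and> a < B + n then g (a - B) else M a)"

lemma put_simps [simp]:
  "y < n \<Longrightarrow> put B n g M (B + y) = g y"
  "a < B \<Longrightarrow> put B n g M a = M a"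
  "B + n \<le> a \<Longrightarrow> put B n g M a = M a"
  by (simp_all add: put_def)

lemma put_upd: "y < n \<Longrightarrow> (put B n g M)(B + y := k) = put B n (g(y := k)) M"
  by (auto simp: put_def fun_eq_iff)

lemma put_cong: "(\<And>y. y < n \<Longrightarrow> g y = h y) \<Longrightarrow> put B n g M = put B n h M"
  by (auto simp: put_def fun_eq_iff)

text \<open>The weaker form of \<open>encodes\<close> on which the search relies: it reads edges and
  marks, but no lists.\<close>

definition linked :: "nat \<Rightarrow> (nat \<Rightarrow> nat \<Rightarrow> bool) \<Rightarrow> nat \<Rightarrow> (nat \<Rightarrow> nat) \<Rightarrow> (nat \<Rightarrow> nat) \<Rightarrow> bool" where
  "linked n adj F M mk \<longleftrightarrow> n * n \<le> F \<and> (\<forall>x<n. \<forall>y<n. M (x * n + y) \<noteq> 0 \<longleftrightarrow> adj x y) \<and>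
     (\<forall>y<n. M (F + y) = mk y)"

lemma linkedD:
  assumes "linked n adj F M mk"
  shows "x < n \<Longrightarrow> y < n \<Longrightarrow> M (x * n + y) \<noteq> 0 \<longleftrightarrow> adj x y"
    "y < n \<Longrightarrow> M (F + y) = mk y" "x < n \<Longrightarrow> y < n \<Longrightarrow> x * n + y < F"
proof -
  show "x < n \<Longrightarrow> y < n \<Longrightarrow> x * n + y < F"
    using addr_less[of x n y n] assms by (auto simp: linked_def)
qed (use assms in \<open>auto simp: linked_def\<close>)

lemma val_child: "val (AMem (child (ANum 0) (AVar r))) (R, M) = M (R rF + R rK + R r)"
  by (simp add: child_def)

lemma val_own0: "val (AMem (own (ANum 0) (AVar r))) (R, M) = M (R rF + R r)"
  by (simp add: own_def)

lemma val_edge: "val (edge (AVar r) (AVar q)) (R, M) = M (R r * R rN + R q)"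
  by (simp add: edge_def)

lemma val_neq: "val (neq a b) s = 0 \<longleftrightarrow> val a s = val b s"
  by (auto simp: neq_def)

lemma sem_Sto_child:
  "sem (Sto (child (ANum 0) (AVar r)) (ANum k)) (R, M) = (R, M(R rF + R rK + R r := k))"
  by (simp add: child_def)

lemma sem_Sto_own:
  "sem (Sto (own (ANum 0) (AVar r)) (ANum k)) (R, M) = (R, M(R rF + R r := k))"
  by (simp add: own_def)

lemma sem_seed:
  assumes l: "linked n adj F M mk" and R: "R rF = F" "R rN = n" "R rK = K" "R rV < n" and K: "n \<le> K"
  obtains R' where "sem seed (R, M) = (R', put (F + K) n (\<lambda>y. if adj (R rV) y \<and> mk y = 1 then 3 else 0) M)"
    "\<And>r. r \<noteq> rI \<Longrightarrow> R' r = R r"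
proof -
  note e = linkedD[OF l]
  let ?b = "Cond (edge (AVar rV) (AVar rI))
    (Cond (neq (AMem (own (ANum 0) (AVar rI))) (ANum 1)) (Sto (child (ANum 0) (AVar rI)) (ANum 0))
      (Sto (child (ANum 0) (AVar rI)) (ANum 3)))
    (Sto (child (ANum 0) (AVar rI)) (ANum 0))"
  define g0 where "g0 y = (if adj (R rV) y \<and> mk y = 1 then 3 else 0 :: nat)" for y
  define g where "g j y = (if y < j then g0 y else M (F + K + y))" for j y :: nat
  have wf: "wfs (For rI rN ?b)" by (simp add: expr_defs)
  show thesis
  proof (rule sem_For[OF wf, of "\<lambda>j R' M'. M' = put (F + K) n (g j) M" R M], goal_cases)
    case 1
    show ?case by (auto simp: put_def g_def fun_eq_iff)
  next
    case (2 j R' M')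
    have k: "R' rF = F" "R' rN = n" "R' rK = K" "R' rV = R rV" "j < n" "R' rI = j"
      using 2(4)[of rF] 2(4)[of rN] 2(4)[of rK] 2(4)[of rV] 2(1,3) R by simp_all
    have mj: "M' (F + j) = mk j" using k(5) K e(2) by (simp add: 2(2))
    have ej: "M' (R rV * n + j) \<noteq> 0 \<longleftrightarrow> adj (R rV) j" using e(1,3)[OF R(4) k(5)] by (simp add: 2(2))
    have "sem ?b (R', M') = (R', M'(F + K + j := g0 j))"
      unfolding sem.simps(5) val_edge val_neq val_own0 sem_Sto_child
      using k ej mj by (auto simp: g0_def)
    moreover have "M'(F + K + j := g0 j) = put (F + K) n (g (Suc j)) M"
      unfolding 2(2) put_upd[OF k(5)] by (rule put_cong) (auto simp: g_def)
    ultimately show ?case by simp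
  next
    case (3 R2 M2)
    have "put (F + K) n (g n) M = put (F + K) n g0 M" by (rule put_cong) (simp add: g_def)
    then show ?case using that[of R2] 3 R(2) unfolding seed_def g0_def by simp
  qed
qed

lemma sem_spread:
  assumes l: "linked n adj F M mk" and R: "R rF = F" "R rN = n" "R rK = K" "R rB = x" "x < n" and K: "n \<le> K"
  obtains R' where "sem spread (R, put (F + K) n g M) =
      (R', put (F + K) n (\<lambda>y. if g y = 0 \<and> mk y = 1 \<and> adj x y then 1 else g y) M)"
    "\<And>r. r \<noteq> rI \<Longrightarrow> R' r = R r"
proof -
  note e = linkedD[OF l]
  let ?b = "Cond (AMem (child (ANum 0) (AVar rI))) Nop
    (Cond (neq (AMem (own (ANum 0) (AVar rI))) (ANum 1)) Nop
      (Cond (edge (AVar rB) (AVar rI)) (Sto (child (ANum 0) (AVar rI)) (ANum 1)) Nop))"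
  define h where "h j y = (if y < j \<and> g y = 0 \<and> mk y = 1 \<and> adj x y then 1 else g y)" for j y :: nat
  have wf: "wfs (For rI rN ?b)" by (simp add: expr_defs)
  show thesis
  proof (rule sem_For[OF wf, of "\<lambda>j R' M'. M' = put (F + K) n (h j) M" R "put (F + K) n g M"], goal_cases)
    case 1
    show ?case by (auto simp: put_def h_def fun_eq_iff)
  next
    case (2 j R' M')
    have k: "R' rF = F" "R' rN = n" "R' rK = K" "R' rB = x" "j < n" "R' rI = j"
      using 2(4)[of rF] 2(4)[of rN] 2(4)[of rK] 2(4)[of rB] 2(1,3) R by simp_all
    have mj: "M' (F + j) = mk j" using k(5) K e(2) by (simp add: 2(2))
    have gj: "M' (F + K + j) = g j" using k(5) by (simp add: 2(2) h_def)
    have ej: "M' (x * n + j) \<noteq> 0 \<longleftrightarrow> adj x j" using e(1,3)[OF R(5) k(5)] by (simp add: 2(2))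
    have "sem ?b (R', M') = (R', M'(F + K + j := h (Suc j) j))"
      unfolding sem.simps(1,5) val_edge val_neq val_own0 val_child sem_Sto_child
      using k ej mj gj by (auto simp: h_def)
    moreover have "M'(F + K + j := h (Suc j) j) = put (F + K) n (h (Suc j)) M"
      unfolding 2(2) put_upd[OF k(5)] by (rule put_cong) (auto simp: h_def less_Suc_eq)
    ultimately show ?case by simp
  next
    case (3 R2 M2)
    have "put (F + K) n (h n) M = put (F + K) n (\<lambda>y. if g y = 0 \<and> mk y = 1 \<and> adj x y then 1 else g y) M"
      by (rule put_cong) (simp add: h_def)
    then show ?case using that[of R2] 3 R(2) unfolding spread_def by simp
  qed
qed

text \<open>The reachable part of the graph is computed by \<open>n\<close> rounds; a round that does not reach a fixed
  point marks at least one more vertex.\<close>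

locale reach =
  fixes n :: nat and adj :: "nat \<Rightarrow> nat \<Rightarrow> bool" and mk :: "nat \<Rightarrow> nat" and v :: nat
begin

definition "live = {y. y < n \<and> mk y = 1}"
definition "saturated S \<longleftrightarrow> (\<forall>x\<in>S. \<forall>y\<in>live. adj x y \<longrightarrow> y \<in> S)"
definition "supp g = {y. y < n \<and> g y \<noteq> (0 :: nat)}"
text \<open>Invariant of the search. Being contained in every saturated set that contains the seeds
  expresses leastness without mentioning walks. The value \<open>3\<close> stays tied to the
  neighbours of \<open>v\<close>, as these have to be coloured next.\<close>

definition "good g \<longleftrightarrow> supp g \<subseteq> live \<and> (\<forall>y<n. g y = 3 \<longleftrightarrow> y \<in> live \<and> adj v y) \<and> (\<forall>y<n. g y \<in> {0, 1, 3}) \<and>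
  (\<forall>S. (\<forall>y\<in>live. adj v y \<longrightarrow> y \<in> S) \<longrightarrow> saturated S \<longrightarrow> supp g \<subseteq> S)"

lemma good_spread:
  assumes "good g" "x \<in> supp g" "x < n"
  defines "h \<equiv> \<lambda>y. if g y = 0 \<and> mk y = 1 \<and> adj x y then 1 else g y"
  shows "good h" "supp g \<subseteq> supp h" "y \<in> live \<Longrightarrow> adj x y \<Longrightarrow> y \<in> supp h"
proof -
  show sub: "supp g \<subseteq> supp h" by (auto simp: supp_def h_def)
  show "y \<in> live \<Longrightarrow> adj x y \<Longrightarrow> y \<in> supp h" by (auto simp: supp_def h_def live_def)
  show "good h"
    unfolding good_def
  proof (intro conjI allI impI)
    show "supp h \<subseteq> live" using assms(1) by (auto simp: supp_def h_def live_def good_def split: if_splits)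
    show "h y = 3 \<longleftrightarrow> y \<in> live \<and> adj v y" if "y < n" for y
      using assms(1) that by (auto simp: h_def good_def)
    show "h y \<in> {0, 1, 3}" if "y < n" for y
      using assms(1) that by (auto simp: h_def good_def)
    fix S assume S: "\<forall>y\<in>live. adj v y \<longrightarrow> y \<in> S" "saturated S"
    then have "supp g \<subseteq> S" using assms(1) by (auto simp: good_def)
    moreover from this have "x \<in> S" using assms(2) by auto
    ultimately show "supp h \<subseteq> S"
      using S(2) by (auto simp: supp_def h_def saturated_def live_def split: if_splits)
  qed
qed

lemma sem_closure_round:
  assumes l: "linked n adj F M mk" and R: "R rF = F" "R rN = n" "R rK = K" and K: "n \<le> K" and g: "good g"
  obtains R' h where "sem closure_round (R, put (F + K) n g M) = (R', put (F + K) n h M)" "good h"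
    "supp g \<subseteq> supp h" "\<And>x y. x \<in> supp g \<Longrightarrow> y \<in> live \<Longrightarrow> adj x y \<Longrightarrow> y \<in> supp h"
    "\<And>r. r \<notin> {rI, rB} \<Longrightarrow> R' r = R r"
proof -
  let ?b = "Cond (AMem (child (ANum 0) (AVar rB))) spread Nop"
  have wf: "wfs (For rB rN ?b)" by (simp add: expr_defs spread_def)
  define P where "P j M' h \<longleftrightarrow> M' = put (F + K) n h M \<and> good h \<and> supp g \<subseteq> supp h \<and>
    (\<forall>x<j. x \<in> supp g \<longrightarrow> (\<forall>y\<in>live. adj x y \<longrightarrow> y \<in> supp h))" for j :: nat and M' h
  show thesis
  proof (rule sem_For[OF wf, of "\<lambda>j R' M'. \<exists>h. P j M' h" R "put (F + K) n g M"], goal_cases)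
    case 1
    show ?case using g by (intro exI[of _ g]) (simp add: P_def)
  next
    case (2 j R' M')
    from 2(2) obtain h where h: "P j M' h" ..
    have k: "R' rF = F" "R' rN = n" "R' rK = K" "R' rB = j" "j < n"
      using 2(4)[of rF] 2(4)[of rN] 2(4)[of rK] 2(1,3) R by (simp_all add: spread_def)
    have M': "M' = put (F + K) n h M" using h by (simp add: P_def)
    have gj: "M' (F + K + j) = h j" using k(5) by (simp add: M')
    show ?case
    proof (cases "h j = 0")
      case True
      then have "sem ?b (R', M') = (R', M')"
        unfolding sem.simps(1,5) val_child using k gj by simp
      moreover have "P (Suc j) M' h" using h True by (auto simp: P_def supp_def less_Suc_eq)
      ultimately show ?thesis by auto
    next
      case False
      define h' where "h' = (\<lambda>y. if h y = 0 \<and> mk y = 1 \<and> adj j y then 1 else h y)"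
      obtain R2 where "sem spread (R', put (F + K) n h M) = (R2, put (F + K) n h' M)"
        unfolding h'_def by (rule sem_spread[OF l k(1-5) K])
      then have "sem ?b (R', M') = (R2, put (F + K) n h' M)"
        unfolding sem.simps(1,5) val_child M' using k gj False M' by simp
      moreover have "j \<in> supp h" using False k(5) by (simp add: supp_def)
      then have "P (Suc j) (put (F + K) n h' M) h'"
        using good_spread[of h j] h k(5) unfolding h'_def[symmetric] P_def less_Suc_eq by blast
      ultimately show ?thesis by auto
    qed
  next
    case (3 R2 M2)
    then obtain h where h: "P n M2 h" using R(2) by auto
    show ?case
    proof (rule that[of R2 h])
      show "sem closure_round (R, put (F + K) n g M) = (R2, put (F + K) n h M)"
        using 3(1) h unfolding closure_round_def by (simp add: P_def)
      show "R2 r = R r" if "r \<notin> {rI, rB}" for r using 3(3)[of r] that by (simp add: spread_def)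
    qed (use h in \<open>auto simp: P_def supp_def\<close>)
  qed
qed

lemma sem_closure:
  assumes l: "linked n adj F M mk" and R: "R rF = F" "R rN = n" "R rK = K" and K: "n \<le> K" and g: "good g"
  obtains R' h where "sem (For rA rN closure_round) (R, put (F + K) n g M) = (R', put (F + K) n h M)"
    "good h" "saturated (supp h)" "\<And>r. r \<notin> {rI, rA, rB} \<Longrightarrow> R' r = R r"
proof -
  have wf: "wfs (For rA rN closure_round)" by (simp add: expr_defs spread_def closure_round_def)
  \<comment> \<open>As long as the support is not saturated, each round has added a vertex.\<close>
  define P where "P j M' h \<longleftrightarrow> M' = put (F + K) n h M \<and> good h \<and> (saturated (supp h) \<or> j \<le> card (supp h))"
    for j :: nat and M' h
  have fin: "finite (supp h)" for h by (simp add: supp_def)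
  show thesis
  proof (rule sem_For[OF wf, of "\<lambda>j R' M'. \<exists>h. P j M' h" R "put (F + K) n g M"], goal_cases)
    case 1
    show ?case using g by (intro exI[of _ g]) (simp add: P_def)
  next
    case (2 j R' M')
    from 2(2) obtain h where h: "P j M' h" ..
    have k: "R' rF = F" "R' rN = n" "R' rK = K"
      using 2(4)[of rF] 2(4)[of rN] 2(4)[of rK] R by (simp_all add: spread_def closure_round_def)
    have gh: "good h" using h by (simp add: P_def)
    obtain R2 h' where h': "sem closure_round (R', put (F + K) n h M) = (R2, put (F + K) n h' M)" "good h'"
      "supp h \<subseteq> supp h'" "\<And>x y. x \<in> supp h \<Longrightarrow> y \<in> live \<Longrightarrow> adj x y \<Longrightarrow> y \<in> supp h'"
      by (rule sem_closure_round[OF l k K gh]) blast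
    have "saturated (supp h') \<or> Suc j \<le> card (supp h')"
    proof (cases "supp h' = supp h")
      case True
      then have "saturated (supp h')" using h'(4) by (auto simp: saturated_def)
      then show ?thesis ..
    next
      case False
      then have "card (supp h) < card (supp h')" using h'(3) fin by (intro psubset_card_mono) auto
      \<comment> \<open>A saturated support contains the seeds, hence by leastness every later
        support: it cannot grow any more.\<close>
      moreover have "supp h' \<subseteq> supp h" if "saturated (supp h)"
      proof -
        have "\<forall>y\<in>live. adj v y \<longrightarrow> y \<in> supp h" using gh by (auto simp: good_def supp_def live_def)
        then show ?thesis using that h'(2) by (auto simp: good_def)
      qed
      ultimately show ?thesis using h h'(3) False by (auto simp: P_def)
    qed
    then have "P (Suc j) (put (F + K) n h' M) h'" using h'(2) by (simp add: P_def)
    then show ?case using h'(1) h by (auto simp: P_def)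
  next
    case (3 R2 M2)
    then obtain h where h: "P n M2 h" using R(2) by auto
    \<comment> \<open>After \<open>n\<close> rounds without saturation the support would consist of
      all \<open>n\<close> vertices, and then it is saturated trivially.\<close>
    have "saturated (supp h)"
    proof (rule ccontr)
      assume n: "\<not> saturated (supp h)"
      then have "n \<le> card (supp h)" using h by (simp add: P_def)
      moreover have "supp h \<subseteq> {..<n}" by (auto simp: supp_def)
      ultimately have "supp h = {..<n}" by (intro card_subset_eq) (auto simp: card_mono le_antisym dest: card_mono[rotated])
      with n show False by (auto simp: saturated_def live_def)
    qed
    then show ?case
      using that[of R2 h] 3(1) 3(3) h by (simp add: P_def spread_def closure_round_def)
  qed
qed

end

lemma sem_erase:
  assumes R: "R rF = F" "R rN = n" "R rK = K" and K: "n \<le> K"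
  obtains R' where "sem erase (R, M) = (R', put F n (\<lambda>y. if M (F + K + y) \<noteq> 0 then 0 else M (F + y)) M)"
    "\<And>r. r \<noteq> rI \<Longrightarrow> R' r = R r"
proof -
  let ?b = "Cond (AMem (child (ANum 0) (AVar rI))) (Sto (own (ANum 0) (AVar rI)) (ANum 0)) Nop"
  define h where "h j y = (if y < j \<and> M (F + K + y) \<noteq> 0 then 0 else M (F + y))" for j y :: nat
  have wf: "wfs (For rI rN ?b)" by (simp add: expr_defs)
  show thesis
  proof (rule sem_For[OF wf, of "\<lambda>j R' M'. M' = put F n (h j) M" R M], goal_cases)
    case 1
    show ?case by (auto simp: put_def h_def fun_eq_iff)
  next
    case (2 j R' M')
    have k: "R' rF = F" "R' rN = n" "R' rK = K" "j < n" "R' rI = j"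
      using 2(4)[of rF] 2(4)[of rN] 2(4)[of rK] 2(1,3) R by simp_all
    have cj: "M' (F + K + j) = M (F + K + j)" using K by (simp add: 2(2))
    have oj: "M' (F + j) = M (F + j)" using k(4) by (simp add: 2(2) h_def)
    have "sem ?b (R', M') = (R', M'(F + j := h (Suc j) j))"
      unfolding sem.simps(1,5) val_child sem_Sto_own
      using k cj oj by (auto simp: h_def)
    moreover have "M'(F + j := h (Suc j) j) = put F n (h (Suc j)) M"
      unfolding 2(2) put_upd[OF k(4)] by (rule put_cong) (auto simp: h_def less_Suc_eq)
    ultimately show ?case by simp
  next
    case (3 R2 M2)
    have "put F n (h n) M = put F n (\<lambda>y. if M (F + K + y) \<noteq> 0 then 0 else M (F + y)) M"
      by (rule put_cong) (simp add: h_def)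
    then show ?case using that[of R2] 3 R(2) unfolding erase_def by simp
  qed
qed

text \<open>For symmetric \<open>adj\<close>, this is the union of the components of
  \<open>A\<close> that contain a neighbour of \<open>v\<close>.\<close>

definition reached :: "nat set \<Rightarrow> (nat \<Rightarrow> nat \<Rightarrow> bool) \<Rightarrow> nat \<Rightarrow> nat set \<Rightarrow> bool" where
  "reached A adj v C \<longleftrightarrow> C \<subseteq> A \<and> (\<forall>y\<in>A. adj v y \<longrightarrow> y \<in> C) \<and> (\<forall>x\<in>C. \<forall>y\<in>A. adj x y \<longrightarrow> y \<in> C) \<and>
     (\<forall>S. (\<forall>y\<in>A. adj v y \<longrightarrow> y \<in> S) \<longrightarrow> (\<forall>x\<in>S. \<forall>y\<in>A. adj x y \<longrightarrow> y \<in> S) \<longrightarrow> C \<subseteq> S)"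

lemma reachedD:
  assumes "reached A adj v C"
  shows "C \<subseteq> A" "\<And>y. y \<in> A \<Longrightarrow> adj v y \<Longrightarrow> y \<in> C" "\<And>x y. x \<in> C \<Longrightarrow> y \<in> A \<Longrightarrow> adj x y \<Longrightarrow> y \<in> C"
    "\<And>S. (\<And>y. y \<in> A \<Longrightarrow> adj v y \<Longrightarrow> y \<in> S) \<Longrightarrow> (\<And>x y. x \<in> S \<Longrightarrow> y \<in> A \<Longrightarrow> adj x y \<Longrightarrow> y \<in> S) \<Longrightarrow> C \<subseteq> S"
  using assms by (simp_all add: reached_def)

text \<open>No mark \<open>2\<close> is handed down: the candidates inside the part will be the
  neighbours of \<open>v\<close>, as they get coloured.\<close>

definition child_marks :: "(nat \<Rightarrow> nat \<Rightarrow> bool) \<Rightarrow> nat \<Rightarrow> nat set \<Rightarrow> nat \<Rightarrow> nat" where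
  "child_marks adj v C = (\<lambda>y. if y \<in> C then (if adj v y then 3 else 1) else 0)"

definition rest_marks :: "nat \<Rightarrow> nat set \<Rightarrow> (nat \<Rightarrow> nat) \<Rightarrow> nat \<Rightarrow> nat" where
  "rest_marks v C mk = (\<lambda>y. if y \<in> C \<or> y = v then 0 else mk y)"

lemma sem_split_off:
  assumes enc: "encodes n adj F M mk ls" and R: "R rF = F" "R rN = n" "R rK = 4 * n + 1" "R rV = v" "v < n"
  defines "A \<equiv> {y. y < n \<and> mk y = 1}"
  obtains R' M' C where "sem split_off (R, M) = (R', M')"
    "reached A adj v C" "encodes n adj (F + R rK) M' (child_marks adj v C) ls"
    "encodes n adj F M' (rest_marks v C mk) ls"
    "\<And>a. a < F \<Longrightarrow> M' a = M a" "R' rF = F + R rK" "\<And>r. r \<in> {rN, rK, rD, rW} \<Longrightarrow> R' r = R r"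
proof -
  interpret reach n adj mk v .
  define K where "K = R rK"
  have K: "K = 4 * n + 1" "n \<le> K" using R by (simp_all add: K_def)
  note e = encodesD[OF enc]
  obtain R1 where 1: "sem copy_frame (R, M) = (R1, shifted F K K M)" "\<And>r. r \<noteq> rI \<Longrightarrow> R1 r = R r"
    by (rule sem_copy_frame[of R M, unfolded R(1) K_def[symmetric]]) blast
  define M1 where "M1 = shifted F K K M"
  have M1: "M1 a = M a" if "a < F + K" for a using that by (simp add: M1_def shifted_def)
  have l: "linked n adj F M1 mk"
    unfolding linked_def
  proof (intro conjI allI impI)
    show "n * n \<le> F" by (rule e(1))
    show "M1 (x * n + y) \<noteq> 0 \<longleftrightarrow> adj x y" if "x < n" "y < n" for x y
      using e(2)[OF that] e(5)[OF that] by (simp add: M1)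
    show "M1 (F + y) = mk y" if "y < n" for y using e(3)[OF that] that K by (simp add: M1)
  qed
  define g0 where "g0 = (\<lambda>y. if adj v y \<and> mk y = 1 then 3 else 0 :: nat)"
  have R1: "R1 rF = F" "R1 rN = n" "R1 rK = K" "R1 rV = v" "R1 rV < n" using 1(2) R by (simp_all add: K_def)
  obtain R2 where 2: "sem seed (R1, M1) = (R2, put (F + K) n g0 M1)" "\<And>r. r \<noteq> rI \<Longrightarrow> R2 r = R1 r"
    unfolding g0_def
    apply (rule sem_seed[OF l R1(1-3,5) K(2), unfolded R1(4)])
    subgoal premises p for R' by (rule p(1)[OF p(2,3)])
    done
  have g0: "good g0"
    unfolding good_def by (auto simp: g0_def supp_def live_def)
  have R2: "R2 rF = F" "R2 rN = n" "R2 rK = K" using 2(2) R1 by simp_all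
  obtain R3 h where 3: "sem (For rA rN closure_round) (R2, put (F + K) n g0 M1) = (R3, put (F + K) n h M1)"
    "good h" "saturated (supp h)" "\<And>r. r \<notin> {rI, rA, rB} \<Longrightarrow> R3 r = R2 r"
    by (rule sem_closure[OF l R2 K(2) g0]) blast
  define M3 where "M3 = put (F + K) n h M1"
  have R3: "R3 rF = F" "R3 rN = n" "R3 rK = K" using 3(4) R2 by simp_all
  define q where "q = (\<lambda>y. if M3 (F + K + y) \<noteq> 0 then 0 else M3 (F + y))"
  obtain R4 where 4: "sem erase (R3, M3) = (R4, put F n q M3)" "\<And>r. r \<noteq> rI \<Longrightarrow> R4 r = R3 r"
    unfolding q_def
    apply (rule sem_erase[OF R3 K(2), of M3])
    subgoal premises p for R' by (rule p(1)[OF p(2,3)])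
    done
  define M5 where "M5 = put F n (q(v := 0)) M3"
  define C where "C = supp h"
  have R4: "R4 r = R r" if "r \<notin> {rI, rA, rB}" for r using that 1(2) 2(2) 3(4) 4(2) by simp
  have split_off_sem: "sem split_off (R, M) = (R4(rF := R4 rF + R4 rK), M5)"
    unfolding split_off_def sem.simps(4) 1(1) M1_def[symmetric] 2(1) 3(1) M3_def[symmetric] 4(1) sem_Sto_own
    using put_upd[of v n F q M3 0] R4 R by (simp add: M5_def)
  have CA: "C \<subseteq> A" using 3(2) by (simp add: C_def good_def live_def A_def)
  have low: "M5 a = M a" if "a < F" for a using that by (simp add: M5_def M3_def M1)
  have hC: "h y = (if y \<in> C then (if adj v y then 3 else 1) else 0)" if "y < n" for y
  proof (cases "y \<in> C")
    case True
    then have "y \<in> live" using CA by (auto simp: A_def live_def)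
    then have "h y = 3 \<longleftrightarrow> adj v y" "h y \<in> {0, 1, 3}" "h y \<noteq> 0"
      using 3(2) that True by (auto simp: good_def C_def supp_def)
    then show ?thesis using True by auto
  qed (use that in \<open>auto simp: C_def supp_def\<close>)
  have AL: "A = live" by (simp add: A_def live_def)
  have reached: "reached A adj v C"
    unfolding reached_def
  proof (intro conjI)
    show "\<forall>y\<in>A. adj v y \<longrightarrow> y \<in> C"
      using 3(2) by (auto simp: C_def good_def live_def A_def supp_def)
    show "\<forall>x\<in>C. \<forall>y\<in>A. adj x y \<longrightarrow> y \<in> C" using 3(3) by (simp add: C_def AL saturated_def)
    show "\<forall>S. (\<forall>y\<in>A. adj v y \<longrightarrow> y \<in> S) \<longrightarrow> (\<forall>x\<in>S. \<forall>y\<in>A. adj x y \<longrightarrow> y \<in> S) \<longrightarrow> C \<subseteq> S"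
      using 3(2) by (simp add: good_def C_def AL saturated_def)
  qed (rule CA)
  note split_off_sem reached
  moreover have "encodes n adj (F + K) M5 (child_marks adj v C) ls"
    unfolding encodes_def child_marks_def
  proof (intro conjI allI impI ballI)
    show "n * n \<le> F + K" using e(1) by simp
    show "M5 (x * n + y) \<noteq> 0 \<longleftrightarrow> adj x y" if "x < n" "y < n" for x y
      using e(2)[OF that] low[OF e(5)[OF that]] by simp
    show "M5 (F + K + y) = (if y \<in> C then (if adj v y then 3 else 1) else 0)" if "y < n" for y
    proof -
      have "M5 (F + K + y) = M3 (F + K + y)" using K(2) by (simp add: M5_def)
      then show ?thesis using hC[OF that] that by (simp add: M3_def)
    qed
    show "M5 (F + K + (d * n + y)) \<noteq> 0 \<longleftrightarrow> ls d y" if "d \<in> {1, 2, 3}" "y < n" for d y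
    proof -
      have a: "d * n + y < 4 * n" by (rule addr_less) (use that in auto)
      have b: "n \<le> d * n + y" using that(1) by auto
      have "M5 (F + K + (d * n + y)) = M1 (F + K + (d * n + y))"
        using b K by (simp add: M5_def M3_def put_def)
      also have "\<dots> = M (F + (d * n + y))" using a K by (simp add: M1_def shifted_def)
      finally show ?thesis using e(4)[OF that] by simp
    qed
  qed
  moreover have "encodes n adj F M5 (rest_marks v C mk) ls"
    unfolding encodes_def rest_marks_def
  proof (intro conjI allI impI ballI)
    show "n * n \<le> F" using e(1) by simp
    show "M5 (x * n + y) \<noteq> 0 \<longleftrightarrow> adj x y" if "x < n" "y < n" for x y
      using e(2)[OF that] low[OF e(5)[OF that]] by simp
    show "M5 (F + y) = (if y \<in> C \<or> y = v then 0 else mk y)" if "y < n" for y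
    proof -
      have "M3 (F + K + y) \<noteq> 0 \<longleftrightarrow> y \<in> C" using hC[OF that] that by (simp add: M3_def)
      moreover have "M3 (F + y) = mk y" using e(3)[OF that] that K by (simp add: M3_def M1)
      ultimately show ?thesis using that by (simp add: M5_def q_def)
    qed
    show "M5 (F + (d * n + y)) \<noteq> 0 \<longleftrightarrow> ls d y" if "d \<in> {1, 2, 3}" "y < n" for d y
    proof -
      have a: "d * n + y < 4 * n" by (rule addr_less) (use that in auto)
      have b: "n \<le> d * n + y" using that(1) by auto
      have "M5 (F + (d * n + y)) = M (F + (d * n + y))"
        using a b K by (simp add: M5_def M3_def put_def M1)
      then show ?thesis using e(4)[OF that] by simp
    qed
  qed
  moreover have "M5 a = M a" if "a < F" for a using that by (rule low)
  moreover have "(R4(rF := R4 rF + R4 rK)) rF = F + K" using R4 R by (simp add: K_def)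
  moreover have "(R4(rF := R4 rF + R4 rK)) r = R r" if "r \<in> {rN, rK, rD, rW}" for r using R4 that by auto
  ultimately show thesis unfolding K_def by (rule that)
qed

section \<open>A single recursion step\<close>

text \<open>A common bound for a node of either procedure: the blocks of both added up, with
  \<open>20\<close> for the calls and tests between them.\<close>

definition node_time :: "nat \<Rightarrow> nat" where
  "node_time X = time (rX \<leftarrow> ANum 0 ;; find_mark 3) X + time find_color X +
     time (rX \<leftarrow> ANum 0 ;; find_mark 1 ;; find_mark 2) X + time split_off X + time (rF \<leftarrow> AVar rF \<ominus> AVar rK) X +
     time select X + time (pre_branch 0) X + time (pre_branch 2) X + time mid_branch X + time post_branch X +
     time (rW \<leftarrow> ANum 0) X + time Nop X + 20"

lemmas block_defs = copy_frame_def assign_def weigh_def double_W_def pre_branch_def mid_branch_def post_branch_def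
  find_mark_def find_color_def try_color_def split_off_def seed_def closure_round_def spread_def erase_def
  select_def try_pair_def list_size_def count_nbrs_def pick_def expr_defs

definition drop_nbrs :: "(nat \<Rightarrow> nat \<Rightarrow> bool) \<Rightarrow> nat \<Rightarrow> nat \<Rightarrow> (nat \<Rightarrow> nat \<Rightarrow> bool) \<Rightarrow> nat \<Rightarrow> nat \<Rightarrow> bool" where
  "drop_nbrs adj v c ls = (\<lambda>d y. ls d y \<and> \<not> (d = c \<and> adj v y))"

definition drop_color :: "nat \<Rightarrow> nat \<Rightarrow> (nat \<Rightarrow> nat \<Rightarrow> bool) \<Rightarrow> nat \<Rightarrow> nat \<Rightarrow> bool" where
  "drop_color v c ls = (\<lambda>d y. ls d y \<and> \<not> (d = c \<and> y = v))"

text \<open>The cell \<open>F + 4 * n\<close> is outside the region of agreement, so saving an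
  accumulator there leaves the instance intact.\<close>

lemma encodes_cong:
  assumes "encodes n adj F M mk ls" "\<And>a. a < F + 4 * n \<Longrightarrow> M' a = M a"
  shows "encodes n adj F M' mk ls"
  unfolding encodes_def
proof (intro conjI allI impI ballI)
  note e = encodesD[OF assms(1)]
  show "n * n \<le> F" by (rule e(1))
  show "M' (x * n + y) \<noteq> 0 \<longleftrightarrow> adj x y" if "x < n" "y < n" for x y
    using e(2,5)[OF that] assms(2)[of "x * n + y"] by simp
  show "M' (F + y) = mk y" if "y < n" for y using e(3)[OF that] assms(2)[of "F + y"] that by simp
  show "M' (F + (d * n + y)) \<noteq> 0 \<longleftrightarrow> ls d y" if "d \<in> {1, 2, 3}" "y < n" for d y
  proof -
    have "d * n + y < 4 * n" by (rule addr_less) (use that in auto)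
    then show ?thesis using e(4)[OF that] assms(2)[of "F + (d * n + y)"] by simp
  qed
qed

section \<open>Specification of the recursive procedures\<close>

locale machine =
  fixes n :: nat and adj :: "nat \<Rightarrow> nat \<Rightarrow> bool" and D :: nat
begin

abbreviation "K \<equiv> 4 * n + 1"

definition ready :: "nat \<Rightarrow> (nat \<Rightarrow> nat) \<Rightarrow> bool" where
  "ready F R \<longleftrightarrow> R rN = n \<and> R rK = K \<and> R rD = D \<and> R rF = F"

definition returns :: "nat \<Rightarrow> nat \<Rightarrow> state \<Rightarrow> state \<Rightarrow> bool" where
  "returns F z s s' \<longleftrightarrow> ready F (fst s') \<and> fst s' rW = fst s rW * z \<and> (\<forall>a<F. snd s' a = snd s a)"

text \<open>The quantification over frame, accumulator and memory makes one fact about an instance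
  usable for every call on it.\<close>

definition solves :: "nat \<Rightarrow> real \<Rightarrow> (nat \<Rightarrow> nat) \<Rightarrow> (nat \<Rightarrow> nat \<Rightarrow> bool) \<Rightarrow> nat \<Rightarrow> bool" where
  "solves p T mk ls z \<longleftrightarrow> (\<forall>F R M. ready F R \<longrightarrow> encodes n adj F M mk ls \<longrightarrow>
     runs (Call p) (R, M) T (returns F z (R, M)))"

lemma solvesD: "solves p T mk ls z \<Longrightarrow> ready F R \<Longrightarrow> encodes n adj F M mk ls \<Longrightarrow>
    runs (Call p) (R, M) T (returns F z (R, M))"
  by (simp add: solves_def)

lemma readyD: "ready F R \<Longrightarrow> R rF = F" "ready F R \<Longrightarrow> R rN = n" "ready F R \<Longrightarrow> R rK = K" "ready F R \<Longrightarrow> R rD = D"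
  by (simp_all add: ready_def)

lemma ready_agree: "agree R R' \<Longrightarrow> ready F R \<longleftrightarrow> ready F R'"
  by (simp add: ready_def agree_def)

lemma returns_W: "R rW = R' rW \<Longrightarrow> returns F z (R, M) = returns F z (R', M)"
  by (simp add: returns_def fun_eq_iff)

text \<open>With limits and multipliers only in \<open>rN\<close> and \<open>rK\<close>, both at
  most \<open>K\<close>, a block costs at most \<open>time c K\<close>, whatever the accumulator
  holds.\<close>

definition block :: "stm \<Rightarrow> bool" where
  "block c \<longleftrightarrow> wfs c \<and> lims c \<subseteq> {rN, rK} \<and> mods c \<inter> {rN, rK} = {}"

lemma block_simps:
  "block (rX \<leftarrow> ANum 0 ;; find_mark 3)" "block find_color" "block (rX \<leftarrow> ANum 0 ;; find_mark 1 ;; find_mark 2)"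
  "block split_off" "block (rF \<leftarrow> AVar rF \<ominus> AVar rK)" "block select" "block (pre_branch m)" "block mid_branch"
  "block post_branch" "block (rW \<leftarrow> ANum 0)" "block Nop"
  by (simp_all add: block_def block_defs)

lemma runs_block:
  assumes "block c" "ready F R" "sem c (R, M) = (Ra, Ma)" "\<And>R1. agree R1 Ra \<Longrightarrow> Q (R1, Ma)"
  shows "runs (comp c) (R, M) (real (time c K)) Q"
  by (rule runs_comp) (use assms in \<open>auto simp: block_def ready_def\<close>)

lemma runs_block_Seq:
  assumes "block c" "ready F R" "sem c (R, M) = (Ra, Ma)" "\<And>R1. agree R1 Ra \<Longrightarrow> runs c2 (R1, Ma) T Q"
  shows "runs (Seq (comp c) c2) (R, M) (real (time c K) + T) Q"
proof (rule runs_Seq)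
  show "runs (comp c) (R, M) (real (time c K)) (\<lambda>s. \<exists>R1. agree R1 Ra \<and> s = (R1, Ma))"
    by (rule runs_block[OF assms(1-3)]) blast
qed (use assms(4) in auto)

lemma runs_solves_Seq:
  assumes "solves p T1 mk ls z" "ready F R" "encodes n adj F M mk ls"
    "\<And>R1 M1. ready F R1 \<Longrightarrow> R1 rW = R rW * z \<Longrightarrow> (\<And>a. a < F \<Longrightarrow> M1 a = M a) \<Longrightarrow> runs c2 (R1, M1) T Q"
  shows "runs (Seq (Call p) c2) (R, M) (T1 + T) Q"
proof (rule runs_Seq[OF solvesD[OF assms(1-3)]])
  fix s assume "returns F z (R, M) s"
  then show "runs c2 s T Q" using assms(4)[of "fst s" "snd s"] by (simp add: returns_def)
qed

text \<open>Starting from accumulator \<open>W\<close>, the first call ends with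
  \<open>W * wt K c * z1\<close>; with \<open>W\<close> restored from the saved cell, the second
  ends with \<open>W * z2\<close>. Their sum is \<open>W\<close> times the value of the
  node.\<close>

lemma runs_branch:
  assumes 1: "solves p T1 (mk(v := m)) (drop_nbrs adj v c ls) z1" and 2: "solves p T2 mk (drop_color v c ls) z2"
    and st: "ready F R" "encodes n adj F M mk ls" "R rV = v" "v < n" "R rC = c" "c \<in> {1, 2, 3}"
  shows "runs (branch p m) (R, M)
    (real (time (pre_branch m) K) + (T1 + (real (time mid_branch K) + (T2 + real (time post_branch K)))))
    (returns F (wt K c * z1 + z2) (R, M))"
proof -
  note R = readyD[OF st(1)]
  obtain Ra Ma where a: "sem (pre_branch m) (R, M) = (Ra, Ma)"
    "encodes n adj (F + R rK) Ma (mk(v := m)) (drop_nbrs adj v c ls)"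
    "encodes n adj F Ma mk (drop_color v c ls)"
    "Ma (F + 4 * n) = R rW" "\<And>a. a < F \<Longrightarrow> Ma a = M a" "Ra rF = F + R rK" "Ra rW = R rW * wt (R rK) c"
    "Ra rN = n" "Ra rK = R rK" "Ra rD = R rD"
    unfolding drop_nbrs_def drop_color_def
    by (rule sem_pre_branch[OF st(2) R(1,2,3) st(3-6), of m]) blast
  show ?thesis
    unfolding branch_def
  proof (rule runs_block_Seq[OF block_simps(7) st(1) a(1)])
    fix R1 assume "agree R1 Ra"
    then have R1: "ready (F + K) R1" "R1 rW = R rW * wt K c" using a R by (simp_all add: ready_def agree_def)
    have e1: "encodes n adj (F + K) Ma (mk(v := m)) (drop_nbrs adj v c ls)" using a(2) R by simp
    show "runs (Seq (Call p) (Seq (comp mid_branch) (Seq (Call p) (comp post_branch)))) (R1, Ma)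
      (T1 + (real (time mid_branch K) + (T2 + real (time post_branch K)))) (returns F (wt K c * z1 + z2) (R, M))"
    proof (rule runs_solves_Seq[OF 1 R1(1) e1])
      fix R2 M2 assume R2: "ready (F + K) R2" "R2 rW = R1 rW * z1" and M2: "\<And>a. a < F + K \<Longrightarrow> M2 a = Ma a"
      note R2' = readyD[OF R2(1)]
      have e2: "encodes n adj F M2 mk (drop_color v c ls)" by (rule encodes_cong[OF a(3)]) (simp add: M2)
      have F2: "R2 rF = F + R2 rK" using R2' by simp
      obtain Rb Mb where b: "sem mid_branch (R2, M2) = (Rb, Mb)"
        "encodes n adj (F + R2 rK) Mb mk (drop_color v c ls)" "Mb (F + 4 * n) = R2 rW" "\<And>a. a < F \<Longrightarrow> Mb a = M2 a"
        "Rb rF = F + R2 rK" "Rb rW = M2 (F + 4 * n)" "Rb rN = n" "Rb rK = R2 rK" "Rb rD = R2 rD"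
        by (rule sem_mid_branch[OF e2 F2 R2'(2,3)]) blast
      show "runs (Seq (comp mid_branch) (Seq (Call p) (comp post_branch))) (R2, M2)
        (real (time mid_branch K) + (T2 + real (time post_branch K))) (returns F (wt K c * z1 + z2) (R, M))"
      proof (rule runs_block_Seq[OF block_simps(8) R2(1) b(1)])
        fix R3 assume "agree R3 Rb"
        then have R3: "ready (F + K) R3" "R3 rW = R rW"
          using b R2' M2[of "F + 4 * n"] a(4) by (simp_all add: ready_def agree_def)
        have e3: "encodes n adj (F + K) Mb mk (drop_color v c ls)" using b(2) R2' by simp
        show "runs (Seq (Call p) (comp post_branch)) (R3, Mb) (T2 + real (time post_branch K))
          (returns F (wt K c * z1 + z2) (R, M))"
        proof (rule runs_solves_Seq[OF 2 R3(1) e3])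
          fix R4 M4 assume R4: "ready (F + K) R4" "R4 rW = R3 rW * z2" and M4: "\<And>a. a < F + K \<Longrightarrow> M4 a = Mb a"
          note R4' = readyD[OF R4(1)]
          have F4: "R4 rF = F + R4 rK" using R4' by simp
          show "runs (comp post_branch) (R4, M4) (real (time post_branch K)) (returns F (wt K c * z1 + z2) (R, M))"
          proof (rule runs_block[OF block_simps(9) R4(1) sem_post_branch[OF F4]])
            fix R5 assume ag: "agree R5 (R4(rF := F, rW := R4 rW + M4 (F + 4 * R4 rN)))"
            have "R5 rW = R rW * (wt K c * z1 + z2)"
              using ag R4' R4(2) R3(2) R2(2) R1(2) b(3) M4[of "F + 4 * n"] by (simp add: agree_def algebra_simps)
            moreover have "ready F R5" using ag R4' by (simp add: ready_def agree_def)
            ultimately show "returns F (wt K c * z1 + z2) (R, M) (R5, M4)"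
              using M4 b(4) M2 a(5) by (simp add: returns_def)
          qed
        qed
      qed
    qed
  qed
qed

lemma zero_runs:
  assumes "ready F R"
  shows "runs (comp (rW \<leftarrow> ANum 0)) (R, M) (real (time (rW \<leftarrow> ANum 0) K)) (returns F 0 (R, M))"
  by (rule runs_block[OF block_simps(10) assms]) (use assms in \<open>auto simp: ready_def returns_def agree_def\<close>)

lemma solves_CallI:
  assumes "p < length prog" "\<And>F R M. ready F R \<Longrightarrow> encodes n adj F M mk ls \<Longrightarrow>
    runs (prog ! p) (R, M) (T - 1) (returns F z (R, M))"
  shows "solves p T mk ls z"
  unfolding solves_def
proof (intro allI impI)
  fix F R M assume "ready F R" "encodes n adj F M mk ls"
  then have "runs (Call p) (R, M) (T - 1 + 1) (returns F z (R, M))"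
    by (intro runs_Call assms)
  then show "runs (Call p) (R, M) T (returns F z (R, M))" by simp
qed

text \<open>Turns the code into a recurrence: a user of this rule deals only with subinstances,
  their values and their times, no longer with states.\<close>

lemma solves_rec1:
  fixes T :: real
  assumes emp: "\<And>v. v < n \<Longrightarrow> mk v \<noteq> 0 \<Longrightarrow> colors ls v = {} \<Longrightarrow> z = 0"
    and br: "\<And>v c. (\<forall>v<n. mk v \<noteq> 0 \<longrightarrow> colors ls v \<noteq> {}) \<Longrightarrow> v < n \<Longrightarrow> mk v \<noteq> 0 \<Longrightarrow> c \<in> colors ls v \<Longrightarrow>
      card (colors ls v) = 1 \<or> D \<le> card (nbrs n adj mk ls v c) \<Longrightarrow>
      \<exists>(T1 :: real) (T2 :: real) z1 z2. solves 1 T1 (mk(v := 0)) (drop_nbrs adj v c ls) z1 \<and>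
        solves 1 T2 mk (drop_color v c ls) z2 \<and> T1 + T2 + node_time K \<le> T \<and> z = wt K c * z1 + z2"
    and go: "(\<And>v. v < n \<Longrightarrow> mk v \<noteq> 0 \<Longrightarrow> colors ls v \<noteq> {}) \<Longrightarrow>
      (\<And>v c. v < n \<Longrightarrow> mk v \<noteq> 0 \<Longrightarrow> c \<in> colors ls v \<Longrightarrow>
        card (colors ls v) \<noteq> 1 \<and> card (nbrs n adj mk ls v c) < D) \<Longrightarrow>
      \<exists>T2 :: real. solves 2 T2 mk ls z \<and> T2 + node_time K \<le> T"
    and T: "node_time K \<le> T"
  shows "solves 1 T mk ls z"
proof (rule solves_CallI)
  fix F R M
  assume st: "ready F R" "encodes n adj F M mk ls"
  note R = readyD[OF st(1)]
  obtain Ra where a: "sem select (R, M) = (Ra, M)"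
    "Ra rY = 0 \<longleftrightarrow> (\<forall>v<n. mk v \<noteq> 0 \<longrightarrow> colors ls v \<noteq> {})"
    "\<And>v c. Ra rX = 0 \<Longrightarrow> v < n \<Longrightarrow> mk v \<noteq> 0 \<Longrightarrow> c \<in> colors ls v \<Longrightarrow>
       card (colors ls v) \<noteq> 1 \<and> card (nbrs n adj mk ls v c) < R rD"
    "Ra rX \<noteq> 0 \<Longrightarrow> Ra rV < n \<and> mk (Ra rV) \<noteq> 0 \<and> Ra rC \<in> colors ls (Ra rV) \<and>
       (card (colors ls (Ra rV)) = 1 \<or> R rD \<le> card (nbrs n adj mk ls (Ra rV) (Ra rC)))"
    "\<And>r. r \<in> {rN, rK, rD, rF, rW} \<Longrightarrow> Ra r = R r"
    apply (rule sem_select[OF st(2) R(1,2)])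
    subgoal premises p for Ra by (rule p(1)[OF p(2-6)])
    done
  define Tb where "Tb = T - 1 - real (time select K) - 2"
  have nt: "real (time select K) + real (time (rW \<leftarrow> ANum 0) K) + real (time (pre_branch 0) K) +
      real (time mid_branch K) + real (time post_branch K) + 20 \<le> real (node_time K)"
    unfolding node_time_def of_nat_add by linarith
  have "runs rec1 (R, M) (real (time select K) + (Tb + 1 + 1)) (returns F z (R, M))"
    unfolding rec1_def
  proof (rule runs_block_Seq[OF block_simps(6) st(1) a(1)])
    fix R1 assume "agree R1 Ra"
    then have R1: "R1 r = Ra r" if "r < 100" for r using that by (simp add: agree_def)
    have rd: "ready F R1" "R1 rW = R rW" using R1 a(5) R by (simp_all add: ready_def)
    note ret = returns_W[of R1 R, OF rd(2)]
    show "runs (IfNZ rY (comp (rW \<leftarrow> ANum 0)) (IfNZ rX (branch 1 0) (Call 2))) (R1, M) (Tb + 1 + 1) (returns F z (R, M))"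
    proof (intro runs_IfNZ)
      assume "fst (R1, M) rY \<noteq> 0"
      then have "\<exists>v<n. mk v \<noteq> 0 \<and> colors ls v = {}" using a(2) R1[of rY] by auto
      then have z: "z = 0" using emp by blast
      show "runs (comp (rW \<leftarrow> ANum 0)) (R1, M) (Tb + 1) (returns F z (R, M))"
        by (rule runs_mono[OF zero_runs[OF rd(1)]]) (use T nt ret z in \<open>auto simp: Tb_def\<close>)
    next
      assume "fst (R1, M) rY = 0"
      then have ne: "\<forall>v<n. mk v \<noteq> 0 \<longrightarrow> colors ls v \<noteq> {}" using a(2) R1[of rY] by simp
      {
        assume "fst (R1, M) rX \<noteq> 0"
        then have X: "Ra rX \<noteq> 0" using R1[of rX] by simp
        define v c where "v = Ra rV" and "c = Ra rC"
        have vc: "v < n" "mk v \<noteq> 0" "c \<in> colors ls v" "card (colors ls v) = 1 \<or> D \<le> card (nbrs n adj mk ls v c)"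
          using a(4)[OF X] R(4) by (simp_all add: v_def c_def)
        obtain T1 T2 :: real and z1 z2 where h: "solves 1 T1 (mk(v := 0)) (drop_nbrs adj v c ls) z1"
          "solves 1 T2 mk (drop_color v c ls) z2" "T1 + T2 + node_time K \<le> T" "z = wt K c * z1 + z2"
          using br[OF ne vc] by blast
        have regs: "R1 rV = v" "R1 rC = c" "c \<in> {1, 2, 3}"
          using R1[of rV] R1[of rC] vc(3) by (auto simp: v_def c_def colors_def)
        show "runs (branch 1 0) (R1, M) Tb (returns F z (R, M))"
          by (rule runs_mono[OF runs_branch[OF h(1,2) rd(1) st(2) regs(1) vc(1) regs(2,3)]])
            (use h(3,4) nt ret in \<open>auto simp: Tb_def\<close>)
      next
        assume "fst (R1, M) rX = 0"
        then have X: "Ra rX = 0" using R1[of rX] by simp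
        obtain T2 :: real where h: "solves 2 T2 mk ls z" "T2 + node_time K \<le> T"
          using go ne a(3)[OF X] R(4) by blast
        show "runs (Call 2) (R1, M) Tb (returns F z (R, M))"
          by (rule runs_mono[OF solvesD[OF h(1) rd(1) st(2)]]) (use h(2) nt ret in \<open>auto simp: Tb_def\<close>)
      }
    qed
  qed
  then show "runs (prog ! 1) (R, M) (T - 1) (returns F z (R, M))"
    by (simp add: prog_def Tb_def)
qed (simp add: prog_def)

lemma runs_color_step:
  fixes T :: real
  assumes emp: "colors ls v = {} \<Longrightarrow> z = 0"
    and br: "\<And>c. c \<in> colors ls v \<Longrightarrow>
      \<exists>(T1 :: real) (T2 :: real) z1 z2. solves 2 T1 (mk(v := 2)) (drop_nbrs adj v c ls) z1 \<and>
        solves 2 T2 mk (drop_color v c ls) z2 \<and>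
        real (time find_color K) + (real (time (pre_branch 2) K) + (T1 + (real (time mid_branch K) +
          (T2 + real (time post_branch K))))) + 1 \<le> T \<and> z = wt K c * z1 + z2"
    and T: "real (time find_color K) + real (time (rW \<leftarrow> ANum 0) K) + 1 \<le> T"
    and st: "ready F R" "encodes n adj F M mk ls" "R rV = v" "v < n"
  shows "runs color_step (R, M) T (returns F z (R, M))"
proof -
  note R = readyD[OF st(1)]
  obtain Rb where b: "sem find_color (R, M) = (Rb, M)"
    "(\<exists>c\<in>{1, 2, 3}. M (R rF + (c * R rN + R rV)) \<noteq> 0 \<and> Rb rX = 1 \<and> Rb rC = c) \<or>
     (\<forall>c\<in>{1, 2, 3}. M (R rF + (c * R rN + R rV)) = 0) \<and> Rb rX = 0"
    "\<And>r. r \<notin> {rC, rX} \<Longrightarrow> Rb r = R r"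
    apply (rule sem_find_color[of R M])
    subgoal premises p for R' by (rule p(1)[OF p(2-4)])
    done
  have m: "M (R rF + (c * R rN + R rV)) \<noteq> 0 \<longleftrightarrow> ls c v" if "c \<in> {1, 2, 3}" for c
    using encodesD(4)[OF st(2) that st(4)] R st(3) by simp
  have b2: "(Rb rC \<in> colors ls v \<and> Rb rX = 1) \<or> (colors ls v = {} \<and> Rb rX = 0)"
    using b(2)
  proof (elim disjE bexE conjE)
    fix c :: nat assume c: "c \<in> {1, 2, 3}" "M (R rF + (c * R rN + R rV)) \<noteq> 0" "Rb rX = 1" "Rb rC = c"
    then have "ls c v" using m by blast
    then show ?thesis using c by (simp add: colors_def)
  next
    assume c: "\<forall>c\<in>{1, 2, 3}. M (R rF + (c * R rN + R rV)) = 0" "Rb rX = 0"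
    have "\<not> ls c v" if "c \<in> {1, 2, 3}" for c using m[OF that] c(1) that by auto
    then have "colors ls v = {}" unfolding colors_def by blast
    then show ?thesis using c(2) by simp
  qed
  have "runs color_step (R, M) (real (time find_color K) + (T - real (time find_color K) - 1 + 1)) (returns F z (R, M))"
    unfolding color_step_def
  proof (rule runs_block_Seq[OF block_simps(2) st(1) b(1)])
    fix R2 assume "agree R2 Rb"
    then have R2: "R2 r = Rb r" if "r < 100" for r using that by (simp add: agree_def)
    have rd2: "ready F R2" "R2 rW = R rW" "R2 rV = v"
      using R2 b(3) R st(3) by (simp_all add: ready_def)
    note ret = returns_W[of R2 R, OF rd2(2)]
    show "runs (IfNZ rX (branch 2 2) (comp (rW \<leftarrow> ANum 0))) (R2, M) (T - real (time find_color K) - 1 + 1) (returns F z (R, M))"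
    proof (rule runs_IfNZ)
      assume "fst (R2, M) rX \<noteq> 0"
      then have c: "Rb rC \<in> colors ls v" using b2 R2[of rX] by auto
      obtain T1 T2 :: real and z1 z2 where h: "solves 2 T1 (mk(v := 2)) (drop_nbrs adj v (Rb rC) ls) z1"
        "solves 2 T2 mk (drop_color v (Rb rC) ls) z2"
        "real (time find_color K) + (real (time (pre_branch 2) K) + (T1 + (real (time mid_branch K) +
          (T2 + real (time post_branch K))))) + 1 \<le> T" "z = wt K (Rb rC) * z1 + z2"
        using br[OF c] by blast
      have regs: "R2 rC = Rb rC" "Rb rC \<in> {1, 2, 3}" using R2[of rC] c by (auto simp: colors_def)
      show "runs (branch 2 2) (R2, M) (T - real (time find_color K) - 1) (returns F z (R, M))"
        by (rule runs_mono[OF runs_branch[OF h(1,2) rd2(1) st(2) rd2(3) st(4) regs]]) (use h(3,4) ret in auto)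
    next
      assume "fst (R2, M) rX = 0"
      then have z: "z = 0" using b2 R2[of rX] emp by auto
      show "runs (comp (rW \<leftarrow> ANum 0)) (R2, M) (T - real (time find_color K) - 1) (returns F z (R, M))"
        by (rule runs_mono[OF zero_runs[OF rd2(1)]]) (use T ret z in auto)
    qed
  qed
  then show ?thesis by simp
qed

lemma runs_split_step:
  fixes T :: real
  assumes sp: "\<And>C. reached {y. y < n \<and> mk y = 1} adj v C \<Longrightarrow>
      \<exists>(T1 :: real) (T2 :: real) z1 z2. solves 2 T1 (child_marks adj v C) ls z1 \<and>
        solves 2 T2 (rest_marks v C mk) ls z2 \<and>
        real (time split_off K) + (T1 + (real (time (rF \<leftarrow> AVar rF \<ominus> AVar rK) K) + T2)) \<le> T \<and> z = z1 * z2"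
    and st: "ready F R" "encodes n adj F M mk ls" "R rV = v" "v < n"
  shows "runs split_step (R, M) T (returns F z (R, M))"
proof -
  note R = readyD[OF st(1)]
  obtain Rc Mc C where c: "sem split_off (R, M) = (Rc, Mc)" "reached {y. y < n \<and> mk y = 1} adj v C"
    "encodes n adj (F + R rK) Mc (child_marks adj v C) ls" "encodes n adj F Mc (rest_marks v C mk) ls"
    "\<And>a. a < F \<Longrightarrow> Mc a = M a" "Rc rF = F + R rK" "\<And>r. r \<in> {rN, rK, rD, rW} \<Longrightarrow> Rc r = R r"
    apply (rule sem_split_off[OF st(2) R(1-3) st(3,4)])
    subgoal premises p for R' M' C by (rule p(1)[OF p(2-8)])
    done
  from sp[OF c(2)]
  obtain T1 T2 :: real and z1 z2 where h: "solves 2 T1 (child_marks adj v C) ls z1"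
    "solves 2 T2 (rest_marks v C mk) ls z2"
    "real (time split_off K) + (T1 + (real (time (rF \<leftarrow> AVar rF \<ominus> AVar rK) K) + T2)) \<le> T" "z = z1 * z2"
    by blast
  have "runs split_step (R, M) (real (time split_off K) + (T1 + (real (time (rF \<leftarrow> AVar rF \<ominus> AVar rK) K) + T2)))
      (returns F z (R, M))"
    unfolding split_step_def
  proof (rule runs_block_Seq[OF block_simps(4) st(1) c(1)])
    fix R1 assume "agree R1 Rc"
    then have R1: "ready (F + K) R1" "R1 rW = R rW" using c(6,7) R by (simp_all add: ready_def agree_def)
    have e1: "encodes n adj (F + K) Mc (child_marks adj v C) ls" using c(3) R by simp
    show "runs (Seq (Call 2) (Seq (comp (rF \<leftarrow> AVar rF \<ominus> AVar rK)) (Call 2))) (R1, Mc)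
      (T1 + (real (time (rF \<leftarrow> AVar rF \<ominus> AVar rK) K) + T2)) (returns F z (R, M))"
    proof (rule runs_solves_Seq[OF h(1) R1(1) e1])
      fix R2 M2 assume R2: "ready (F + K) R2" "R2 rW = R1 rW * z1" and M2: "\<And>a. a < F + K \<Longrightarrow> M2 a = Mc a"
      have s: "sem (rF \<leftarrow> AVar rF \<ominus> AVar rK) (R2, M2) = (R2(rF := F), M2)" using readyD[OF R2(1)] by simp
      show "runs (Seq (comp (rF \<leftarrow> AVar rF \<ominus> AVar rK)) (Call 2)) (R2, M2)
        (real (time (rF \<leftarrow> AVar rF \<ominus> AVar rK) K) + T2) (returns F z (R, M))"
      proof (rule runs_block_Seq[OF block_simps(5) R2(1) s])
        fix R3 assume "agree R3 (R2(rF := F))"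
        then have R3: "ready F R3" "R3 rW = R rW * z1" using R2 R1(2) by (simp_all add: ready_def agree_def)
        have e3: "encodes n adj F M2 (rest_marks v C mk) ls"
          by (rule encodes_cong[OF c(4)]) (simp add: M2)
        show "runs (Call 2) (R3, M2) T2 (returns F z (R, M))"
        proof (rule runs_mono[OF solvesD[OF h(2) R3(1) e3] order_refl])
          fix s' assume "returns F z2 (R3, M2) s'"
          then show "returns F z (R, M) s'" using R3(2) M2 c(5) h(4) by (simp add: returns_def)
        qed
      qed
    qed
  qed
  then show ?thesis by (rule runs_mono) (use h(3) in auto)
qed

text \<open>The counterpart for phase 2. If no marked vertex is left, the accumulator stays as it
  is, which means the factor \<open>1\<close>, the weight of the empty colouring.\<close>

lemma solves_rec2:
  fixes T :: real
  assumes emp: "\<And>v. v < n \<Longrightarrow> mk v = 3 \<Longrightarrow> colors ls v = {} \<Longrightarrow> z = 0"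
    and br: "\<And>v c. v < n \<Longrightarrow> mk v = 3 \<Longrightarrow> c \<in> colors ls v \<Longrightarrow>
      \<exists>(T1 :: real) (T2 :: real) z1 z2. solves 2 T1 (mk(v := 2)) (drop_nbrs adj v c ls) z1 \<and>
        solves 2 T2 mk (drop_color v c ls) z2 \<and> T1 + T2 + node_time K \<le> T \<and> z = wt K c * z1 + z2"
    and sp: "\<And>v C. \<forall>y<n. mk y \<noteq> 3 \<Longrightarrow> v < n \<Longrightarrow> mk v = 2 \<or> mk v = 1 \<and> (\<forall>y<n. mk y \<noteq> 2) \<Longrightarrow>
      reached {y. y < n \<and> mk y = 1} adj v C \<Longrightarrow>
      \<exists>(T1 :: real) (T2 :: real) z1 z2. solves 2 T1 (child_marks adj v C) ls z1 \<and>
        solves 2 T2 (rest_marks v C mk) ls z2 \<and>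
        T1 + T2 + node_time K \<le> T \<and> z = z1 * z2"
    and fin: "\<forall>y<n. mk y \<noteq> 3 \<and> mk y \<noteq> 2 \<and> mk y \<noteq> 1 \<Longrightarrow> z = 1"
    and T: "node_time K \<le> T"
  shows "solves 2 T mk ls z"
proof (rule solves_CallI)
  fix F R M
  assume st: "ready F R" "encodes n adj F M mk ls"
  note R = readyD[OF st(1)]
  note e = encodesD(3)[OF st(2)]
  let ?f3 = "rX \<leftarrow> ANum 0 ;; find_mark 3" and ?f12 = "rX \<leftarrow> ANum 0 ;; find_mark 1 ;; find_mark 2"
  have nt: "real (time ?f3 K) + real (time find_color K) + real (time ?f12 K) + real (time split_off K) +
      real (time (rF \<leftarrow> AVar rF \<ominus> AVar rK) K) + real (time (pre_branch 2) K) + real (time mid_branch K) +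
      real (time post_branch K) + real (time (rW \<leftarrow> ANum 0) K) + real (time Nop K) + 20 \<le> real (node_time K)"
    unfolding node_time_def of_nat_add by linarith
  note pos = of_nat_0_le_iff[of "time c K" for c, where 'a = real]
  have fm: "\<exists>R'. sem (find_mark m) (R, M) = (R', M) \<and> ((\<exists>v<n. mk v = m \<and> R' rX = 1 \<and> R' rV = v) \<or>
     (\<forall>y<n. mk y \<noteq> m) \<and> R' rX = R rX \<and> R' rV = R rV) \<and> (\<forall>r. r \<notin> {rI, rV, rX} \<longrightarrow> R' r = R r)"
    if "R rF = F" "R rN = n" for R m
    by (rule sem_find_mark[of m R M]) (use that e in auto)
  obtain Ra where a: "sem (find_mark 3) (R(rX := 0), M) = (Ra, M)"
    "(\<exists>v<n. mk v = 3 \<and> Ra rX = 1 \<and> Ra rV = v) \<or> (\<forall>y<n. mk y \<noteq> 3) \<and> Ra rX = 0"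
    "\<And>r. r \<notin> {rI, rV, rX} \<Longrightarrow> Ra r = (R(rX := 0)) r"
    using fm[of "R(rX := 0)" 3] R by auto
  define T3 where "T3 = T - 1 - real (time ?f3 K) - 1"
  have sa: "sem ?f3 (R, M) = (Ra, M)" using a(1) by simp
  have "runs rec2 (R, M) (real (time ?f3 K) + (T3 + 1)) (returns F z (R, M))"
    unfolding rec2_def
  proof (rule runs_block_Seq[OF block_simps(1) st(1) sa])
    fix R1 assume "agree R1 Ra"
    then have R1: "R1 r = Ra r" if "r < 100" for r using that by (simp add: agree_def)
    have rd: "ready F R1" "R1 rW = R rW" using R1 a(3) R by (simp_all add: ready_def)
    note R1' = readyD[OF rd(1)]
    note ret = returns_W[of R1 R, OF rd(2)]
    show "runs (IfNZ rX color_step (Seq (comp ?f12) (IfNZ rX split_step (comp Nop)))) (R1, M) (T3 + 1) (returns F z (R, M))"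
    proof (rule runs_IfNZ)
      assume "fst (R1, M) rX \<noteq> 0"
      then have v: "mk (R1 rV) = 3" "R1 rV < n" using a(2) R1[of rX] R1[of rV] by auto
      show "runs color_step (R1, M) T3 (returns F z (R, M))"
        unfolding ret[symmetric]
      proof (rule runs_color_step[OF _ _ _ rd(1) st(2) refl v(2)])
        show "colors ls (R1 rV) = {} \<Longrightarrow> z = 0" using emp v by blast
        show "real (time find_color K) + real (time (rW \<leftarrow> ANum 0) K) + 1 \<le> T3"
          using T nt pos unfolding T3_def by (smt (verit))
        fix c assume "c \<in> colors ls (R1 rV)"
        from br[OF v(2,1) this] obtain T1 T2 :: real and z1 z2 where
          "solves 2 T1 (mk(R1 rV := 2)) (drop_nbrs adj (R1 rV) c ls) z1"
          "solves 2 T2 mk (drop_color (R1 rV) c ls) z2" "z = wt K c * z1 + z2" "T1 + T2 + node_time K \<le> T" by blast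
        moreover from this(4) have "real (time find_color K) + (real (time (pre_branch 2) K) +
            (T1 + (real (time mid_branch K) + (T2 + real (time post_branch K))))) + 1 \<le> T3"
          using nt pos unfolding T3_def by (smt (verit))
        ultimately show "\<exists>(T1 :: real) (T2 :: real) z1 z2. solves 2 T1 (mk(R1 rV := 2)) (drop_nbrs adj (R1 rV) c ls) z1 \<and>
            solves 2 T2 mk (drop_color (R1 rV) c ls) z2 \<and>
            real (time find_color K) + (real (time (pre_branch 2) K) + (T1 + (real (time mid_branch K) +
              (T2 + real (time post_branch K))))) + 1 \<le> T3 \<and> z = wt K c * z1 + z2" by blast
      qed
    next
      assume "fst (R1, M) rX = 0"
      then have no3: "\<forall>y<n. mk y \<noteq> 3" using a(2) R1[of rX] by auto
      obtain Rb where b: "sem (find_mark 1) (R1(rX := 0), M) = (Rb, M)"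
        "(\<exists>v<n. mk v = 1 \<and> Rb rX = 1 \<and> Rb rV = v) \<or> (\<forall>y<n. mk y \<noteq> 1) \<and> Rb rX = 0"
        "\<And>r. r \<notin> {rI, rV, rX} \<Longrightarrow> Rb r = (R1(rX := 0)) r"
        using fm[of "R1(rX := 0)" 1] R1' by auto
      obtain Rc where c: "sem (find_mark 2) (Rb, M) = (Rc, M)"
        "(\<exists>v<n. mk v = 2 \<and> Rc rX = 1 \<and> Rc rV = v) \<or> (\<forall>y<n. mk y \<noteq> 2) \<and> Rc rX = Rb rX \<and> Rc rV = Rb rV"
        "\<And>r. r \<notin> {rI, rV, rX} \<Longrightarrow> Rc r = Rb r"
        using fm[of Rb 2] b(3) R1' by auto
      have sc: "sem ?f12 (R1, M) = (Rc, M)" using b(1) c(1) by simp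
      have "runs (Seq (comp ?f12) (IfNZ rX split_step (comp Nop))) (R1, M)
          (real (time ?f12 K) + (T3 - real (time ?f12 K) - 1 + 1)) (returns F z (R, M))"
      proof (rule runs_block_Seq[OF block_simps(3) rd(1) sc])
        fix R2 assume "agree R2 Rc"
        then have R2: "R2 r = Rc r" if "r < 100" for r using that by (simp add: agree_def)
        have rd2: "ready F R2" "R2 rW = R rW"
          using R2 c(3) b(3) R1' rd(2) by (simp_all add: ready_def)
        note ret = returns_W[of R2 R, OF rd2(2)]
        show "runs (IfNZ rX split_step (comp Nop)) (R2, M) (T3 - real (time ?f12 K) - 1 + 1) (returns F z (R, M))"
        proof (rule runs_IfNZ)
          assume "fst (R2, M) rX \<noteq> 0"
          then have v: "R2 rV < n" "mk (R2 rV) = 2 \<or> mk (R2 rV) = 1 \<and> (\<forall>y<n. mk y \<noteq> 2)"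
            using b(2) c(2) R2[of rX] R2[of rV] by auto
          show "runs split_step (R2, M) (T3 - real (time ?f12 K) - 1) (returns F z (R, M))"
            unfolding ret[symmetric]
          proof (rule runs_split_step[OF _ rd2(1) st(2) refl v(1)], goal_cases)
            case (1 C)
            from sp[OF no3 v 1] obtain T1 T2 :: real and z1 z2 where
              "solves 2 T1 (child_marks adj (R2 rV) C) ls z1"
              "solves 2 T2 (rest_marks (R2 rV) C mk) ls z2"
              "z = z1 * z2" "T1 + T2 + node_time K \<le> T" by blast
            moreover from this(4) have "real (time split_off K) + (T1 + (real (time (rF \<leftarrow> AVar rF \<ominus> AVar rK) K) + T2))
                \<le> T3 - real (time ?f12 K) - 1"
              using nt pos unfolding T3_def by (smt (verit))
            ultimately show ?case by blast
          qed
        next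
          assume "fst (R2, M) rX = 0"
          then have z: "z = 1" using b(2) c(2) R2[of rX] no3 by (intro fin) auto
          have "runs (comp Nop) (R2, M) (real (time Nop K)) (returns F z (R, M))"
            by (rule runs_block[OF block_simps(11) rd2(1)]) (use z rd2 in \<open>auto simp: returns_def ready_def agree_def\<close>)
          then show "runs (comp Nop) (R2, M) (T3 - real (time ?f12 K) - 1) (returns F z (R, M))"
            by (rule runs_mono) (use T nt pos in \<open>auto simp: T3_def simp del: time.simps\<close>)
        qed
      qed
      then show "runs (Seq (comp ?f12) (IfNZ rX split_step (comp Nop))) (R1, M) T3 (returns F z (R, M))" by simp
    qed
  qed
  then show "runs (prog ! 2) (R, M) (T - 1) (returns F z (R, M))"
    by (simp add: prog_def T3_def)
qed (simp add: prog_def)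

end

section \<open>Counting recursion nodes\<close>

definition alive :: "nat \<Rightarrow> (nat \<Rightarrow> nat) \<Rightarrow> nat set" where
  "alive n mk = {y. y < n \<and> (mk y = 1 \<or> mk y = 3)}"

definition front :: "nat \<Rightarrow> (nat \<Rightarrow> nat) \<Rightarrow> nat set" where
  "front n mk = {y. y < n \<and> mk y = 3}"

definition cand :: "nat \<Rightarrow> (nat \<Rightarrow> nat) \<Rightarrow> nat set" where
  "cand n mk = {y. y < n \<and> mk y = 2}"

lemma finite_alive [simp]: "finite (alive n mk)" "finite (front n mk)" "finite (cand n mk)"
  by (simp_all add: alive_def front_def cand_def)

definition lsize :: "nat set \<Rightarrow> (nat \<Rightarrow> nat \<Rightarrow> bool) \<Rightarrow> nat" where
  "lsize A ls = (\<Sum>y\<in>A. card (colors ls y))"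

lemma card_colors_le: "card (colors ls y) \<le> 3"
proof -
  have "card (colors ls y) \<le> card {1, 2, 3 :: nat}" unfolding colors_def by (rule card_mono) auto
  then show ?thesis by simp
qed

lemma lsize_le: "finite A \<Longrightarrow> lsize A ls \<le> 3 * card A"
  unfolding lsize_def using sum_bounded_above[of A "\<lambda>y. card (colors ls y)" 3] card_colors_le
  by (simp add: mult.commute)

lemma colors_drop_color: "colors (drop_color v c ls) y = colors ls y - (if y = v then {c} else {})"
  by (auto simp: colors_def drop_color_def)

lemma colors_drop_nbrs: "colors (drop_nbrs adj v c ls) y = colors ls y - (if adj v y then {c} else {})"
  by (auto simp: colors_def drop_nbrs_def)

lemma lsize_mono: "finite B \<Longrightarrow> A \<subseteq> B \<Longrightarrow> (\<And>y. y \<in> A \<Longrightarrow> colors ls y \<subseteq> colors ls' y) \<Longrightarrow> lsize A ls \<le> lsize B ls'"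
  unfolding lsize_def by (rule order_trans[OF sum_mono sum_mono2]) (auto intro: card_mono[OF finite_colors])

lemma lsize_drop_color:
  assumes "finite A" "v \<in> A" "c \<in> colors ls v"
  shows "lsize A (drop_color v c ls) + 1 = lsize A ls"
proof -
  have "card (colors ls v) = Suc (card (colors ls v - {c}))"
    by (rule card.remove) (use assms(3) in auto)
  moreover have "(\<Sum>y\<in>A - {v}. card (colors (drop_color v c ls) y)) = (\<Sum>y\<in>A - {v}. card (colors ls y))"
    by (rule sum.cong) (auto simp: colors_drop_color)
  ultimately show ?thesis
    unfolding lsize_def using sum.remove[OF assms(1,2), of "\<lambda>y. card (colors ls y)"]
      sum.remove[OF assms(1,2), of "\<lambda>y. card (colors (drop_color v c ls) y)"]
    by (simp add: colors_drop_color)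
qed

lemma lsize_remove:
  assumes "finite A" "v \<in> A" "c \<in> colors ls v"
  shows "lsize (A - {v}) (drop_nbrs adj v c ls) + 1 \<le> lsize A ls"
proof -
  have "lsize (A - {v}) (drop_nbrs adj v c ls) \<le> lsize (A - {v}) ls"
    by (rule lsize_mono) (use assms in \<open>auto simp: colors_drop_nbrs\<close>)
  moreover have "card (colors ls v) \<ge> 1" using assms(3) by (auto simp: Suc_le_eq card_gt_0_iff)
  ultimately show ?thesis unfolding lsize_def using sum.remove[OF assms(1,2), of "\<lambda>y. card (colors ls y)"] by simp
qed

text \<open>A bound on the number of nodes, plus one, where \<open>a\<close> counts vertices and
  \<open>b\<close> list entries reserved for branching. If \<open>b\<close> drops by one on both
  sides, both budgets are at most half; if a pivot disappears, \<open>(a1 + 1) + (a2 + 1)\<close> is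
  at most \<open>a + 1\<close>.\<close>

definition bud :: "nat \<Rightarrow> nat \<Rightarrow> nat" where
  "bud a b = (a + 1) * 2 ^ (b + 1)"

lemma bud_mono: "a \<le> a' \<Longrightarrow> b \<le> b' \<Longrightarrow> bud a b \<le> bud a' b'"
  unfolding bud_def by (intro mult_le_mono power_increasing) auto

lemma bud_ge: "2 \<le> bud a b"
  using bud_mono[of 0 a 0 b] by (simp add: bud_def)

lemma bud_branch: "b1 + 1 \<le> b \<Longrightarrow> b2 + 1 \<le> b \<Longrightarrow> bud a b1 + bud a b2 \<le> bud a b"
  using bud_mono[of a a b1 "b - 1"] bud_mono[of a a b2 "b - 1"] by (cases b) (auto simp: bud_def)

lemma bud_split:
  assumes "a1 + a2 + 1 \<le> a" "b1 \<le> b" "b2 \<le> b"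
  shows "bud a1 b1 + bud a2 b2 \<le> bud a b"
proof -
  have "bud a1 b1 + bud a2 b2 \<le> bud a1 b + bud a2 b" using assms by (intro add_mono bud_mono) auto
  also have "\<dots> = bud (a1 + a2 + 1) b" by (simp add: bud_def algebra_simps)
  also have "\<dots> \<le> bud a b" using assms by (intro bud_mono) auto
  finally show ?thesis .
qed

text \<open>The first pivot of a part belongs to that part, so no vertex disappears and
  \<open>bud_split\<close> does not apply. The additional unit in the exponent pays instead, since
  \<open>a1 + 1 \<le> 2 * a1\<close>.\<close>

lemma bud_root:
  assumes "a1 + a2 \<le> a" "1 \<le> a1"
  shows "bud a1 b + bud a2 (b + 1) \<le> bud a (b + 1)"
proof -
  have "a1 + 1 \<le> 2 * a1" using assms by simp
  then have "(a1 + 1) * 2 ^ (b + 1) \<le> 2 * a1 * 2 ^ (b + 1)" by (rule mult_le_mono1)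
  then have "bud a1 b + bud a2 (b + 1) \<le> bud (a1 + a2) (b + 1)" by (simp add: bud_def algebra_simps)
  also have "\<dots> \<le> bud a (b + 1)" using assms by (intro bud_mono) auto
  finally show ?thesis .
qed

section \<open>Induced paths of pivots and the analysis of phase 2\<close>

locale pathfree = machine +
  fixes t :: nat
  assumes adj_sym: "adj x y \<Longrightarrow> adj y x"
    and adj_refl: "x < n \<Longrightarrow> adj x x"
    and no_path: "\<not> (\<exists>ps. length ps = t \<and> set ps \<subseteq> {..<n} \<and> distinct ps \<and>
      (\<forall>i j. i < j \<longrightarrow> j < t \<longrightarrow> (adj (ps ! i) (ps ! j) \<longleftrightarrow> j = Suc i)))"
begin

definition ipath :: "nat list \<Rightarrow> bool" where
  "ipath ps \<longleftrightarrow> set ps \<subseteq> {..<n} \<and> distinct ps \<and>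
     (\<forall>i j. i < j \<longrightarrow> j < length ps \<longrightarrow> (adj (ps ! i) (ps ! j) \<longleftrightarrow> j = Suc i))"

lemma ipath_length: "ipath ps \<Longrightarrow> length ps \<noteq> t"
  using no_path unfolding ipath_def by blast

lemma ipath_single: "v < n \<Longrightarrow> ipath [v]"
  by (simp add: ipath_def)

lemma ipath_Cons:
  assumes "ipath (u # us)" "w < n" "adj w u" "w \<noteq> u" "w \<notin> set us" "\<And>p. p \<in> set us \<Longrightarrow> \<not> adj w p"
  shows "ipath (w # u # us)"
  unfolding ipath_def
proof (intro conjI allI impI)
  show "set (w # u # us) \<subseteq> {..<n}" "distinct (w # u # us)" using assms by (auto simp: ipath_def)
  fix i j assume ij: "i < j" "j < length (w # u # us)"
  then obtain j' where j': "j = Suc j'" by (cases j) auto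
  show "adj ((w # u # us) ! i) ((w # u # us) ! j) \<longleftrightarrow> j = Suc i"
  proof (cases i)
    case 0
    show ?thesis
    proof (cases j')
      case 0
      then show ?thesis using j' \<open>i = 0\<close> assms(3) by simp
    next
      case (Suc j'')
      then have "us ! j'' \<in> set us" using ij j' by simp
      then show ?thesis using Suc j' \<open>i = 0\<close> assms(6) by simp
    qed
  next
    case (Suc i')
    then show ?thesis using assms(1) ij j' by (simp add: ipath_def)
  qed
qed

abbreviation "A mk \<equiv> alive n mk"
abbreviation "val_of mk ls \<equiv> wcount (wt K) adj (A mk) ls"
abbreviation "\<tau> \<equiv> real (node_time K)"

text \<open>\<open>u # us\<close> is the path of pivots, latest first; the vertices marked \<open>3\<close> are the neighbours of
  \<open>u\<close> that are still to be coloured, those marked \<open>2\<close> are the candidates for the next pivot. The last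
  condition says that every component can be continued by one of them.\<close>

definition chain_at :: "(nat \<Rightarrow> nat) \<Rightarrow> nat \<Rightarrow> nat \<Rightarrow> nat list \<Rightarrow> bool" where
  "chain_at mk r u us \<longleftrightarrow> ipath (u # us) \<and> length us + 1 + r = t \<and>
     (\<forall>y\<in>A mk. mk y = 3 \<longleftrightarrow> adj u y) \<and> (\<forall>p\<in>set us. \<forall>y\<in>A mk. \<not> adj p y) \<and>
     (\<forall>w\<in>cand n mk. adj u w \<and> (\<forall>p\<in>set us. \<not> adj p w)) \<and>
     (\<forall>w\<in>A mk \<union> cand n mk. card {y \<in> A mk. adj w y} \<le> 3 * D) \<and>
     (\<forall>X\<subseteq>A mk. X \<noteq> {} \<longrightarrow> (\<forall>x\<in>X. \<forall>y\<in>A mk. adj x y \<longrightarrow> y \<in> X) \<longrightarrow>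
       (\<exists>x\<in>X. mk x = 3 \<or> (\<exists>w\<in>cand n mk. adj w x)))"

definition chain :: "(nat \<Rightarrow> nat) \<Rightarrow> nat \<Rightarrow> bool" where
  "chain mk r \<longleftrightarrow> (\<exists>u us. chain_at mk r u us)"

lemma chain_atD:
  assumes "chain_at mk r u us"
  shows "ipath (u # us)" "length us + 1 + r = t" "\<forall>y\<in>A mk. mk y = 3 \<longleftrightarrow> adj u y"
    "\<forall>p\<in>set us. \<forall>y\<in>A mk. \<not> adj p y" "\<forall>w\<in>cand n mk. adj u w \<and> (\<forall>p\<in>set us. \<not> adj p w)"
    "\<forall>w\<in>A mk \<union> cand n mk. card {y \<in> A mk. adj w y} \<le> 3 * D"
    "\<forall>X\<subseteq>A mk. X \<noteq> {} \<longrightarrow> (\<forall>x\<in>X. \<forall>y\<in>A mk. adj x y \<longrightarrow> y \<in> X) \<longrightarrow>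
       (\<exists>x\<in>X. mk x = 3 \<or> (\<exists>w\<in>cand n mk. adj w x))"
  using assms unfolding chain_at_def by - (elim conjE, assumption)+

lemma marks_mark:
  assumes "v < n" "mk v = 3"
  shows "A (mk(v := 2)) = A mk - {v}" "front n (mk(v := 2)) = front n mk - {v}" "cand n (mk(v := 2)) = insert v (cand n mk)"
  using assms by (auto simp: alive_def front_def cand_def)

lemma val_of_branch:
  assumes "v \<in> A mk" "c \<in> colors ls v" "A mk' = A mk - {v}"
  shows "val_of mk ls = wt K c * val_of mk' (drop_nbrs adj v c ls) + val_of mk (drop_color v c ls)"
  unfolding assms(3) drop_nbrs_def drop_color_def
  by (rule wcount_branch) (use assms adj_sym in \<open>auto simp: colors_def\<close>)

lemma val_of_empty: "v \<in> A mk \<Longrightarrow> colors ls v = {} \<Longrightarrow> val_of mk ls = 0"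
  by (rule wcount_no_color) (auto simp: colors_def)

text \<open>A closed set of the smaller graph either contains a neighbour of \<open>v\<close>, and
  now \<open>v\<close> is the candidate attached to it, or it is closed in the larger graph too and
  inherits the vertex guaranteed there.\<close>

lemma chain_mark:
  assumes "chain mk r" "v < n" "mk v = 3"
  shows "chain (mk(v := 2)) r"
proof -
  obtain u us where "chain_at mk r u us" using assms(1) unfolding chain_def by blast
  note c = chain_atD[OF this]
  have v: "v \<in> A mk" using assms by (simp add: alive_def)
  note m = marks_mark[of v mk, OF assms(2,3)]
  show ?thesis
    unfolding chain_def chain_at_def m(1,3)
  proof (intro exI[of _ u] exI[of _ us] conjI)
    show "\<forall>y\<in>A mk - {v}. (mk(v := 2)) y = 3 \<longleftrightarrow> adj u y" using c(3) by simp
    show "\<forall>p\<in>set us. \<forall>y\<in>A mk - {v}. \<not> adj p y" using c(4) by simp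
    show "\<forall>w\<in>insert v (cand n mk). adj u w \<and> (\<forall>p\<in>set us. \<not> adj p w)" using c(3,4,5) v assms(3) by auto
    show "\<forall>w\<in>A mk - {v} \<union> insert v (cand n mk). card {y \<in> A mk - {v}. adj w y} \<le> 3 * D"
    proof
      fix w assume "w \<in> A mk - {v} \<union> insert v (cand n mk)"
      then have "w \<in> A mk \<union> cand n mk" using v by auto
      then have "card {y \<in> A mk. adj w y} \<le> 3 * D" using c(6) by blast
      moreover have "card {y \<in> A mk - {v}. adj w y} \<le> card {y \<in> A mk. adj w y}" by (rule card_mono) auto
      ultimately show "card {y \<in> A mk - {v}. adj w y} \<le> 3 * D" by linarith
    qed
    show "\<forall>X\<subseteq>A mk - {v}. X \<noteq> {} \<longrightarrow> (\<forall>x\<in>X. \<forall>y\<in>A mk - {v}. adj x y \<longrightarrow> y \<in> X) \<longrightarrow>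
       (\<exists>x\<in>X. (mk(v := 2)) x = 3 \<or> (\<exists>w\<in>insert v (cand n mk). adj w x))"
    proof (intro allI impI)
      fix X assume X: "X \<subseteq> A mk - {v}" "X \<noteq> {}" "\<forall>x\<in>X. \<forall>y\<in>A mk - {v}. adj x y \<longrightarrow> y \<in> X"
      show "\<exists>x\<in>X. (mk(v := 2)) x = 3 \<or> (\<exists>w\<in>insert v (cand n mk). adj w x)"
      proof (cases "\<exists>x\<in>X. adj x v")
        case True
        then obtain x where "x \<in> X" "adj v x" using adj_sym by blast
        then show ?thesis by (intro bexI[of _ x]) auto
      next
        case False
        then have cl: "\<forall>x\<in>X. \<forall>y\<in>A mk. adj x y \<longrightarrow> y \<in> X" using X(3) by blast
        have sub: "X \<subseteq> A mk" using X(1) by blast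
        obtain x where x: "x \<in> X" "mk x = 3 \<or> (\<exists>w\<in>cand n mk. adj w x)"
          using c(7)[THEN spec, THEN mp, THEN mp, THEN mp, OF sub X(2) cl] by (elim bexE)
        have "x \<noteq> v" using x(1) X(1) by blast
        then show ?thesis using x by (intro bexI[of _ x]) auto
      qed
    qed
  qed (use c in auto)
qed

text \<open>As \<open>C\<close> is closed, sets closed outside \<open>C\<close> are closed in the
  whole graph. The candidate attached to such a set is not \<open>v\<close>, since all remaining
  neighbours of \<open>v\<close> lie in \<open>C\<close>.\<close>

lemma chain_rest:
  assumes "chain mk r" "\<forall>y<n. mk y \<noteq> 3" and C: "\<And>y. y \<in> A mk \<Longrightarrow> adj v y \<Longrightarrow> y \<in> C"
    "\<And>x y. x \<in> C \<Longrightarrow> y \<in> A mk \<Longrightarrow> adj x y \<Longrightarrow> y \<in> C"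
    and mk': "A mk' = A mk - C" "cand n mk' = cand n mk - {v}" "\<forall>y\<in>A mk'. mk' y \<noteq> 3"
  shows "chain mk' r"
proof -
  obtain u us where "chain_at mk r u us" using assms(1) unfolding chain_def by blast
  note c = chain_atD[OF this]
  have n3: "mk y \<noteq> 3" if "y \<in> A mk" for y using that assms(2) by (simp add: alive_def)
  show ?thesis
    unfolding chain_def chain_at_def mk'(1,2)
  proof (intro exI[of _ u] exI[of _ us] conjI)
    show "\<forall>y\<in>A mk - C. mk' y = 3 \<longleftrightarrow> adj u y" using c(3) n3 mk' by auto
    show "\<forall>w\<in>A mk - C \<union> (cand n mk - {v}). card {y \<in> A mk - C. adj w y} \<le> 3 * D"
    proof
      fix w assume "w \<in> A mk - C \<union> (cand n mk - {v})"
      then have "card {y \<in> A mk. adj w y} \<le> 3 * D" using c(6) by blast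
      moreover have "card {y \<in> A mk - C. adj w y} \<le> card {y \<in> A mk. adj w y}" by (rule card_mono) auto
      ultimately show "card {y \<in> A mk - C. adj w y} \<le> 3 * D" by linarith
    qed
    show "\<forall>X\<subseteq>A mk - C. X \<noteq> {} \<longrightarrow> (\<forall>x\<in>X. \<forall>y\<in>A mk - C. adj x y \<longrightarrow> y \<in> X) \<longrightarrow>
       (\<exists>x\<in>X. mk' x = 3 \<or> (\<exists>w\<in>cand n mk - {v}. adj w x))"
    proof (intro allI impI)
      fix X assume X: "X \<subseteq> A mk - C" "X \<noteq> {}" "\<forall>x\<in>X. \<forall>y\<in>A mk - C. adj x y \<longrightarrow> y \<in> X"
      have cl: "\<forall>x\<in>X. \<forall>y\<in>A mk. adj x y \<longrightarrow> y \<in> X"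
      proof (intro ballI impI)
        fix x y assume that: "x \<in> X" "y \<in> A mk" "adj x y"
        have "y \<notin> C" using C(2)[of y x] adj_sym[OF that(3)] X(1) that by auto
        then show "y \<in> X" using X(3) that by blast
      qed
      have sub: "X \<subseteq> A mk" using X(1) by blast
      obtain x where x: "x \<in> X" "mk x = 3 \<or> (\<exists>w\<in>cand n mk. adj w x)"
        using c(7)[THEN spec, THEN mp, THEN mp, THEN mp, OF sub X(2) cl] by (elim bexE)
      have "mk x \<noteq> 3" using n3 sub x(1) by blast
      then obtain w where w: "w \<in> cand n mk" "adj w x" using x(2) by blast
      have "w \<noteq> v" using C(1)[of x] w(2) x(1) X(1) by auto
      then show "\<exists>x\<in>X. mk' x = 3 \<or> (\<exists>w\<in>cand n mk - {v}. adj w x)" using w x(1) by blast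
    qed
  qed (use c in auto)
qed

text \<open>Every nonempty closed \<open>X\<close> within \<open>C\<close> contains a neighbour of
  the new pivot \<open>v\<close>: otherwise \<open>C - X\<close> would contain all seeds and be
  closed, against the leastness of \<open>C\<close>.\<close>

lemma chain_child:
  assumes path: "ipath (v # us)" "length us + 1 + r = t"
    and us: "\<And>p y. p \<in> set us \<Longrightarrow> y \<in> C \<Longrightarrow> \<not> adj p y"
    and deg: "\<And>w. w \<in> C \<Longrightarrow> card {y \<in> C. adj w y} \<le> 3 * D"
    and mk': "A mk' = C" "cand n mk' = {}" "\<And>y. y \<in> C \<Longrightarrow> mk' y = 3 \<longleftrightarrow> adj v y"
    and C: "\<And>x y. x \<in> C \<Longrightarrow> y \<in> A mk \<Longrightarrow> adj x y \<Longrightarrow> y \<in> C" "C \<subseteq> A mk"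
    and least: "\<And>S. (\<And>y. y \<in> A mk \<Longrightarrow> adj v y \<Longrightarrow> y \<in> S) \<Longrightarrow>
      (\<And>x y. x \<in> S \<Longrightarrow> y \<in> A mk \<Longrightarrow> adj x y \<Longrightarrow> y \<in> S) \<Longrightarrow> C \<subseteq> S"
    and seeds: "\<And>y. y \<in> A mk \<Longrightarrow> adj v y \<Longrightarrow> y \<in> C"
  shows "chain mk' r"
  unfolding chain_def chain_at_def mk'(1,2)
proof (intro exI[of _ v] exI[of _ us] conjI)
  show "\<forall>X\<subseteq>C. X \<noteq> {} \<longrightarrow> (\<forall>x\<in>X. \<forall>y\<in>C. adj x y \<longrightarrow> y \<in> X) \<longrightarrow> (\<exists>x\<in>X. mk' x = 3 \<or> (\<exists>w\<in>{}. adj w x))"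
  proof (intro allI impI)
    fix X assume X: "X \<subseteq> C" "X \<noteq> {}" "\<forall>x\<in>X. \<forall>y\<in>C. adj x y \<longrightarrow> y \<in> X"
    show "\<exists>x\<in>X. mk' x = 3 \<or> (\<exists>w\<in>{}. adj w x)"
    proof (rule ccontr)
      assume "\<not> ?thesis"
      then have no: "\<not> adj v x" if "x \<in> X" for x using that mk'(3) X(1) by auto
      have "C \<subseteq> C - X"
      proof (rule least)
        show "y \<in> C - X" if "y \<in> A mk" "adj v y" for y using that seeds no by auto
        show "y \<in> C - X" if "x \<in> C - X" "y \<in> A mk" "adj x y" for x y
          using that C(1)[of x y] X(3) adj_sym[OF that(3)] by auto
      qed
      then show False using X(1,2) by auto
    qed
  qed
qed (use assms in auto)

text \<open>The constant \<open>9\<close> stems from three colours for each of at most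
  \<open>3 * D\<close> neighbours; the reserve for one pivot has this size.\<close>

lemma card_front_le:
  assumes "C \<subseteq> B" "finite B" "card {y \<in> B. adj v y} \<le> 3 * D"
  shows "lsize {y \<in> C. adj v y} ls \<le> 9 * D"
proof -
  have "card {y \<in> C. adj v y} \<le> card {y \<in> B. adj v y}" using assms by (intro card_mono) auto
  moreover have "lsize {y \<in> C. adj v y} ls \<le> 3 * card {y \<in> C. adj v y}"
    by (rule lsize_le, rule finite_subset[of _ B]) (use assms in auto)
  ultimately show ?thesis using assms(3) by linarith
qed

text \<open>Bounding times by the budget minus one leaves exactly one node's cost for the node
  itself.\<close>

lemma tau_bound:
  assumes "h1 + h2 \<le> h"
  shows "\<tau> * (real h1 - 1) + \<tau> * (real h2 - 1) + real (node_time K) \<le> \<tau> * (real h - 1)"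
proof -
  have "\<tau> * (real h1 + real h2) \<le> \<tau> * real h" using assms by (intro mult_left_mono) auto
  then show ?thesis by (simp add: algebra_simps)
qed

lemma tau_ge: "2 \<le> h \<Longrightarrow> real (node_time K) \<le> \<tau> * (real h - 1)"
  using mult_left_mono[of 1 "real h - 1" \<tau>] by simp

lemma marks_child:
  assumes "reached (A mk) adj v C"
  shows "A (child_marks adj v C) = C" "cand n (child_marks adj v C) = {}"
    "front n (child_marks adj v C) = {y \<in> C. adj v y}" "y \<in> C \<Longrightarrow> child_marks adj v C y = 3 \<longleftrightarrow> adj v y"
  using reachedD(1)[OF assms] by (auto simp: alive_def front_def cand_def child_marks_def)

lemma val_of_split:
  assumes "reached (A mk) adj v C" "A mc = C" "A mr = A mk - C"
  shows "val_of mk ls = val_of mc ls * val_of mr ls" "card (A mk) = card C + card (A mk - C)"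
proof -
  note C = reachedD[OF assms(1)]
  show "val_of mk ls = val_of mc ls * val_of mr ls"
    unfolding assms(2,3) by (rule wcount_split[OF _ C(1)], simp) (use C(3) adj_sym C(1) in blast)
  have "finite C" by (rule finite_subset[OF C(1)]) simp
  then show "card (A mk) = card C + card (A mk - C)"
    using C(1) by (simp add: card_Diff_subset card_mono)
qed

text \<open>\<open>r\<close> is the number of pivots that may still follow. The exponent consists of
  the list entries of the current neighbourhood, which branching consumes, and a reserve of
  \<open>9 * D\<close> for each later pivot. The first alternative covers empty parts, for which
  there is no chain to maintain.\<close>

lemma solves_chain:
  "A mk = {} \<or> chain mk r \<Longrightarrow>
    solves 2 (\<tau> * (real (bud (card (A mk) + card (cand n mk)) (lsize (front n mk) ls + r * (9 * D))) - 1))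
      mk ls (val_of mk ls)"
\<comment> \<open>Colouring turns an uncoloured vertex into a candidate and keeps the sum of the two
  cardinalities, but lowers the total list size; splitting removes the pivot.\<close>
proof (induction "card (A mk) + card (cand n mk) + lsize (A mk) ls" arbitrary: mk ls r rule: less_induct)
  case less
  define a where "a = card (A mk) + card (cand n mk)"
  define b where "b = lsize (front n mk) ls + r * (9 * D)"
  show ?case
    unfolding a_def[symmetric] b_def[symmetric]
  proof (rule solves_rec2, goal_cases)
    case (1 v)
    then show ?case by (intro val_of_empty[of v]) (auto simp: alive_def)
  next
    case (2 v c)
    let ?mk = "mk(v := 2)"
    have v: "v \<in> A mk" "v \<in> front n mk" "v \<notin> cand n mk" using 2 by (auto simp: alive_def front_def cand_def)
    note m = marks_mark[of v mk, OF 2(1,2)]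
    have chain: "chain mk r" using less.prems v by auto
    have card: "card (A mk) = Suc (card (A mk - {v}))" by (rule card.remove) (use v(1) in auto)
    have a1: "card (A ?mk) + card (cand n ?mk) = a"
      unfolding m a_def using card v(3) by simp
    have b1: "lsize (front n ?mk) (drop_nbrs adj v c ls) + r * (9 * D) + 1 \<le> b"
      unfolding m b_def using lsize_remove[OF _ v(2) 2(3)] by simp
    have b2: "lsize (front n mk) (drop_color v c ls) + r * (9 * D) + 1 \<le> b"
      unfolding b_def using lsize_drop_color[OF _ v(2) 2(3)] by simp
    have s1: "solves 2 (\<tau> * (real (bud a (lsize (front n ?mk) (drop_nbrs adj v c ls) + r * (9 * D))) - 1))
        ?mk (drop_nbrs adj v c ls) (val_of ?mk (drop_nbrs adj v c ls))"
    proof (rule less.hyps[of ?mk "drop_nbrs adj v c ls" r, unfolded a1])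
      have "lsize (A ?mk) (drop_nbrs adj v c ls) + 1 \<le> lsize (A mk) ls"
        unfolding m by (rule lsize_remove) (use v 2 in auto)
      then show "a + lsize (A ?mk) (drop_nbrs adj v c ls) < card (A mk) + card (cand n mk) + lsize (A mk) ls"
        unfolding a_def by simp
      show "A ?mk = {} \<or> chain ?mk r" using chain_mark[OF chain 2(1,2)] by blast
    qed
    have s2: "solves 2 (\<tau> * (real (bud a (lsize (front n mk) (drop_color v c ls) + r * (9 * D))) - 1))
        mk (drop_color v c ls) (val_of mk (drop_color v c ls))"
    proof (rule less.hyps[of mk "drop_color v c ls" r, folded a_def])
      show "a + lsize (A mk) (drop_color v c ls) < a + lsize (A mk) ls"
        using lsize_drop_color[OF _ v(1) 2(3)] by simp
      show "A mk = {} \<or> chain mk r" using chain by blast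
    qed
    show ?case
      by (intro exI conjI, rule s1, rule s2, rule tau_bound, rule bud_branch[OF b1 b2], rule val_of_branch[OF v(1) 2(3) m(1)])
  next
    case (3 v C)
    let ?mc = "child_marks adj v C" and ?mr = "rest_marks v C mk"
    have A: "A mk = {y. y < n \<and> mk y = 1}" using 3(1) by (auto simp: alive_def)
    note re = 3(4)[folded A]
    note C = reachedD[OF re]
    note mc = marks_child[OF re]
    \<comment> \<open>The pivot is a candidate: with neither candidates nor vertices marked
      \<open>3\<close>, the last chain condition would fail for the set of all uncoloured
      vertices.\<close>
    have v2: "mk v = 2"
    proof (rule ccontr)
      assume "mk v \<noteq> 2"
      then have v: "v \<in> A mk" "cand n mk = {}" using 3(2,3) by (auto simp: alive_def cand_def)
      then have "chain mk r" using less.prems by auto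
      then obtain u us where "chain_at mk r u us" unfolding chain_def by blast
      from chain_atD(7)[OF this] have "\<exists>x\<in>A mk. mk x = 3 \<or> (\<exists>w\<in>cand n mk. adj w x)" using v(1) by blast
      then show False using v(2) 3(1) by (auto simp: alive_def)
    qed
    have vc: "v \<in> cand n mk" "v \<notin> A mk" using v2 3(2) by (auto simp: cand_def alive_def)
    have mr: "A ?mr = A mk - C" "cand n ?mr = cand n mk - {v}" "front n ?mr = {}"
      using vc(2) C(1) 3(1) by (auto simp: alive_def cand_def front_def rest_marks_def)
    note val = val_of_split(1)[OF re mc(1) mr(1), of ls]
    note cardA = val_of_split(2)[OF re mc(1) mr(1)]
    have cardc: "card (cand n mk) = Suc (card (cand n mk - {v}))" by (rule card.remove) (use vc(1) in auto)
    \<comment> \<open>A nonempty part lengthens the path by \<open>v\<close> and pays for its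
      neighbourhood with one unit of \<open>r\<close>; an empty part costs nothing.\<close>
    obtain r' where r': "A ?mc = {} \<or> chain ?mc r'" "lsize (front n ?mc) ls + r' * (9 * D) \<le> r * (9 * D)"
    proof (cases "C = {}")
      case True
      have "lsize (front n ?mc) ls = 0" using mc(3) True by (simp add: lsize_def)
      then show thesis using that[of r] mc(1) True by simp
    next
      case False
      then have "A mk \<noteq> {}" using C(1) by auto
      then obtain u us where "chain_at mk r u us" using less.prems unfolding chain_def by blast
      note c = chain_atD[OF this]
      have nu: "\<not> adj u y" if "y \<in> A mk" for y using c(3) that 3(1) by (auto simp: alive_def)
      \<comment> \<open>If \<open>v\<close> had no uncoloured neighbour, the empty set would be
        closed and leastness would make \<open>C\<close> empty. The old pivot \<open>u\<close> has
        none left, so \<open>v\<close> differs from \<open>u\<close>.\<close>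
      obtain y where y: "y \<in> A mk" "adj v y" using C(4)[of "{}"] False by auto
      have "v \<noteq> u" using nu y by auto
      \<comment> \<open>Earlier pivots are not adjacent to the candidate \<open>v\<close>, whereas
        \<open>v\<close> is adjacent to itself.\<close>
      moreover have "v \<notin> set us" using c(5) vc(1) adj_refl[OF 3(2)] by auto
      ultimately have p: "ipath (v # u # us)"
        using c(5) vc(1) adj_sym by (intro ipath_Cons c(1) 3(2)) blast+
      \<comment> \<open>With \<open>r = 0\<close> the present path would already be an induced path
        on \<open>t\<close> vertices.\<close>
      have "r \<noteq> 0" using ipath_length[OF c(1)] c(2) by auto
      then obtain r' where r': "r = Suc r'" by (cases r) auto
      have "chain ?mc r'"
      proof (rule chain_child[OF p _ _ _ mc(1,2,4) C(3) C(1,4,2)])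
        show "length (u # us) + 1 + r' = t" using c(2) r' by simp
        show "\<not> adj p y" if "p \<in> set (u # us)" "y \<in> C" for p y using that c(4) nu C(1) by auto
        show "card {y \<in> C. adj w y} \<le> 3 * D" if "w \<in> C" for w
        proof -
          have "card {y \<in> C. adj w y} \<le> card {y \<in> A mk. adj w y}" using C(1) by (intro card_mono) auto
          also have "\<dots> \<le> 3 * D" using c(6) that C(1) by blast
          finally show ?thesis .
        qed
      qed auto
      moreover have "lsize (front n ?mc) ls \<le> 9 * D"
        unfolding mc(3) by (rule card_front_le[OF C(1)]) (use c(6) vc(1) in auto)
      ultimately show thesis using that[of r'] r' by simp
    qed
    have s1: "solves 2 (\<tau> * (real (bud (card (A ?mc) + card (cand n ?mc)) (lsize (front n ?mc) ls + r' * (9 * D))) - 1))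
        ?mc ls (val_of ?mc ls)"
    proof (rule less.hyps[OF _ r'(1)])
      have "lsize C ls \<le> lsize (A mk) ls" by (rule lsize_mono) (use C in auto)
      then show "card (A ?mc) + card (cand n ?mc) + lsize (A ?mc) ls < card (A mk) + card (cand n mk) + lsize (A mk) ls"
        unfolding mc(1,2) using cardA cardc by simp
    qed
    have s2: "solves 2 (\<tau> * (real (bud (card (A ?mr) + card (cand n ?mr)) (lsize (front n ?mr) ls + r * (9 * D))) - 1))
        ?mr ls (val_of ?mr ls)"
    proof (rule less.hyps)
      have "lsize (A mk - C) ls \<le> lsize (A mk) ls" by (rule lsize_mono) auto
      then show "card (A ?mr) + card (cand n ?mr) + lsize (A ?mr) ls < card (A mk) + card (cand n mk) + lsize (A mk) ls"
        unfolding mr(1,2) using cardA cardc by simp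
      show "A ?mr = {} \<or> chain ?mr r"
      proof (cases "A mk = {}")
        case False
        then have "chain mk r" using less.prems by blast
        then have "chain ?mr r"
          by (rule chain_rest[OF _ 3(1) C(2,3) mr(1,2)]) (use 3(1) in \<open>auto simp: alive_def rest_marks_def\<close>)
        then show ?thesis ..
      qed (use mr in auto)
    qed
    have "bud (card (A ?mc) + card (cand n ?mc)) (lsize (front n ?mc) ls + r' * (9 * D)) +
        bud (card (A ?mr) + card (cand n ?mr)) (lsize (front n ?mr) ls + r * (9 * D)) \<le> bud a b"
    proof (rule bud_split)
      show "card (A ?mc) + card (cand n ?mc) + (card (A ?mr) + card (cand n ?mr)) + 1 \<le> a"
        unfolding mc(1,2) mr(1,2) a_def using cardA cardc by simp
      show "lsize (front n ?mc) ls + r' * (9 * D) \<le> b" using r'(2) unfolding b_def by simp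
      show "lsize (front n ?mr) ls + r * (9 * D) \<le> b" unfolding mr(3) b_def by (simp add: lsize_def)
    qed
    note le = tau_bound[OF this]
    from s1 s2 le val show ?case by blast
  next
    case 4
    then have "A mk = {}" by (auto simp: alive_def)
    then show ?case by simp
  next
    case 5
    show ?case by (rule tau_ge[OF bud_ge])
  qed
qed

text \<open>Peels off one part after the other, starting a fresh chain in each. The part contains
  its pivot, which is its own neighbour and therefore gets the mark \<open>3\<close>; hence the
  pivot needs no colouring step of its own.\<close>

lemma solves_root:
  assumes "t \<ge> 1" "\<And>w. w \<in> A mk \<Longrightarrow> card {y \<in> A mk. adj w y} \<le> 3 * D" "\<And>y. y < n \<Longrightarrow> mk y \<in> {0, 1}"
  shows "solves 2 (\<tau> * (real (bud (card (A mk)) (t * (9 * D) + 1)) - 1)) mk ls (val_of mk ls)"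
  using assms(2,3)
proof (induction "card (A mk)" arbitrary: mk rule: less_induct)
  case less
  define a where "a = card (A mk)"
  have n3: "mk y \<noteq> 3" "mk y \<noteq> 2" if "y < n" for y using less.prems(2)[OF that] by auto
  show ?case
    unfolding a_def[symmetric]
  proof (rule solves_rec2, goal_cases)
    case (1 v)
    then show ?case using n3 by blast
  next
    case (2 v c)
    then show ?case using n3 by blast
  next
    case (3 v C)
    let ?mc = "child_marks adj v C" and ?mr = "rest_marks v C mk"
    have A: "A mk = {y. y < n \<and> mk y = 1}" using 3(1) by (auto simp: alive_def)
    note re = 3(4)[folded A]
    note C = reachedD[OF re]
    note mc = marks_child[OF re]
    have v: "v \<in> A mk" using 3(2,3) n3 by (auto simp: alive_def)
    have vC: "v \<in> C" using C(2)[OF v adj_refl[OF 3(2)]] .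
    have mr: "A ?mr = A mk - C" using vC by (auto simp: alive_def rest_marks_def)
    note val = val_of_split(1)[OF re mc(1) mr, of ls]
    note cardA = val_of_split(2)[OF re mc(1) mr]
    have "finite C" by (rule finite_subset[OF C(1)]) simp
    then have card1: "1 \<le> card C" using vC by (auto simp: Suc_le_eq card_gt_0_iff)
    have "chain ?mc (t - 1)"
    proof (rule chain_child[OF ipath_single[OF 3(2)] _ _ _ mc(1,2,4) C(3) C(1,4,2)])
      show "length [] + 1 + (t - 1) = t" using assms(1) by simp
      show "card {y \<in> C. adj w y} \<le> 3 * D" if "w \<in> C" for w
      proof -
        have "card {y \<in> C. adj w y} \<le> card {y \<in> A mk. adj w y}" using C(1) by (intro card_mono) auto
        also have "\<dots> \<le> 3 * D" using less.prems(1) that C(1) by blast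
        finally show ?thesis .
      qed
    qed auto
    then have s1: "solves 2 (\<tau> * (real (bud (card (A ?mc) + card (cand n ?mc)) (lsize (front n ?mc) ls + (t - 1) * (9 * D))) - 1))
        ?mc ls (val_of ?mc ls)" by (intro solves_chain disjI2)
    have s2: "solves 2 (\<tau> * (real (bud (card (A ?mr)) (t * (9 * D) + 1)) - 1)) ?mr ls (val_of ?mr ls)"
    proof (rule less.hyps)
      show "card (A ?mr) < card (A mk)" unfolding mr using cardA card1 by simp
      show "card {y \<in> A ?mr. adj w y} \<le> 3 * D" if "w \<in> A ?mr" for w
      proof -
        have "card {y \<in> A ?mr. adj w y} \<le> card {y \<in> A mk. adj w y}" unfolding mr by (intro card_mono) auto
        also have "\<dots> \<le> 3 * D" using less.prems(1) that mr by blast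
        finally show ?thesis .
      qed
      show "?mr y \<in> {0, 1}" if "y < n" for y using less.prems(2)[OF that] by (simp add: rest_marks_def)
    qed
    have "bud (card (A ?mc) + card (cand n ?mc)) (lsize (front n ?mc) ls + (t - 1) * (9 * D)) +
        bud (card (A ?mr)) (t * (9 * D) + 1) \<le> bud (card C) (t * (9 * D)) + bud (card (A mk - C)) (t * (9 * D) + 1)"
    proof (intro add_mono bud_mono)
      \<comment> \<open>The neighbourhood of the first pivot and the reserve for
        \<open>t - 1\<close> more pivots make \<open>t * (9 * D)\<close>; the remaining unit in the
        exponent is used by \<open>bud_root\<close>.\<close>
      have "lsize (front n ?mc) ls \<le> 9 * D"
        unfolding mc(3) by (rule card_front_le[OF C(1)]) (use less.prems(1) v in auto)
      moreover have "t * (9 * D) = 9 * D + (t - 1) * (9 * D)" using assms(1) by (cases t) auto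
      ultimately show "lsize (front n ?mc) ls + (t - 1) * (9 * D) \<le> t * (9 * D)" by linarith
    qed (simp_all add: mc mr)
    also have "\<dots> \<le> bud a (t * (9 * D) + 1)"
      by (rule bud_root) (use cardA card1 in \<open>auto simp: a_def\<close>)
    finally have le: "bud (card (A ?mc) + card (cand n ?mc)) (lsize (front n ?mc) ls + (t - 1) * (9 * D)) +
        bud (card (A ?mr)) (t * (9 * D) + 1) \<le> bud a (t * (9 * D) + 1)" .
    note le = tau_bound[OF this]
    from s1 s2 le val show ?case by blast
  next
    case 4
    then have "A mk = {}" by (auto simp: alive_def)
    then show ?case by simp
  next
    case 5
    show ?case by (rule tau_ge[OF bud_ge])
  qed
qed

end

section \<open>The analysis of phase 1\<close>

context pathfree
begin

text \<open>Each vertex counted by \<open>nbrs\<close> loses the colour \<open>c\<close>. For a pair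
  with at least \<open>D\<close> such vertices this is the drop of the measure that makes phase 1
  subexponential.\<close>

lemma lsize_remove_nbrs:
  assumes "v < n" "\<And>y. y < n \<Longrightarrow> mk y \<in> {0, 1}" "c \<in> {1, 2, 3}"
  shows "lsize (A mk - {v}) (drop_nbrs adj v c ls) + card (nbrs n adj mk ls v c) \<le> lsize (A mk) ls"
proof -
  let ?N = "nbrs n adj mk ls v c"
  have N: "?N \<subseteq> A mk" using assms(2) by (fastforce simp: nbrs_def alive_def)
  have "card (colors (drop_nbrs adj v c ls) y) + (if y \<in> ?N then 1 else 0) \<le> card (colors ls y)" if "y \<in> A mk" for y
  proof (cases "y \<in> ?N")
    case True
    then have "c \<in> colors ls y" "adj v y" using assms(3) by (auto simp: nbrs_def colors_def)
    then have "card (colors ls y) = Suc (card (colors ls y - {c}))" by (intro card.remove) auto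
    then show ?thesis using True \<open>adj v y\<close> by (simp add: colors_drop_nbrs)
  next
    case False
    then show ?thesis by (auto simp: colors_drop_nbrs intro!: card_mono)
  qed
  then have "(\<Sum>y\<in>A mk. card (colors (drop_nbrs adj v c ls) y) + (if y \<in> ?N then 1 else 0)) \<le> lsize (A mk) ls"
    unfolding lsize_def by (rule sum_mono)
  moreover have "(\<Sum>y\<in>A mk. if y \<in> ?N then 1 else 0 :: nat) = card ?N"
    using N by (simp add: sum.If_cases Int_absorb1)
  moreover have "lsize (A mk - {v}) (drop_nbrs adj v c ls) \<le> lsize (A mk) (drop_nbrs adj v c ls)"
    by (rule lsize_mono) auto
  ultimately show ?thesis by (simp add: sum.distrib lsize_def)
qed

text \<open>A node with an empty list stops at once, so striking the last colour of a list costs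
  just one node.\<close>

lemma solves_empty:
  assumes "v < n" "mk v = 1" "colors ls v = {}"
  shows "solves 1 (real (node_time K)) mk ls 0"
  by (rule solves_rec1) (use assms in auto)

text \<open>Since \<open>2 + 2 > 3\<close>; here it matters that there are only three
  colours.\<close>

lemma colors_meet:
  assumes "card (colors ls v) \<ge> 2" "card (colors ls w) \<ge> 2"
  shows "colors ls v \<inter> colors ls w \<noteq> {}"
proof
  assume "colors ls v \<inter> colors ls w = {}"
  then have "card (colors ls v \<union> colors ls w) = card (colors ls v) + card (colors ls w)"
    by (intro card_Un_disjoint) auto
  moreover have "card (colors ls v \<union> colors ls w) \<le> card {1, 2, 3 :: nat}"
    by (rule card_mono) (auto simp: colors_def)
  ultimately show False using assms by simp
qed

text \<open>Every neighbour of \<open>w\<close> shares a colour with \<open>w\<close>, so the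
  neighbourhood is covered by at most three sets \<open>nbrs\<close>, each with fewer than
  \<open>D\<close> elements.\<close>

lemma degree_bound:
  assumes "\<And>v. v \<in> A mk \<Longrightarrow> card (colors ls v) \<ge> 2" "\<And>y. y < n \<Longrightarrow> mk y \<in> {0, 1}"
    "\<And>v c. v \<in> A mk \<Longrightarrow> c \<in> colors ls v \<Longrightarrow> card (nbrs n adj mk ls v c) < D" "w \<in> A mk"
  shows "card {y \<in> A mk. adj w y} \<le> 3 * D"
proof -
  have "{y \<in> A mk. adj w y} \<subseteq> (\<Union>c\<in>colors ls w. nbrs n adj mk ls w c)"
  proof
    fix y assume y: "y \<in> {y \<in> A mk. adj w y}"
    then obtain c where "c \<in> colors ls w" "c \<in> colors ls y"
      using colors_meet[OF assms(1) assms(1), of w y] assms(4) by blast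
    then show "y \<in> (\<Union>c\<in>colors ls w. nbrs n adj mk ls w c)"
      using y by (auto simp: nbrs_def alive_def colors_def)
  qed
  moreover have "finite (\<Union>c\<in>colors ls w. nbrs n adj mk ls w c)" by (simp add: nbrs_def)
  ultimately have "card {y \<in> A mk. adj w y} \<le> card (\<Union>c\<in>colors ls w. nbrs n adj mk ls w c)" by (intro card_mono)
  also have "\<dots> \<le> (\<Sum>c\<in>colors ls w. card (nbrs n adj mk ls w c))" by (rule card_UN_le) simp
  also have "\<dots> \<le> of_nat (card (colors ls w)) * D"
    by (rule sum_bounded_above) (use assms(3,4) in \<open>auto simp: less_imp_le\<close>)
  also have "\<dots> \<le> 3 * D" using card_colors_le[of ls w] by simp
  finally show ?thesis .
qed

text \<open>Branching on a pair with many neighbours decreases the total list size by \<open>D\<close> on one side and by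
  one on the other; \<open>x\<close> solves the resulting recurrence.\<close>

lemma solves_phase1:
  fixes x Q :: real
  assumes t: "t \<ge> 1" and x: "1 \<le> x" "1 / x + 1 / x ^ D \<le> 1" and Q: "real (bud n (t * (9 * D) + 1)) + 1 \<le> Q"
    and mk: "\<And>y. y < n \<Longrightarrow> mk y \<in> {0, 1}"
  shows "solves 1 (\<tau> * (Q * (real (lsize (A mk) ls) + 1) * x ^ lsize (A mk) ls - 1)) mk ls (val_of mk ls)"
  using mk
proof (induction "lsize (A mk) ls" arbitrary: mk ls rule: less_induct)
  case less
  \<comment> \<open>\<open>Q\<close> bounds the cost of phase 2 at a leaf, \<open>x ^ m\<close> that
    of branching on pairs with many neighbours, and the linear factor pays for forced steps on lists
    with one colour.\<close>
  define f where "f m = Q * (real m + 1) * x ^ m" for m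
  define m where "m = lsize (A mk) ls"
  have Q3: "3 \<le> Q" using Q bud_ge[of n "t * (9 * D) + 1"] by linarith
  have xm: "1 \<le> x ^ k" for k using x(1) by (rule one_le_power)
  have Qf: "Q \<le> f k" for k
  proof -
    have "1 * 1 \<le> (real k + 1) * x ^ k" using xm[of k] by (intro mult_mono) auto
    then show ?thesis unfolding f_def using mult_left_mono[of 1 "(real k + 1) * x ^ k" Q] Q3 by (simp add: mult.assoc)
  qed
  have alive: "v \<in> A mk" if "v < n" "mk v \<noteq> 0" for v using less.prems[OF that(1)] that by (auto simp: alive_def)
  show ?case
    unfolding f_def[symmetric] m_def[symmetric]
  proof (rule solves_rec1, goal_cases)
    case (1 v)
    then show ?case using val_of_empty[OF alive] by simp
  next
    case (2 v c)
    let ?mk = "mk(v := 0)" and ?l1 = "drop_nbrs adj v c ls" and ?l2 = "drop_color v c ls"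
    have v: "v \<in> A mk" using alive 2 by blast
    have c: "c \<in> {1, 2, 3}" using 2(4) by (simp add: colors_def)
    have A1: "A ?mk = A mk - {v}" by (auto simp: alive_def)
    have m1: "lsize (A ?mk) ?l1 + card (nbrs n adj mk ls v c) \<le> m"
      unfolding A1 m_def by (rule lsize_remove_nbrs[OF 2(2) less.prems c])
    have m1': "lsize (A ?mk) ?l1 + 1 \<le> m" unfolding A1 m_def by (rule lsize_remove) (use v 2 in auto)
    have m2: "lsize (A mk) ?l2 + 1 = m" unfolding m_def by (rule lsize_drop_color) (use v 2 in auto)
    have s1: "solves 1 (\<tau> * (f (lsize (A ?mk) ?l1) - 1)) ?mk ?l1 (val_of ?mk ?l1)"
      unfolding f_def by (rule less.hyps) (use m1' less.prems in \<open>auto simp: m_def\<close>)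
    note val = val_of_branch[OF v 2(4) A1]
    have mono: "f k \<le> Q * (real m + 1) * x ^ l" if "k \<le> l" "l \<le> m" for k l
      unfolding f_def using that Q3 x(1) by (intro mult_mono power_increasing) auto
    show ?case
    proof (cases "D \<le> card (nbrs n adj mk ls v c)")
      case True
      have s2: "solves 1 (\<tau> * (f (lsize (A mk) ?l2) - 1)) mk ?l2 (val_of mk ?l2)"
        unfolding f_def by (rule less.hyps) (use m2 less.prems in \<open>auto simp: m_def\<close>)
      have le: "lsize (A ?mk) ?l1 \<le> m - D" "D \<le> m" using m1 True by linarith+
      have x0: "x \<noteq> 0" using x(1) by simp
      have "f (lsize (A ?mk) ?l1) + f (lsize (A mk) ?l2) \<le> Q * (real m + 1) * x ^ (m - D) + Q * (real m + 1) * x ^ (m - 1)"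
        using le m2 by (intro add_mono mono) auto
      also have "x ^ (m - D) = x ^ m / x ^ D" using x0 le by (simp add: power_diff)
      also have "x ^ (m - 1) = x ^ m / x" using x0 m2 by (simp add: power_diff)
      also have "Q * (real m + 1) * (x ^ m / x ^ D) + Q * (real m + 1) * (x ^ m / x) = f m * (1 / x + 1 / x ^ D)"
        by (simp add: f_def algebra_simps add_divide_distrib)
      also have "\<dots> \<le> f m" using x(2) Qf[of m] Q3 by (intro mult_left_le) auto
      finally have "\<tau> * (f (lsize (A ?mk) ?l1) + f (lsize (A mk) ?l2)) \<le> \<tau> * f m" by (rule mult_left_mono) simp
      then have "\<tau> * (f (lsize (A ?mk) ?l1) - 1) + \<tau> * (f (lsize (A mk) ?l2) - 1) + \<tau> \<le> \<tau> * (f m - 1)"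
        by (simp add: algebra_simps)
      with s1 s2 val show ?thesis by blast
    next
      case False
      then have "card (colors ls v) = 1" using 2(5) by blast
      then have "colors ls v = {c}" using 2(4) by (auto simp: card_1_singleton_iff)
      then have e: "colors ?l2 v = {}" by (simp add: colors_drop_color)
      have "mk v = 1" using less.prems[OF 2(2)] 2(3) by simp
      then have s2: "solves 1 \<tau> mk ?l2 (val_of mk ?l2)"
        using solves_empty[OF 2(2) _ e] val_of_empty[OF v e] by simp
      \<comment> \<open>In a forced step the other side is a single node of value \<open>0\<close>.
        The measure drops by at least one, so the linear factor frees \<open>Q * x ^ m\<close>,
        which covers both nodes.\<close>
      have "f (lsize (A ?mk) ?l1) \<le> Q * real m * x ^ m"
        unfolding f_def using m1' Q3 x(1) by (intro mult_mono power_increasing) auto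
      also have "Q * real m * x ^ m + 2 \<le> f m"
        using mult_mono[of 2 Q 1 "x ^ m"] Q3 xm[of m] by (simp add: f_def algebra_simps)
      finally have "f (lsize (A ?mk) ?l1) + 2 \<le> f m" by simp
      then have "\<tau> * (f (lsize (A ?mk) ?l1) + 2) \<le> \<tau> * f m" by (rule mult_left_mono) simp
      then have "\<tau> * (f (lsize (A ?mk) ?l1) - 1) + \<tau> + \<tau> \<le> \<tau> * (f m - 1)" by (simp add: algebra_simps)
      with s1 s2 val show ?thesis by blast
    qed
  next
    case 3
    have two: "card (colors ls v) \<ge> 2" if "v \<in> A mk" for v
    proof -
      have v: "v < n" "mk v \<noteq> 0" using that by (auto simp: alive_def)
      then have "colors ls v \<noteq> {}" using 3(1) by blast
      then obtain c where "c \<in> colors ls v" by blast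
      with 3(2)[OF v] \<open>colors ls v \<noteq> {}\<close> show ?thesis
        by (metis One_nat_def Suc_1 card_eq_0_iff finite_colors le_antisym not_less_eq_eq le_0_eq)
    qed
    have deg: "card {y \<in> A mk. adj w y} \<le> 3 * D" if "w \<in> A mk" for w
    proof (rule degree_bound[OF two less.prems _ that])
      show "card (nbrs n adj mk ls v c) < D" if "v \<in> A mk" "c \<in> colors ls v" for v c
        using 3(2)[of v c] that by (auto simp: alive_def)
    qed
    from solves_root[OF t deg less.prems]
    have s: "solves 2 (\<tau> * (real (bud (card (A mk)) (t * (9 * D) + 1)) - 1)) mk ls (val_of mk ls)" by blast
    have "card (A mk) \<le> card {..<n}" by (rule card_mono) (auto simp: alive_def)
    then have "bud (card (A mk)) (t * (9 * D) + 1) \<le> bud n (t * (9 * D) + 1)" by (intro bud_mono) auto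
    then have "real (bud (card (A mk)) (t * (9 * D) + 1)) \<le> f m - 1" using Q Qf[of m] by linarith
    then have "\<tau> * (real (bud (card (A mk)) (t * (9 * D) + 1)) - 1 + 1) \<le> \<tau> * (f m - 1)" by (intro mult_left_mono) auto
    then have "\<tau> * (real (bud (card (A mk)) (t * (9 * D) + 1)) - 1) + \<tau> \<le> \<tau> * (f m - 1)" by (simp add: algebra_simps)
    with s show ?case by blast
  next
    case 4
    show ?case using mult_left_mono[of 1 "f m - 1" \<tau>] Qf[of m] Q3 by simp
  qed
qed

end

section \<open>Initialisation\<close>

lemma card_less_Suc_if: "card {i. i < Suc j \<and> P i} = card {i. i < j \<and> P i} + (if P j then 1 else 0)"
proof -
  have "{i. i < Suc j \<and> P i} = (if P j then insert j {i. i < j \<and> P i} else {i. i < j \<and> P i})"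
    by (auto simp: less_Suc_eq)
  then show ?thesis by simp
qed

text \<open>For positive \<open>n\<close> this is the binary length of \<open>n\<close>, in the form
  in which the loop computes it.\<close>

definition bits :: "nat \<Rightarrow> nat" where
  "bits n = card {i. i < n \<and> 2 ^ i \<le> n}"

text \<open>One more than the square root of \<open>n\<close> times the binary length of
  \<open>n\<close>, rounded up. The additional one lets a factor \<open>1 / x\<close> be split off
  in the recurrence of phase 1.\<close>

definition threshold :: "nat \<Rightarrow> nat" where
  "threshold n = 1 + card {i. i < n \<and> i * i < bits n * n}"

lemma sem_init_degree:
  obtains R' where "sem init_degree (R, M) = (R', M)" "R' rD = threshold (R rN)"
    "\<And>r. r \<in> {0, rN, rK} \<Longrightarrow> R' r = R r"
proof -
  let ?b1 = "Cond (AVar rT \<ominus> AVar rN) Nop (rX \<leftarrow> AVar rX \<oplus> ANum 1) ;; rT \<leftarrow> AVar rT \<oplus> AVar rT"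
  let ?b2 = "Cond (AVar rY \<ominus> AVar rZ) (rD \<leftarrow> AVar rD \<oplus> ANum 1) Nop ;; rZ \<leftarrow> AVar rZ \<oplus> AVar rI \<oplus> AVar rI \<oplus> ANum 1"
  define n where "n = R rN"
  define R0 where "R0 = R(rX := 0, rT := 1)"
  have wf: "wfs (For rI rN ?b1)" "wfs (For rI rN ?b2)" by simp_all
  obtain R1 where 1: "sem (For rI rN ?b1) (R0, M) = (R1, M)" "R1 rX = bits n"
    "\<And>r. r \<notin> mods (For rI rN ?b1) \<Longrightarrow> R1 r = R0 r"
  proof (rule sem_For[OF wf(1), of "\<lambda>j R' M'. M' = M \<and> R' rX = card {i. i < j \<and> 2 ^ i \<le> n} \<and> R' rT = 2 ^ j" R0 M],
      goal_cases)
    case (2 j R' M')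
    have "R' rN = n" using 2(5)[of rN] by (simp add: R0_def n_def)
    then show ?case using 2(3,4) by (auto simp: card_less_Suc_if)
  next
    case (3 R2 M2)
    show ?case by (rule 3(1)[of R2]) (use 3(2-4) in \<open>simp_all add: bits_def n_def R0_def\<close>)
  qed (simp add: R0_def)
  define R2 where "R2 = R1(rY := bits n * n, rD := 1, rZ := 0)"
  have R1: "R1 rN = n" using 1(3)[of rN] by (simp add: R0_def n_def)
  obtain R3 where 3: "sem (For rI rN ?b2) (R2, M) = (R3, M)" "R3 rD = threshold n"
    "\<And>r. r \<notin> mods (For rI rN ?b2) \<Longrightarrow> R3 r = R2 r"
  proof (rule sem_For[OF wf(2), of "\<lambda>j R' M'. M' = M \<and> R' rD = 1 + card {i. i < j \<and> i * i < bits n * n} \<and> R' rZ = j * j" R2 M],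
      goal_cases)
    case (2 j R' M')
    have "R' rY = bits n * n" using 2(5)[of rY] by (simp add: R2_def)
    then show ?case using 2(3,4) by (auto simp: card_less_Suc_if)
  next
    case (3 R4 M4)
    show ?case by (rule 3(1)[of R4]) (use 3(2-4) R1 in \<open>simp_all add: threshold_def R2_def\<close>)
  qed (simp add: R2_def)
  have "sem init_degree (R, M) = (R3, M)"
    unfolding init_degree_def sem.simps(4)
    using 1(1,2) 3(1) R1 by (simp add: R0_def R2_def)
  moreover have "R3 r = R r" if "r \<in> {0, rN, rK}" for r
    using 1(3)[of r] 3(3)[of r] that by (auto simp: R0_def R2_def)
  ultimately show thesis using that 3(2) by (auto simp: n_def)
qed

lemma sem_init_frame:
  assumes R: "R rN = n"
  obtains R' M' where "sem init_frame (R, M) = (R', M')"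
    "encodes n (\<lambda>x y. x = y \<or> M (x * n + y) \<noteq> 0) (n * n + 3 * n) M' (\<lambda>_. 1)
      (\<lambda>d y. M (n * n + (3 * y + (d - 1))) \<noteq> 0)"
    "R' rF = n * n + 3 * n" "R' rW = 1" "\<And>r. r \<in> {0, rN, rK, rD} \<Longrightarrow> R' r = R r"
proof -
  let ?b1 = "Sto (AVar rI \<otimes> rN \<oplus> AVar rI) (ANum 1)"
  let ?b2 = "Sto (own (ANum 0) (AVar rI)) (ANum 1) ;; init_list 0 ;; init_list 1 ;; init_list 2"
  define F where "F = n * n + 3 * n"
  have wf: "wfs (For rI rN ?b1)" "wfs (For rI rN ?b2)" by (simp_all add: expr_defs init_list_def)
  obtain R1 M1 where 1: "sem (For rI rN ?b1) (R, M) = (R1, M1)" "M1 = (\<lambda>a. if \<exists>x<n. a = x * n + x then 1 else M a)"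
    "\<And>r. r \<notin> mods (For rI rN ?b1) \<Longrightarrow> R1 r = R r"
  proof (rule sem_For[OF wf(1), of "\<lambda>j R' M'. M' = (\<lambda>a. if \<exists>x<j. a = x * n + x then 1 else M a)" R M], goal_cases)
    case (2 j R' M')
    have "R' rN = n" using 2(5)[of rN] R by simp
    then have "snd (sem ?b1 (R', M')) = M'(j * n + j := 1)" using 2(4) by simp
    also have "\<dots> = (\<lambda>a. if \<exists>x<Suc j. a = x * n + x then 1 else M a)"
      unfolding 2(3) by (auto simp: fun_eq_iff less_Suc_eq)
    finally show ?case .
  next
    case (3 R2 M2)
    show ?case by (rule 3(1)[of R2 M2]) (use 3(2-4) R in simp_all)
  qed simp
  define R2 where "R2 = R1(rF := F)"
  have R2: "R2 rN = n" "R2 rF = F" using 1(3)[of rN] R by (simp_all add: R2_def)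
  define src where "src d y = M1 (n * n + (3 * y + (d - 1)))" for d y
  obtain R3 M3 where 3: "sem (For rI rN ?b2) (R2, M1) = (R3, M3)"
    "\<And>a. a < F \<Longrightarrow> M3 a = M1 a" "\<And>y. y < n \<Longrightarrow> M3 (F + y) = 1"
    "\<And>d y. d \<in> {1, 2, 3} \<Longrightarrow> y < n \<Longrightarrow> M3 (F + (d * n + y)) = src d y"
    "\<And>r. r \<notin> mods (For rI rN ?b2) \<Longrightarrow> R3 r = R2 r"
  proof (rule sem_For[OF wf(2), of "\<lambda>j R' M'. (\<forall>a<F. M' a = M1 a) \<and> (\<forall>y<j. M' (F + y) = 1) \<and>
        (\<forall>d\<in>{1, 2, 3}. \<forall>y<j. M' (F + (d * n + y)) = src d y)" R2 M1], goal_cases)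
    case (2 j R' M')
    have k: "R' rN = n" "R' rF = F" "j < n"
      using 2(5)[of rN] 2(5)[of rF] R2 2(2) by (simp_all add: init_list_def)
    define N where "N = M'(F + j := 1, F + (1 * n + j) := src 1 j, F + (2 * n + j) := src 2 j, F + (3 * n + j) := src 3 j)"
    \<comment> \<open>The list bits of the input lie below \<open>F\<close>, where this loop does
      not write.\<close>
    have lt: "n * n + (3 * j + d) < F" if "d \<le> 2" for d
      using k(3) that by (simp add: F_def)
    have s0: "sem (Sto (own (ANum 0) (AVar rI)) (ANum 1)) (R', M') = (R', M'(F + j := 1))"
      using k 2(4) by (simp add: own_def)
    have il: "sem (init_list c) (R', M'') = (R', M''(F + (Suc c * n + j) := src (Suc c) j))"
      if "\<forall>a<F. M'' a = M1 a" "c \<le> 2" for c M''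
    proof -
      have "M'' (n * n + (j + (j + (j + c)))) = M'' (n * n + (3 * j + c))" by (rule arg_cong[of _ _ M'']) simp
      also have "\<dots> = src (Suc c) j" using that(1) lt[OF that(2)] by (simp add: src_def)
      finally show ?thesis using k 2(4) by (simp add: init_list_def own_def add.assoc)
    qed
    have up: "\<forall>a<F. (M''(F + z := q)) a = M1 a" if "\<forall>a<F. M'' a = M1 a" for M'' z q
      using that by simp
    have "\<forall>a<F. M' a = M1 a" using 2(3) by blast
    note u0 = up[OF this, of j 1]
    note u1 = up[OF u0, of "Suc 0 * n + j" "src (Suc 0) j"]
    note u2 = up[OF u1, of "Suc 1 * n + j" "src (Suc 1) j"]
    have "sem ?b2 (R', M') = (R', N)"
      unfolding sem.simps(4) s0 il[OF u0 le0] il[OF u1 one_le_numeral] il[OF u2 order_refl] N_def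
      by (simp add: numeral_2_eq_2 numeral_3_eq_3)
    moreover have "N a = M1 a" if "a < F" for a using 2(3) that by (simp add: N_def)
    moreover have NN: "N (F + (d * n + y)) = (if y = j then (if d = 0 then 1 else src d j) else M' (F + (d * n + y)))"
      if "d \<in> {0, 1, 2, 3}" "y < n" for d y
    proof -
      have "F + (d * n + y) = F + (d' * n + j) \<longleftrightarrow> d = d' \<and> y = j" for d'
        using addr_eq_iff[OF that(2) k(3), of d d'] by simp
      from this[of 0] this[of 1] this[of 2] this[of 3] show ?thesis using that(1) unfolding N_def by auto
    qed
    have "N (F + y) = 1" if "y < Suc j" for y
      using NN[of 0 y] that 2(3) k(3) by (cases "y = j") auto
    moreover have "N (F + (d * n + y)) = src d y" if "d \<in> {1, 2, 3}" "y < Suc j" for d y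
      using NN[of d y] that 2(3) k(3) by (cases "y = j") auto
    ultimately show ?case by (auto simp del: sem.simps)
  next
    case (3 R4 M4)
    have inv: "\<forall>a<F. M4 a = M1 a" "\<forall>y<n. M4 (F + y) = 1"
      "\<forall>d\<in>{1, 2, 3}. \<forall>y<n. M4 (F + (d * n + y)) = src d y"
      using 3(3) unfolding R2(1) by blast+
    show ?case
      by (rule 3(1)[OF 3(2) _ _ _ 3(4)]) (use inv in blast)+
  qed simp
  have R3: "R3 r = R r" if "r \<in> {0, rN, rK, rD}" for r
    using 3(5)[of r] 1(3)[of r] that by (auto simp: R2_def init_list_def)
  have "R1 rN = n" using 1(3)[of rN] R by simp
  moreover have "n * n + n + n + n = F" by (simp add: F_def)
  ultimately have rF: "sem (rF \<leftarrow> AVar rN \<otimes> rN \<oplus> AVar rN \<oplus> AVar rN \<oplus> AVar rN) (R1, M1) = (R2, M1)"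
    by (simp add: R2_def)
  have "sem init_frame (R, M) = (R3(rW := 1), M3)"
    unfolding init_frame_def sem.simps(4) 1(1) rF 3(1) by simp
  moreover have "encodes n (\<lambda>x y. x = y \<or> M (x * n + y) \<noteq> 0) F M3 (\<lambda>_. 1) (\<lambda>d y. M (n * n + (3 * y + (d - 1))) \<noteq> 0)"
    unfolding encodes_def
  proof (intro conjI allI impI ballI)
    show "n * n \<le> F" by (simp add: F_def)
    show "M3 (x * n + y) \<noteq> 0 \<longleftrightarrow> x = y \<or> M (x * n + y) \<noteq> 0" if "x < n" "y < n" for x y
    proof -
      have "x * n + y < n * n" by (rule addr_less[OF that])
      then have "M3 (x * n + y) = M1 (x * n + y)" by (intro 3(2)) (simp add: F_def)
      moreover have "(\<exists>z<n. x * n + y = z * n + z) \<longleftrightarrow> x = y"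
        using addr_eq_iff[OF that(2)] that by auto
      ultimately show ?thesis by (simp add: 1(2))
    qed
    show "M3 (F + y) = 1" if "y < n" for y by (rule 3(3)[OF that])
    show "M3 (F + (d * n + y)) \<noteq> 0 \<longleftrightarrow> M (n * n + (3 * y + (d - 1))) \<noteq> 0" if "d \<in> {1, 2, 3}" "y < n" for d y
    proof -
      have "n * n + (3 * y + (d - 1)) \<noteq> x * n + x" if "x < n" for x
        using addr_less[OF that that] by simp
      then have "src d y = M (n * n + (3 * y + (d - 1)))" unfolding src_def 1(2) by auto
      then show ?thesis using 3(4)[OF that] by simp
    qed
  qed
  moreover have "(R3(rW := 1)) rF = F" using 3(5)[of rF] R2 by (simp add: init_list_def)
  moreover have "(R3(rW := 1)) rW = 1" by simp
  moreover have "(R3(rW := 1)) r = R r" if "r \<in> {0, rN, rK, rD}" for r using R3[OF that] that by auto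
  ultimately show thesis unfolding F_def by (rule that)
qed

section \<open>Extraction of the digits\<close>

lemma sem_compute_power:
  assumes R: "R rK = K" "R rE \<le> K * K * K"
  obtains R' where "sem compute_power (R, M) = (R', M)" "R' rQ = 2 ^ R rE"
    "\<And>r. r \<notin> {rQ, rZ, rX, rY, rI} \<Longrightarrow> R' r = R r"
proof -
  let ?b = "Cond (AVar rZ) (rQ \<leftarrow> AVar rQ \<oplus> AVar rQ ;; rZ \<leftarrow> AVar rZ \<ominus> ANum 1) Nop"
  let ?f1 = "For rI rK ?b" and ?f2 = "For rY rK (For rI rK ?b)" and ?f3 = "For rX rK (For rY rK (For rI rK ?b))"
  have wf: "wfs ?f1" "wfs ?f2" "wfs ?f3" by simp_all
  \<comment> \<open>\<open>rZ\<close> counts the doublings still to be made, so the product of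
    \<open>rQ\<close> and \<open>2 ^ rZ\<close> is invariant while \<open>rZ\<close> drops to
    \<open>0\<close>.\<close>
  have p1: "\<exists>R'. sem ?f1 (R, M) = (R', M) \<and> R' rQ * 2 ^ R' rZ = R rQ * 2 ^ R rZ \<and> R' rZ = R rZ - K \<and>
      (\<forall>r. r \<notin> mods ?f1 \<longrightarrow> R' r = R r)" if "R rK = K" for R
  proof (rule sem_For[OF wf(1), of "\<lambda>j R' M'. M' = M \<and> R' rQ * 2 ^ R' rZ = R rQ * 2 ^ R rZ \<and> R' rZ = R rZ - j" R M],
      goal_cases)
    case (2 j R' M')
    have "R' rQ * 2 ^ R' rZ = R' rQ * 2 * 2 ^ (R' rZ - 1)" if "R' rZ \<noteq> 0"
      using that by (cases "R' rZ") auto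
    then show ?case using 2(2) by (auto simp: mult_2_right)
  next
    case (3 R2 M2)
    then show ?case using that by (intro exI[of _ R2]) (auto simp del: sem.simps)
  qed simp
  have p2: "\<exists>R'. sem ?f2 (R, M) = (R', M) \<and> R' rQ * 2 ^ R' rZ = R rQ * 2 ^ R rZ \<and> R' rZ = R rZ - K * K \<and>
      (\<forall>r. r \<notin> mods ?f2 \<longrightarrow> R' r = R r)" if "R rK = K" for R
  proof (rule sem_For[OF wf(2), of "\<lambda>j R' M'. M' = M \<and> R' rQ * 2 ^ R' rZ = R rQ * 2 ^ R rZ \<and> R' rZ = R rZ - j * K" R M],
      goal_cases)
    case (2 j R' M')
    have "R' rK = K" using 2(4)[of rK] that by simp
    from p1[of R', OF this] obtain R2 where R2: "sem ?f1 (R', M) = (R2, M)" "R2 rQ * 2 ^ R2 rZ = R' rQ * 2 ^ R' rZ"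
      "R2 rZ = R' rZ - K" by blast
    have inv: "M' = M" "R' rQ * 2 ^ R' rZ = R rQ * 2 ^ R rZ" "R' rZ = R rZ - j * (K)" using 2(2) by blast+
    have "R2 rQ * 2 ^ R2 rZ = R rQ * 2 ^ R rZ" using R2(2) inv(2) by (simp only:)
    moreover have "R2 rZ = R rZ - Suc j * (K)" using R2(3) inv(3) by (simp add: add.commute)
    moreover have "(R2(rY := Suc j)) rQ = R2 rQ" "(R2(rY := Suc j)) rZ = R2 rZ" by simp_all
    ultimately show ?case unfolding inv(1) R2(1) fst_conv snd_conv by (simp only: simp_thms)
  next
    case (3 R2 M2)
    then show ?case using that by (intro exI[of _ R2]) (auto simp del: sem.simps)
  qed simp
  have p3: "\<exists>R'. sem ?f3 (R, M) = (R', M) \<and> R' rQ * 2 ^ R' rZ = R rQ * 2 ^ R rZ \<and> R' rZ = R rZ - K * (K * K) \<and>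
      (\<forall>r. r \<notin> mods ?f3 \<longrightarrow> R' r = R r)" if "R rK = K" for R
  proof (rule sem_For[OF wf(3), of "\<lambda>j R' M'. M' = M \<and> R' rQ * 2 ^ R' rZ = R rQ * 2 ^ R rZ \<and> R' rZ = R rZ - j * (K * K)" R M],
      goal_cases)
    case (2 j R' M')
    have "R' rK = K" using 2(4)[of rK] that by simp
    from p2[of R', OF this]
    obtain R2 where R2: "sem ?f2 (R', M) = (R2, M)" "R2 rQ * 2 ^ R2 rZ = R' rQ * 2 ^ R' rZ"
      "R2 rZ = R' rZ - K * K" by blast
    have inv: "M' = M" "R' rQ * 2 ^ R' rZ = R rQ * 2 ^ R rZ" "R' rZ = R rZ - j * (K * K)" using 2(2) by blast+
    have "R2 rQ * 2 ^ R2 rZ = R rQ * 2 ^ R rZ" using R2(2) inv(2) by (simp only:)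
    moreover have "R2 rZ = R rZ - Suc j * (K * K)" using R2(3) inv(3) by (simp add: add.commute)
    moreover have "(R2(rX := Suc j)) rQ = R2 rQ" "(R2(rX := Suc j)) rZ = R2 rZ" by simp_all
    ultimately show ?case unfolding inv(1) R2(1) fst_conv snd_conv by (simp only: simp_thms)
  next
    case (3 R2 M2)
    then show ?case using that by (intro exI[of _ R2]) (auto simp del: sem.simps)
  qed simp
  define R0 where "R0 = R(rQ := 1, rZ := R rE)"
  have "R0 rK = K" using R by (simp add: R0_def)
  from p3[of R0, OF this] obtain R' where R': "sem ?f3 (R0, M) = (R', M)" "R' rQ * 2 ^ R' rZ = R0 rQ * 2 ^ R0 rZ"
    "R' rZ = R0 rZ - K * (K * K)" "\<forall>r. r \<notin> mods ?f3 \<longrightarrow> R' r = R0 r" by blast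
  have "R' rZ = 0" using R'(3) R(2) by (simp add: R0_def mult.assoc)
  then have "R' rQ = 2 ^ R rE" using R'(2) by (simp add: R0_def)
  moreover have "sem compute_power (R, M) = (R', M)"
    unfolding compute_power_def sem.simps(4) using R'(1) by (simp add: R0_def del: sem.simps(6))
  moreover have "R' r = R r" if "r \<notin> {rQ, rZ, rX, rY, rI}" for r using R'(4) that by (simp add: R0_def)
  ultimately show thesis using that by blast
qed

text \<open>One step of binary long division: a single comparison decides bit \<open>s\<close> of
  \<open>w\<close>, and a subtraction removes it from the remainder.\<close>

lemma div_mod_halve:
  fixes w :: nat
  defines "u s \<equiv> w mod 2 ^ s"
  shows "w div 2 ^ s = 2 * (w div 2 ^ Suc s) + (if 2 ^ s \<le> u (Suc s) then 1 else 0)"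
    "u s = u (Suc s) - (if 2 ^ s \<le> u (Suc s) then 2 ^ s else 0)"
proof -
  have lt: "u (Suc s) < 2 * 2 ^ s" using pos_mod_bound[of "2 ^ Suc s" w] by (simp add: u_def)
  have w: "w = 2 * (w div 2 ^ Suc s) * 2 ^ s + u (Suc s)"
    using div_mult_mod_eq[of w "2 ^ Suc s"] by (simp add: u_def mult.assoc mult.left_commute)
  have d: "w div 2 ^ s = 2 * (w div 2 ^ Suc s) + u (Suc s) div 2 ^ s"
    by (subst w) (simp add: div_mult_self3)
  have m: "u s = u (Suc s) mod 2 ^ s"
    unfolding u_def by (simp add: mod_mod_cancel)
  have "u (Suc s) div 2 ^ s = (if 2 ^ s \<le> u (Suc s) then 1 else 0)"
    using lt by (auto simp: div_nat_eqI)
  then show "w div 2 ^ s = 2 * (w div 2 ^ Suc s) + (if 2 ^ s \<le> u (Suc s) then 1 else 0)" using d by simp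
  show "u s = u (Suc s) - (if 2 ^ s \<le> u (Suc s) then 2 ^ s else 0)"
    unfolding m using lt by (auto simp: mod_if le_mod_geq)
qed

lemma sem_next_digit:
  assumes R: "R rK = K" "R rE = e + K" "e + K \<le> K * K * K" "R rW = w mod 2 ^ (e + K)"
  obtains R' where "sem next_digit (R, M) = (R', M)" "R' rT = w div 2 ^ e mod 2 ^ K" "R' rW = w mod 2 ^ e" "R' rE = e"
    "\<And>r. r \<in> {0, rN, rK, rA, rB} \<Longrightarrow> R' r = R r"
proof -
  let ?c = "Cond (ANum 1 \<oplus> AVar rW \<ominus> AVar rQ) (rW \<leftarrow> AVar rW \<ominus> AVar rQ ;; rT \<leftarrow> AVar rT \<oplus> ANum 1) Nop"
  let ?b = "rE \<leftarrow> AVar rE \<ominus> ANum 1 ;; compute_power ;; rT \<leftarrow> AVar rT \<oplus> AVar rT ;; ?c"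
  have wf: "wfs (For rG rK ?b)" by (simp add: compute_power_def)
  define v where "v = w mod 2 ^ (e + K)"
  define R0 where "R0 = R(rT := 0)"
  have vlt: "v < 2 ^ (e + K)" by (simp add: v_def)
  show thesis
  \<comment> \<open>After \<open>j\<close> rounds the top \<open>j\<close> of the
    \<open>e + K\<close> bits of \<open>v\<close> have moved to \<open>rT\<close>.\<close>
  proof (rule sem_For[OF wf, of "\<lambda>j R' M'. M' = M \<and> R' rE = e + K - j \<and> R' rT = v div 2 ^ (e + K - j) \<and>
      R' rW = v mod 2 ^ (e + K - j)" R0 M], goal_cases)
    case 1
    show ?case using R vlt by (simp add: R0_def v_def)
  next
    case (2 j R' M')
    have k: "R' rK = K" "j < K" using 2(4)[of rK] 2(1) R by (simp_all add: compute_power_def R0_def)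
    define s where "s = e + K - Suc j"
    have s: "e + K - j = Suc s" using k(2) by (simp add: s_def)
    define R1 where "R1 = R'(rE := s)"
    have 1: "sem (rE \<leftarrow> AVar rE \<ominus> ANum 1) (R', M') = (R1, M)" using 2(2) s by (simp add: R1_def)
    obtain R2 where R2: "sem compute_power (R1, M) = (R2, M)" "R2 rQ = 2 ^ R1 rE"
      "\<And>r. r \<notin> {rQ, rZ, rX, rY, rI} \<Longrightarrow> R2 r = R1 r"
      by (rule sem_compute_power[of R1 K]) (use k R s in \<open>auto simp: R1_def s_def\<close>)
    define T W where "T = v div 2 ^ Suc s" and "W = v mod 2 ^ Suc s"
    have R2': "R2 rQ = 2 ^ s" "R2 rT = T" "R2 rW = W" "R2 rE = s"
      using R2(2) R2(3)[of rT] R2(3)[of rW] R2(3)[of rE] 2(2) s by (simp_all add: R1_def T_def W_def)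
    note h = div_mod_halve[of v s, folded T_def W_def]
    define R3 where "R3 = fst (sem ?c (R2(rT := T + T), M))"
    have c: "sem ?c (R2(rT := T + T), M) = (R3, M)" using sem_pure[of ?c "(R2(rT := T + T), M)"] by (simp add: R3_def prod_eq_iff)
    have "sem ?b (R', M') = (R3, M)"
      unfolding sem.simps(4) 1 R2(1) using R2' c by (simp del: sem.simps(5))
    moreover have "R3 rE = s" "R3 rT = v div 2 ^ s" "R3 rW = v mod 2 ^ s"
      using R2' h by (auto simp: R3_def)
    ultimately show ?case by (simp add: s_def del: sem.simps)
  next
    case (3 R2 M2)
    have inv: "M2 = M" "R2 rE = e" "R2 rT = v div 2 ^ e" "R2 rW = v mod 2 ^ e"
      using 3(2) R(1) by (simp_all add: R0_def)
    show thesis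
    proof (rule that[of R2])
      show "sem next_digit (R, M) = (R2, M)"
        unfolding next_digit_def sem.simps(4) using 3(1) inv(1) by (simp add: R0_def del: sem.simps(4,6))
      show "R2 rT = w div 2 ^ e mod 2 ^ K"
        unfolding inv v_def by (simp add: power_add div_mult2_eq mod_mult2_eq)
      show "R2 rW = w mod 2 ^ e" unfolding inv v_def by (simp add: mod_mod_cancel le_imp_power_dvd)
      show "R2 r = R r" if "r \<in> {0, rN, rK, rA, rB}" for r
        using 3(3)[of r] that by (auto simp: R0_def compute_power_def)
    qed (use inv in simp)
  qed
qed

text \<open>For \<open>p + q > n\<close> the truncated difference can make this true, but no
  colouring has such class sizes, and the corresponding digit is \<open>0\<close>.\<close>

definition balanced :: "nat \<Rightarrow> nat \<Rightarrow> nat \<Rightarrow> bool" where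
  "balanced n p q \<longleftrightarrow> \<bar>int p - int q\<bar> \<le> 1 \<and> \<bar>int p - int (n - p - q)\<bar> \<le> 1 \<and> \<bar>int q - int (n - p - q)\<bar> \<le> 1"

lemma val_far: "val (far a b) s = 0 \<longleftrightarrow> \<bar>int (fst s a) - int (fst s b)\<bar> \<le> 1"
  by (auto simp: far_def neq_def)

lemma sem_extract:
  assumes R: "R rK = K" "R rN = n" "R rW = w" "w < 2 ^ (K * K * K)"
  shows "fst (sem extract (R, M)) 0 =
    (\<Sum>p<K. \<Sum>q<K. if balanced n p q then w div 2 ^ ((p * K + q) * K) mod 2 ^ K else 0)"
proof -
  define g where "g p q = (if balanced n p q then w div 2 ^ ((p * K + q) * K) mod 2 ^ K else 0)" for p q
  define E where "E a b = K * K * K - (a * K + b) * K" for a b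
  let ?t = "rC \<leftarrow> AVar rK \<ominus> ANum 1 \<ominus> AVar rA ;; rV \<leftarrow> AVar rK \<ominus> ANum 1 \<ominus> AVar rB ;;
    rL \<leftarrow> AVar rN \<ominus> AVar rC \<ominus> AVar rV ;;
    Cond (far rC rV \<oplus> far rC rL \<oplus> far rV rL) Nop (0 \<leftarrow> AVar 0 \<oplus> AVar rT)"
  let ?b = "next_digit ;; ?t"
  have wf: "wfs (For rB rK ?b)" "wfs (For rA rK (For rB rK ?b))"
    by (simp_all add: next_digit_def compute_power_def far_def neq_def)
  have mods: "mods ?b \<inter> {rN, rK, rA} = {}" by (simp add: next_digit_def compute_power_def)
  have inner: "\<exists>R'. sem (For rB rK ?b) (R, M) = (R', M) \<and> R' rE = E (Suc a) 0 \<and> R' rW = w mod 2 ^ E (Suc a) 0 \<and>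
      R' 0 = R 0 + (\<Sum>b<K. g (K - Suc a) (K - Suc b))"
    if h: "R rK = K" "R rN = n" "R rA = a" "a < K" "R rE = E a 0" "R rW = w mod 2 ^ E a 0" for R a
  proof (rule sem_For[OF wf(1), of "\<lambda>j R' M'. M' = M \<and> R' rE = E a j \<and> R' rW = w mod 2 ^ E a j \<and>
      R' 0 = R 0 + (\<Sum>b<j. g (K - Suc a) (K - Suc b))" R M], goal_cases)
    case 1
    show ?case using h by simp
  next
    case (2 b R' M')
    have k: "R' rK = K" "R' rN = n" "R' rA = a" "R' rB = b" "b < K"
      using 2(4)[of rK] 2(4)[of rN] 2(4)[of rA] 2(1,3) h mods by auto
    have "a * K + b < K * K" using addr_less[OF h(4) k(5)] .
    then have lt: "(a * K + b) * K + K \<le> K * K * K"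
      using mult_le_mono1[of "a * K + b + 1" "K * K" K] by simp
    \<comment> \<open>A position counted from the top and the index of its digit add up to
      \<open>K * K - 1\<close>.\<close>
    have idx: "((K - Suc a) * K + (K - Suc b)) + (a * K + b) + 1 = K * K"
    proof -
      have "(K - Suc a) * K + a * K + K = K * K"
      proof -
        have "(K - Suc a) + a + 1 = K" using h(4) by simp
        then have "((K - Suc a) + a + 1) * K = K * K" by (simp only:)
        then show ?thesis unfolding add_mult_distrib by simp
      qed
      moreover have "K - Suc b + b + 1 = K" using k(5) by simp
      ultimately show ?thesis by linarith
    qed
    define e where "e = E a (Suc b)"
    have e: "E a b = e + K" using lt by (simp add: E_def e_def algebra_simps)
    have e': "e = ((K - Suc a) * K + (K - Suc b)) * K"
    proof -
      have "((K - Suc a) * K + (K - Suc b)) * K + (a * K + b) * K + K = K * K * K"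
        using arg_cong[OF idx, of "\<lambda>z. z * K"] by (simp add: add_mult_distrib)
      then show ?thesis by (simp add: e_def E_def algebra_simps)
    qed
    obtain R2 where R2: "sem next_digit (R', M) = (R2, M)" "R2 rT = w div 2 ^ e mod 2 ^ K" "R2 rW = w mod 2 ^ e"
      "R2 rE = e" "\<And>r. r \<in> {0, rN, rK, rA, rB} \<Longrightarrow> R2 r = R' r"
      by (rule sem_next_digit[of R' K e w M]) (use k e 2(2) lt in \<open>auto simp: E_def\<close>)
    define R3 where "R3 = R2(rC := K - Suc a, rV := K - Suc b, rL := n - (K - Suc a) - (K - Suc b))"
    have "sem ?t (R2, M) = sem (Cond (far rC rV \<oplus> far rC rL \<oplus> far rV rL) Nop (0 \<leftarrow> AVar 0 \<oplus> AVar rT)) (R3, M)"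
      using R2(5) k by (simp add: R3_def del: sem.simps(5))
    also have "\<dots> = (R3(0 := R' 0 + g (K - Suc a) (K - Suc b)), M)"
    proof (cases "balanced n (K - Suc a) (K - Suc b)")
      case True
      then have "val (far rC rV \<oplus> far rC rL \<oplus> far rV rL) (R3, M) = 0"
        by (simp add: val_far balanced_def R3_def)
      then show ?thesis using True R2(2,5) e' by (simp add: g_def R3_def)
    next
      case False
      then have "val (far rC rV \<oplus> far rC rL \<oplus> far rV rL) (R3, M) \<noteq> 0"
        unfolding val.simps add_is_0 val_far by (auto simp: balanced_def R3_def)
      then show ?thesis using False R2(5)[of 0] by (auto simp: g_def R3_def fun_eq_iff)
    qed
    finally have "sem ?b (R', M') = (R3(0 := R' 0 + g (K - Suc a) (K - Suc b)), M)"
      using R2(1) 2(2) by (simp only: sem.simps(4))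
    then show ?case using 2(2) R2 by (simp add: R3_def e_def del: sem.simps)
  next
    case (3 R2 M2)
    have "E a K = E (Suc a) 0" by (simp add: E_def algebra_simps)
    then show ?case using 3 h(1) by (intro exI[of _ R2]) (auto simp del: sem.simps)
  qed
  define R0 where "R0 = R(rE := K * K * K, 0 := 0)"
  show ?thesis
    unfolding g_def[symmetric]
  proof (rule sem_For[OF wf(2), of "\<lambda>j R' M'. M' = M \<and> R' rE = E j 0 \<and> R' rW = w mod 2 ^ E j 0 \<and>
      R' 0 = (\<Sum>a<j. \<Sum>b<K. g (K - Suc a) (K - Suc b))" R0 M], goal_cases)
    case 1
    show ?case using R by (simp add: R0_def E_def)
  next
    case (2 a R' M')
    have k: "R' rK = K" "R' rN = n" "R' rA = a" "a < K"
      using 2(4)[of rK] 2(4)[of rN] 2(1,3) R mods by (auto simp: R0_def)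
    from inner[OF k] obtain R2 where R2: "sem (For rB rK ?b) (R', M) = (R2, M)" "R2 rE = E (Suc a) 0"
      "R2 rW = w mod 2 ^ E (Suc a) 0" "R2 0 = R' 0 + (\<Sum>b<K. g (K - Suc a) (K - Suc b))"
      using 2(2) k by auto
    have "sem (For rB rK ?b) (R', M') = (R2, M)" using R2(1) 2(2) by (simp only:)
    then show ?case using R2 2(2) by (simp del: sem.simps)
  next
    case (3 R2 M2)
    have "sem extract (R, M) = (R2, M2)"
      unfolding extract_def sem.simps(4) 3(1)[symmetric] using R by (simp add: R0_def del: sem.simps(4,6))
    moreover have "R2 0 = (\<Sum>a<K. \<Sum>b<K. g (K - Suc a) (K - Suc b))" using 3(2) R by (simp add: R0_def)
    moreover have "\<dots> = (\<Sum>p<K. \<Sum>q<K. g p q)"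
      by (simp add: sum.nat_diff_reindex[of "\<lambda>q. g _ q"] sum.nat_diff_reindex[of "\<lambda>p. \<Sum>q<K. g p q"])
    ultimately show ?case by simp
  qed
qed

section \<open>Recovering the class sizes from the weighted count\<close>

lemma digit_sum_less:
  fixes B :: nat
  assumes "\<And>q. d q < B"
  shows "(\<Sum>q<N. d q * B ^ q) < B ^ N"
proof (induction N)
  case (Suc N)
  have "(\<Sum>q<Suc N. d q * B ^ q) < B ^ N + d N * B ^ N" using Suc by simp
  also have "\<dots> = Suc (d N) * B ^ N" by simp
  also have "\<dots> \<le> B * B ^ N" using assms[of N] by (intro mult_le_mono1) simp
  finally show ?case by simp
qed simp

text \<open>All coefficients are below the base, so there are no carries.\<close>

lemma digit_sum:
  fixes B :: nat
  assumes "\<And>q. d q < B" "q < N"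
  shows "(\<Sum>i<N. d i * B ^ i) div B ^ q mod B = d q"
  using assms
proof (induction q arbitrary: d N)
  case (0 d N)
  then obtain N' where N: "N = Suc N'" by (cases N) auto
  have "(\<Sum>i<N. d i * B ^ i) = d 0 + B * (\<Sum>i<N'. d (Suc i) * B ^ i)"
    unfolding N sum.lessThan_Suc_shift by (simp add: sum_distrib_left mult.left_commute)
  then show ?case using "0.prems"(1)[of 0] by simp
next
  case (Suc q d N)
  then obtain N' where N: "N = Suc N'" by (cases N) auto
  have s: "(\<Sum>i<N. d i * B ^ i) = d 0 + B * (\<Sum>i<N'. d (Suc i) * B ^ i)"
    unfolding N sum.lessThan_Suc_shift by (simp add: sum_distrib_left mult.left_commute)
  have "(\<Sum>i<N. d i * B ^ i) div B = (\<Sum>i<N'. d (Suc i) * B ^ i)"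
    unfolding s using Suc.prems(1)[of 0] by simp
  then have "(\<Sum>i<N. d i * B ^ i) div B ^ Suc q = (\<Sum>i<N'. d (Suc i) * B ^ i) div B ^ q"
    by (simp add: div_mult2_eq)
  then show ?case using Suc.IH[of "\<lambda>i. d (Suc i)" N'] Suc.prems N by simp
qed

definition class_size :: "nat \<Rightarrow> (nat \<Rightarrow> nat) \<Rightarrow> nat \<Rightarrow> nat" where
  "class_size n \<phi> c = card {v. v < n \<and> \<phi> v = c}"

lemma class_size_le: "class_size n \<phi> c \<le> n"
proof -
  have "class_size n \<phi> c \<le> card {..<n}" unfolding class_size_def by (rule card_mono) auto
  then show ?thesis by simp
qed

text \<open>The exponent of the base \<open>2 ^ K\<close> is the pair of class sizes, itself written
  in base \<open>K\<close>.\<close>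

lemma prod_wt: "(\<Prod>v\<in>{..<n}. wt K (\<phi> v)) = (2 ^ K) ^ (class_size n \<phi> 3 * K + class_size n \<phi> 2)"
proof -
  have "(\<Prod>v\<in>{..<n}. wt K (\<phi> v)) = 2 ^ (\<Sum>v<n. (if \<phi> v = 3 then K * K else 0) + (if \<phi> v = 2 then K else 0))"
    unfolding power_sum by (rule prod.cong) (auto simp: wt_def)
  also have "(\<Sum>v<n. (if \<phi> v = 3 then K * K else 0) + (if \<phi> v = 2 then K else 0)) =
      K * (class_size n \<phi> 3 * K + class_size n \<phi> 2)"
    unfolding sum.distrib class_size_def
    by (simp add: sum.If_cases Collect_conj_eq lessThan_def algebra_simps)
  finally show ?thesis by (simp only: power_mult)
qed

text \<open>\<open>K = 4 * n + 1\<close> does double duty: it exceeds every class size, so pairs of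
  sizes have distinct indices, and \<open>2 ^ K\<close> exceeds the number of colourings.\<close>

lemma wcount_digits:
  fixes n :: nat and adj ls :: "nat \<Rightarrow> nat \<Rightarrow> bool"
  defines "K \<equiv> 4 * n + 1"
  defines "S \<equiv> cols adj {..<n} ls" and "w \<equiv> wcount (wt K) adj {..<n} ls"
  shows "w < 2 ^ (K * K * K)"
    "p < K \<Longrightarrow> q < K \<Longrightarrow> w div 2 ^ ((p * K + q) * K) mod 2 ^ K =
      card {\<phi> \<in> S. class_size n \<phi> 3 = p \<and> class_size n \<phi> 2 = q}"
proof -
  define h where "h \<phi> = class_size n \<phi> 3 * K + class_size n \<phi> 2" for \<phi>
  define d where "d q = card {\<phi> \<in> S. h \<phi> = q}" for q
  have fin: "finite S" unfolding S_def by (rule finite_cols) simp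
  have lt: "class_size n \<phi> c < K" for \<phi> c using class_size_le[of n \<phi> c] by (simp add: K_def)
  have hlt: "h \<phi> < K * K" for \<phi> unfolding h_def by (rule addr_less[OF lt lt])
  have w: "w = (\<Sum>q<K * K. d q * (2 ^ K) ^ q)"
  proof -
    have "w = (\<Sum>\<phi>\<in>S. (2 ^ K) ^ h \<phi>)" by (simp add: w_def wcount_def S_def prod_wt h_def)
    also have "\<dots> = (\<Sum>q<K * K. \<Sum>\<phi>\<in>{\<phi> \<in> S. h \<phi> = q}. (2 ^ K) ^ h \<phi>)"
      by (rule sum.group[symmetric]) (use fin hlt in auto)
    also have "\<dots> = (\<Sum>q<K * K. d q * (2 ^ K) ^ q)"
      by (rule sum.cong) (auto simp: d_def)
    finally show ?thesis .
  qed
  have d: "d q < 2 ^ K" for q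
  proof -
    have "d q \<le> card S" unfolding d_def using fin by (intro card_mono) auto
    also have "\<dots> \<le> card ({..<n} \<rightarrow>\<^sub>E {1, 2, 3 :: nat})"
      unfolding S_def cols_def by (rule card_mono) (auto intro!: finite_PiE)
    also have "\<dots> = 3 ^ n" by (simp add: card_PiE numeral_3_eq_3)
    also have "\<dots> \<le> 4 ^ n" by (rule power_mono) auto
    also have "(4 :: nat) ^ n = 2 ^ (2 * n)" by (simp add: power_mult)
    also have "\<dots> < 2 ^ K" by (rule power_strict_increasing) (auto simp: K_def)
    finally show ?thesis .
  qed
  show "w < 2 ^ (K * K * K)"
    using digit_sum_less[of d "2 ^ K" "K * K", OF d] unfolding w by (simp add: mult.assoc flip: power_mult)
  assume pq: "p < K" "q < K"
  have dw: "w div (2 ^ K) ^ (p * K + q) mod 2 ^ K = d (p * K + q)"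
    unfolding w by (rule digit_sum[OF d addr_less[OF pq]])
  have "{\<phi> \<in> S. h \<phi> = p * K + q} = {\<phi> \<in> S. class_size n \<phi> 3 = p \<and> class_size n \<phi> 2 = q}"
    unfolding h_def using addr_eq_iff[OF lt pq(2)] by blast
  then have ds: "d (p * K + q) = card {\<phi> \<in> S. class_size n \<phi> 3 = p \<and> class_size n \<phi> 2 = q}" by (simp add: d_def)
  have e: "(2 :: nat) ^ ((p * K + q) * K) = (2 ^ K) ^ (p * K + q)" by (simp only: mult.commute[of _ K] power_mult)
  show "w div 2 ^ ((p * K + q) * K) mod 2 ^ K = card {\<phi> \<in> S. class_size n \<phi> 3 = p \<and> class_size n \<phi> 2 = q}"
    unfolding e dw ds ..
qed

lemma card_balanced:
  fixes n :: nat
  assumes "finite S" "n < K"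
  shows "(\<Sum>p<K. \<Sum>q<K. if balanced n p q then card {\<phi> \<in> S. class_size n \<phi> 3 = p \<and> class_size n \<phi> 2 = q} else 0) =
    card {\<phi> \<in> S. balanced n (class_size n \<phi> 3) (class_size n \<phi> 2)}"
proof -
  let ?S = "{\<phi> \<in> S. balanced n (class_size n \<phi> 3) (class_size n \<phi> 2)}"
  let ?g = "\<lambda>\<phi>. (class_size n \<phi> 3, class_size n \<phi> 2)"
  have lt: "class_size n \<phi> c < K" for \<phi> c using class_size_le[of n \<phi> c] assms(2) by simp
  have "card ?S = (\<Sum>\<phi>\<in>?S. 1)" by simp
  also have "\<dots> = (\<Sum>pq\<in>{..<K} \<times> {..<K}. \<Sum>\<phi>\<in>{\<phi> \<in> ?S. ?g \<phi> = pq}. 1)"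
    by (rule sum.group[symmetric]) (use assms lt in auto)
  also have "\<dots> = (\<Sum>(p, q)\<in>{..<K} \<times> {..<K}. if balanced n p q
      then card {\<phi> \<in> S. class_size n \<phi> 3 = p \<and> class_size n \<phi> 2 = q} else 0)"
  proof (rule sum.cong)
    fix pq assume "pq \<in> {..<K} \<times> {..<K}"
    obtain p q where pq: "pq = (p, q)" by (cases pq)
    have "{\<phi> \<in> ?S. ?g \<phi> = (p, q)} =
      (if balanced n p q then {\<phi> \<in> S. class_size n \<phi> 3 = p \<and> class_size n \<phi> 2 = q} else {})" by auto
    then show "(\<Sum>\<phi>\<in>{\<phi> \<in> ?S. ?g \<phi> = pq}. 1) = (case pq of (p, q) \<Rightarrow> if balanced n p q
      then card {\<phi> \<in> S. class_size n \<phi> 3 = p \<and> class_size n \<phi> 2 = q} else 0)"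
      unfolding pq by simp
  qed simp
  finally show ?thesis by (simp add: sum.cartesian_product)
qed

lemma balanced_iff_equitable:
  assumes "\<phi> \<in> {..<n} \<rightarrow>\<^sub>E {1, 2, 3}"
  shows "balanced n (class_size n \<phi> 3) (class_size n \<phi> 2) \<longleftrightarrow> equitable3 ({..<n}, E) \<phi>"
proof -
  let ?C = "\<lambda>c. {v. v < n \<and> \<phi> v = c}"
  have "{..<n} = ?C 1 \<union> (?C 2 \<union> ?C 3)" using assms by (auto dest: PiE_mem)
  then have "card {..<n} = card (?C 1 \<union> (?C 2 \<union> ?C 3))" by simp
  also have "\<dots> = card (?C 1) + card (?C 2 \<union> ?C 3)" by (rule card_Un_disjoint) auto
  also have "card (?C 2 \<union> ?C 3) = card (?C 2) + card (?C 3)" by (rule card_Un_disjoint) auto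
  finally have "n = class_size n \<phi> 1 + (class_size n \<phi> 2 + class_size n \<phi> 3)" by (simp add: class_size_def)
  then have "n - class_size n \<phi> 3 - class_size n \<phi> 2 = class_size n \<phi> 1" by simp
  moreover have "card {v \<in> fst ({..<n}, E). \<phi> v = c} = class_size n \<phi> c" for c by (simp add: class_size_def)
  ultimately show ?thesis
    unfolding balanced_def equitable3_def by (simp add: abs_minus_commute) (auto simp: abs_minus_commute)
qed

section \<open>The running time\<close>

text \<open>Identifies what the counting loops compute with an initial segment, whose end is the
  first index at which the condition fails.\<close>

lemma downward_closed_card:
  fixes P :: "nat \<Rightarrow> bool"
  assumes "\<And>i j. i \<le> j \<Longrightarrow> P j \<Longrightarrow> P i"
  shows "{i. i < n \<and> P i} = {..<card {i. i < n \<and> P i}}"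
proof (induction n)
  case (Suc n)
  show ?case
  proof (cases "P n")
    case True
    then have "{i. i < m \<and> P i} = {..<m}" if "m \<le> Suc n" for m using assms[of _ n] that by fastforce
    then show ?thesis by simp
  next
    case False
    then have "{i. i < Suc n \<and> P i} = {i. i < n \<and> P i}" by (auto simp: less_Suc_eq)
    then show ?thesis using Suc by simp
  qed
qed simp

lemma bits_props:
  assumes "n \<ge> 1"
  shows "1 \<le> bits n" "bits n \<le> n" "n < 2 ^ bits n" "2 ^ (bits n - 1) \<le> n"
proof -
  have eq: "{i. i < n \<and> 2 ^ i \<le> n} = {..<bits n}"
    unfolding bits_def by (rule downward_closed_card) (meson order_trans power_increasing one_le_numeral)
  have "0 \<in> {i. i < n \<and> 2 ^ i \<le> n}" using assms by simp
  then show 1: "1 \<le> bits n" unfolding eq by simp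
  have "card {i. i < n \<and> 2 ^ i \<le> n} \<le> card {..<n}" by (rule card_mono) auto
  then show "bits n \<le> n" by (simp add: bits_def)
  \<comment> \<open>If \<open>bits n < n\<close>, it is the first exponent that fails; otherwise it
    equals \<open>n\<close>, and \<open>n < 2 ^ n\<close> helps.\<close>
  have "\<not> (bits n < n \<and> 2 ^ bits n \<le> n)" using eq by auto
  moreover have "n < 2 ^ n" by (rule less_exp)
  ultimately show "n < 2 ^ bits n" using \<open>bits n \<le> n\<close> by (cases "bits n = n") auto
  have "bits n - 1 \<in> {i. i < n \<and> 2 ^ i \<le> n}" unfolding eq using 1 by simp
  then show "2 ^ (bits n - 1) \<le> n" by simp
qed

lemma threshold_props:
  assumes "n \<ge> 1"
  defines "D \<equiv> threshold n - 1"
  shows "1 \<le> D" "D \<le> n" "bits n * n \<le> D * D" "(D - 1) * (D - 1) < bits n * n"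
proof -
  note b = bits_props[OF assms(1)]
  have D: "D = card {i. i < n \<and> i * i < bits n * n}" by (simp add: D_def threshold_def)
  have eq: "{i. i < n \<and> i * i < bits n * n} = {..<D}"
    unfolding D by (rule downward_closed_card) (meson mult_le_mono order_le_less_trans)
  have "0 \<in> {i. i < n \<and> i * i < bits n * n}" using assms b by simp
  then show 1: "1 \<le> D" unfolding eq by simp
  have "card {i. i < n \<and> i * i < bits n * n} \<le> card {..<n}" by (rule card_mono) auto
  then show "D \<le> n" by (simp add: D)
  have "\<not> (D < n \<and> D * D < bits n * n)" using eq by auto
  then show "bits n * n \<le> D * D" using \<open>D \<le> n\<close> b(2) by (cases "D = n") auto
  have "D - 1 \<in> {i. i < n \<and> i * i < bits n * n}" unfolding eq using 1 by simp
  then show "(D - 1) * (D - 1) < bits n * n" by simp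
qed

text \<open>Chosen so that its power with exponent \<open>threshold n - 1\<close> is the square of
  \<open>2 ^ bits n\<close>, thus larger than \<open>n\<close>, while it still exceeds
  \<open>1\<close> by at least \<open>1 / n\<close>. The value \<open>2\<close> at
  \<open>n = 0\<close> solves the recurrence for the threshold \<open>1\<close>.\<close>

definition rate :: "nat \<Rightarrow> real" where
  "rate n = (if n = 0 then 2 else 2 powr (2 * real (bits n) / real (threshold n - 1)))"

text \<open>An explicit function of the right order: \<open>1 + log 2 n\<close> bounds the binary
  length of a positive \<open>n\<close>.\<close>

definition scale :: "nat \<Rightarrow> real" where
  "scale n = sqrt (real n * (1 + log 2 (real n)))"

lemma scale_ge_0: "0 \<le> scale n"
  by (cases "n = 0") (auto simp: scale_def)

lemma bits_le_scale: "sqrt (real (bits n * n)) \<le> scale n"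
proof (cases "n = 0")
  case False
  then have "2 ^ (bits n - 1) \<le> n" using bits_props(4)[of n] by simp
  then have "(2 :: real) ^ (bits n - 1) \<le> real n" by (metis of_nat_le_iff of_nat_numeral of_nat_power)
  then have "real (bits n - 1) \<le> log 2 (real n)"
    using False by (subst le_log_iff) (auto simp: powr_realpow)
  then have "real (bits n) \<le> 1 + log 2 (real n)" by linarith
  then show ?thesis unfolding scale_def by (simp add: mult.commute mult_left_mono)
qed (simp add: scale_def)

lemma threshold_le_scale: "real (threshold n) \<le> scale n + 2"
proof (cases "n = 0")
  case False
  define D where "D = threshold n - 1"
  have n: "n \<ge> 1" using False by simp
  have "real ((D - 1) * (D - 1)) \<le> real (bits n * n)"
    using threshold_props(4)[OF n] unfolding D_def by (simp only: of_nat_le_iff)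
  then have "real (D - 1) \<le> sqrt (real (bits n * n))" by (intro real_le_rsqrt) (simp add: power2_eq_square)
  then have "real (D - 1) \<le> scale n" using bits_le_scale[of n] by linarith
  then show ?thesis unfolding D_def by linarith
qed (simp add: threshold_def scale_def)

text \<open>With \<open>D\<close> for \<open>threshold n - 1\<close>, multiplying by
  \<open>rate n\<close> leaves \<open>1 + 1 / rate n ^ D \<le> rate n\<close>; the summand
  \<open>1 / rate n ^ D\<close> is at most \<open>1 / n\<close>, and \<open>1 / n\<close> at most
  \<open>rate n - 1\<close>.\<close>

lemma rate_recurrence: "1 \<le> rate n" "1 / rate n + 1 / rate n ^ threshold n \<le> 1"
proof -
  show 1: "1 \<le> rate n" by (auto simp: rate_def ge_one_powr_ge_zero)
  show "1 / rate n + 1 / rate n ^ threshold n \<le> 1"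
  proof (cases "n = 0")
    case False
    then have n: "n \<ge> 1" by simp
    define D where "D = threshold n - 1"
    note b = bits_props[OF n]
    note d = threshold_props[OF n, folded D_def]
    have D: "threshold n = Suc D" by (simp add: D_def threshold_def)
    have x: "rate n = 2 powr (2 * real (bits n) / real D)" using False by (simp add: rate_def D_def)
    have "rate n ^ D = 2 powr (2 * real (bits n))"
      unfolding x using d(1) by (simp add: powr_power)
    also have "\<dots> = 2 ^ (2 * bits n)" using powr_realpow[of 2 "2 * bits n"] by simp
    also have "\<dots> = (2 ^ bits n) ^ 2" by (rule power_even_eq)
    finally have xD: "rate n ^ D = (2 ^ bits n) ^ 2" .
    have "real n \<le> 2 ^ bits n" using b(3) by (metis less_imp_le of_nat_le_iff of_nat_numeral of_nat_power)
    moreover have "(2 :: real) ^ bits n \<le> (2 ^ bits n) ^ 2" by (simp add: power2_eq_square)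
    ultimately have xn: "real n \<le> rate n ^ D" unfolding xD by linarith
    have "1 / real n \<le> rate n - 1"
    proof -
      have "1 / real n \<le> real (bits n) / real D"
        using b(1) d(1,2) by (intro frac_le) auto
      also have "\<dots> \<le> ln 2 * (2 * real (bits n) / real D)"
      proof -
        \<comment> \<open>This yields \<open>ln 2 \<ge> 1 / 2\<close>; the factor \<open>2\<close>
          in the exponent of \<open>rate\<close> compensates for it.\<close>
        have "ln (1 / 2 :: real) \<le> 1 / 2 - 1" by (rule ln_le_minus_one) simp
        then have "1 \<le> ln 2 * (2 :: real)" by (simp add: ln_div)
        then show ?thesis using mult_right_mono[of 1 "ln 2 * 2" "real (bits n) / real D"] by simp
      qed
      also have "\<dots> \<le> exp (ln 2 * (2 * real (bits n) / real D)) - 1"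
        using exp_ge_add_one_self[of "ln 2 * (2 * real (bits n) / real D)"] by linarith
      also have "exp (ln 2 * (2 * real (bits n) / real D)) = rate n"
        unfolding x powr_def by (simp add: mult.commute)
      finally show ?thesis .
    qed
    moreover have "1 / rate n ^ D \<le> 1 / real n" using xn n by (intro divide_left_mono) auto
    ultimately have "1 + 1 / rate n ^ D \<le> rate n" by linarith
    then have "(1 + 1 / rate n ^ D) / rate n \<le> rate n / rate n" using 1 by (intro divide_right_mono) auto
    then show ?thesis using 1 unfolding D by (simp add: add_divide_distrib mult.commute)
  qed (simp add: rate_def threshold_def)
qed

text \<open>The total list size is at most \<open>3 * n\<close>, so the exponent is at most
  \<open>6 * bits n * n / D\<close> with \<open>D\<close> at least the root of
  \<open>bits n * n\<close>.\<close>

lemma rate_power: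
  assumes "m \<le> 3 * n"
  shows "rate n ^ m \<le> 2 powr (6 * scale n)"
proof (cases "n = 0")
  case True
  then show ?thesis using assms by (simp add: scale_def)
next
  case False
  then have n: "n \<ge> 1" by simp
  define D where "D = threshold n - 1"
  note d = threshold_props[OF n, folded D_def]
  have x: "rate n = 2 powr (2 * real (bits n) / real D)" using False by (simp add: rate_def D_def)
  define s where "s = sqrt (real (bits n * n))"
  have "real (bits n * n) \<le> real (D * D)" using d(3) by (simp only: of_nat_le_iff)
  then have sD: "s \<le> real D" unfolding s_def by (intro real_le_lsqrt) (auto simp: power2_eq_square)
  have ss: "s * s = real (bits n * n)" unfolding s_def by simp
  have "rate n ^ m \<le> rate n ^ (3 * n)" using rate_recurrence(1) assms by (intro power_increasing) auto
  also have "\<dots> = 2 powr (6 * (real (bits n * n) / real D))" unfolding x by (simp add: powr_power algebra_simps)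
  also have "real (bits n * n) / real D \<le> s"
    using mult_left_mono[OF sD, of s] d(1) ss by (simp add: pos_divide_le_eq s_def)
  then have "2 powr (6 * (real (bits n * n) / real D)) \<le> 2 powr (6 * scale n)"
    using bits_le_scale[of n] by (intro powr_mono) (auto simp: s_def)
  finally show ?thesis .
qed

lemma scale_bigo: "scale \<in> O(\<lambda>n. sqrt (real n * ln (real n)))"
  unfolding scale_def by real_asymp

section \<open>Correctness and cost of the whole program\<close>

lemma runs_main:
  fixes n t :: nat and E :: "nat set set" and L :: "nat \<Rightarrow> nat set"
  assumes t: "t \<ge> 1" and G: "simple_graph ({..<n}, E)" "path_free t ({..<n}, E)"
    and Q: "real (bud n (t * (9 * threshold n) + 1)) + 1 \<le> Q"
  defines "K \<equiv> 4 * n + 1"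
  shows "computes_within prog (input_state n E L) (num_equitable_list_colorings3 ({..<n}, E) L)
    (real (time init_size 0) + (real (time (init_degree ;; init_frame) K) +
      (real (node_time K) * (Q * (3 * real n + 1) * 2 powr (6 * scale n)) + real (time extract K))) + 1)"
proof -
  define adj where "adj x y \<longleftrightarrow> x = y \<or> {x, y} \<in> E" for x y
  define ls where "ls d y \<longleftrightarrow> d \<in> L y" for d y
  have card2: "card e = 2" if "e \<in> E" for e using G(1) that by (simp add: simple_graph_def)
  have noloop: "{x} \<notin> E" for x using card2[of "{x}"] by auto
  interpret pathfree n adj "threshold n" t
  proof
    show "adj y x" if "adj x y" for x y using that by (auto simp: adj_def insert_commute)
    show "adj x x" if "x < n" for x by (simp add: adj_def)
    show "\<not> (\<exists>ps. length ps = t \<and> set ps \<subseteq> {..<n} \<and> distinct ps \<and>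
      (\<forall>i j. i < j \<longrightarrow> j < t \<longrightarrow> (adj (ps ! i) (ps ! j) \<longleftrightarrow> j = Suc i)))"
    proof
      assume "\<exists>ps. length ps = t \<and> set ps \<subseteq> {..<n} \<and> distinct ps \<and>
        (\<forall>i j. i < j \<longrightarrow> j < t \<longrightarrow> (adj (ps ! i) (ps ! j) \<longleftrightarrow> j = Suc i))"
      then obtain ps where ps: "length ps = t" "set ps \<subseteq> {..<n}" "distinct ps"
        "\<And>i j. i < j \<Longrightarrow> j < t \<Longrightarrow> adj (ps ! i) (ps ! j) \<longleftrightarrow> j = Suc i" by blast
      have lt: "{ps ! i, ps ! j} \<in> E \<longleftrightarrow> {i, j} \<in> snd (path_graph t)" if "i < j" "j < t" for i j
      proof -
        have "ps ! i \<noteq> ps ! j" using that ps(1,3) by (simp add: nth_eq_iff_index_eq)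
        then have "{ps ! i, ps ! j} \<in> E \<longleftrightarrow> j = Suc i" using ps(4)[OF that] by (simp add: adj_def)
        also have "\<dots> \<longleftrightarrow> {i, j} \<in> snd (path_graph t)"
          using that by (auto simp: path_graph_def doubleton_eq_iff)
        finally show ?thesis .
      qed
      have "has_induced_copy ({..<n}, E) (path_graph t)"
        unfolding has_induced_copy_def
      proof (intro exI[of _ "\<lambda>i. ps ! i"] conjI ballI)
        show "inj_on (\<lambda>i. ps ! i) (fst (path_graph t))"
          using ps(1,3) by (auto simp: inj_on_def path_graph_def nth_eq_iff_index_eq)
        show "(\<lambda>i. ps ! i) ` fst (path_graph t) \<subseteq> fst ({..<n}, E)"
          using ps(2) nth_mem[of _ ps] unfolding ps(1) by (auto simp: path_graph_def)
        fix i j assume "i \<in> fst (path_graph t)" "j \<in> fst (path_graph t)"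
        then have ij: "i < t" "j < t" by (simp_all add: path_graph_def)
        show "{ps ! i, ps ! j} \<in> snd ({..<n}, E) \<longleftrightarrow> {i, j} \<in> snd (path_graph t)"
        proof (cases i j rule: linorder_cases)
          case less
          then show ?thesis using lt ij by simp
        next
          case equal
          then show ?thesis using noloop by (auto simp: path_graph_def doubleton_eq_iff)
        next
          case greater
          then show ?thesis using lt[OF greater ij(1)] by (simp add: insert_commute)
        qed
      qed
      with G(2) show False by (simp add: path_free_def)
    qed
  qed
  define M where "M = input_memory n E L"
  define R :: "nat \<Rightarrow> nat" where "R = (\<lambda>_. 0)(0 := n)"
  define R1 where "R1 = R(rN := n, rK := K)"
  have M1: "M (x * n + y) \<noteq> 0 \<longleftrightarrow> {x, y} \<in> E" if "x < n" "y < n" for x y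
    using addr_less[OF that] that(2) by (simp add: M_def input_memory_def)
  have M2: "M (n * n + (3 * y + (d - 1))) \<noteq> 0 \<longleftrightarrow> ls d y" if "d \<in> {1, 2, 3}" "y < n" for d y
  proof -
    define x where "x = 3 * y + (d - 1)"
    have "x < 3 * n" "x mod 3 + 1 = d" "x div 3 = y"
      using that by (auto simp: x_def)
    then show ?thesis unfolding x_def[symmetric] by (simp add: M_def input_memory_def ls_def)
  qed
  obtain R2 where R2: "sem init_degree (R1, M) = (R2, M)" "R2 rD = threshold (R1 rN)"
    "\<And>r. r \<in> {0, rN, rK} \<Longrightarrow> R2 r = R1 r"
    apply (rule sem_init_degree[of R1 M])
    subgoal premises p for R' by (rule p(1)[OF p(2-4)])
    done
  have R2N: "R2 rN = n" using R2(3)[of rN] by (simp add: R1_def)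
  obtain R3 M3 where R3: "sem init_frame (R2, M) = (R3, M3)"
    "encodes n (\<lambda>x y. x = y \<or> M (x * n + y) \<noteq> 0) (n * n + 3 * n) M3 (\<lambda>_. 1)
      (\<lambda>d y. M (n * n + (3 * y + (d - 1))) \<noteq> 0)"
    "R3 rF = n * n + 3 * n" "R3 rW = 1" "\<And>r. r \<in> {0, rN, rK, rD} \<Longrightarrow> R3 r = R2 r"
    apply (rule sem_init_frame[of R2 n M, OF R2N])
    subgoal premises p for R' M' by (rule p(1)[OF p(2-6)])
    done
  define F where "F = n * n + 3 * n"
  have enc: "encodes n adj F M3 (\<lambda>_. 1) ls"
    unfolding encodes_def F_def
  proof (intro conjI allI impI ballI)
    note e = encodesD[OF R3(2)]
    show "M3 (x * n + y) \<noteq> 0 \<longleftrightarrow> adj x y" if "x < n" "y < n" for x y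
      using e(2)[OF that] M1[OF that] by (simp add: adj_def)
    show "M3 (n * n + 3 * n + y) = 1" if "y < n" for y by (rule e(3)[OF that])
    show "M3 (n * n + 3 * n + (d * n + y)) \<noteq> 0 \<longleftrightarrow> ls d y" if "d \<in> {1, 2, 3}" "y < n" for d y
      using e(4)[OF that] M2[OF that] by simp
  qed simp
  have rdy: "ready F R3" "R3 rW = 1"
    using R3(3-5) R2(2,3) by (simp_all add: ready_def F_def R1_def K_def)
  define S where "S = cols adj {..<n} ls"
  define w where "w = wcount (wt K) adj {..<n} ls"
  have alive: "alive n (\<lambda>_. 1) = {..<n}" by (auto simp: alive_def)
  define Tc where "Tc = real (node_time K) * (Q * (real (lsize {..<n} ls) + 1) * rate n ^ lsize {..<n} ls - 1)"
  have solve: "solves 1 Tc (\<lambda>_. 1) ls w"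
    using solves_phase1[OF t rate_recurrence(1)[of n] rate_recurrence(2)[of n] Q, of "\<lambda>_. 1" ls]
    unfolding alive Tc_def w_def K_def by simp
  have Q0: "0 \<le> Q" using Q by linarith
  have m: "lsize {..<n} ls \<le> 3 * n" using lsize_le[of "{..<n}" ls] by simp
  have Tc: "Tc \<le> real (node_time K) * (Q * (3 * real n + 1) * 2 powr (6 * scale n))"
  proof -
    have "Q * (real (lsize {..<n} ls) + 1) * rate n ^ lsize {..<n} ls \<le> Q * (3 * real n + 1) * 2 powr (6 * scale n)"
      using m rate_power[OF m] Q0 rate_recurrence(1)[of n] by (intro mult_mono) auto
    then show ?thesis unfolding Tc_def by (intro mult_left_mono) auto
  qed
  \<comment> \<open>\<open>init_size\<close> contains neither loops nor products, so its cost is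
    taken at \<open>X = 0\<close>.\<close>
  have s1: "runs (comp init_size) (R, M) (real (time init_size 0)) (\<lambda>s. agree (fst s) R1 \<and> snd s = M)"
    by (rule runs_comp) (auto simp: init_size_def agree_def R1_def R_def K_def)
  have s2: "runs (comp (init_degree ;; init_frame)) s (real (time (init_degree ;; init_frame) K))
      (\<lambda>s. ready F (fst s) \<and> fst s rW = 1 \<and> snd s = M3)"
    if h: "agree (fst s) R1 \<and> snd s = M" for s
  proof -
    obtain R' where s: "s = (R', M)" "agree R' R1" using h by (cases s) auto
    have sem: "sem (init_degree ;; init_frame) (R1, M) = (R3, M3)" using R2(1) R3(1) by (simp only: sem.simps(4))
    \<comment> \<open>\<open>exec_comp\<close> is used directly because the actual registers only
      agree with \<open>R1\<close> on the variables.\<close>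
    have "\<exists>k R''. exec prog (comp (init_degree ;; init_frame)) (R', M) k
        (R'', snd (sem (init_degree ;; init_frame) (R1, M))) \<and> k \<le> time (init_degree ;; init_frame) K \<and>
        agree R'' (fst (sem (init_degree ;; init_frame) (R1, M)))"
    proof (rule exec_comp)
      have "lims (init_degree ;; init_frame) \<subseteq> {rN}"
        by (simp add: init_degree_def init_frame_def init_list_def expr_defs)
      moreover have "R' rN \<le> K" using s(2) by (simp add: agree_def R1_def K_def)
      ultimately show "\<forall>l\<in>lims (init_degree ;; init_frame). R' l \<le> K" by blast
      show "agree R' R1" by (rule s(2))
    qed (simp_all add: init_degree_def init_frame_def init_list_def expr_defs)
    then obtain k R'' where "exec prog (comp (init_degree ;; init_frame)) (R', M) k (R'', M3)"
      "k \<le> time (init_degree ;; init_frame) K" "agree R'' R3"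
      unfolding sem fst_conv snd_conv by blast
    moreover have "ready F R''" using rdy(1) \<open>agree R'' R3\<close> ready_agree by blast
    moreover have "R'' rW = 1" using rdy(2) \<open>agree R'' R3\<close> by (simp add: agree_def)
    ultimately show ?thesis unfolding runs_def s(1)
      by (intro exI[of _ k] exI[of _ "(R'', M3)"]) (simp del: time.simps comp.simps)
  qed
  have s3: "runs (Call 1) s Tc (\<lambda>s. ready F (fst s) \<and> fst s rW = w)"
    if h: "ready F (fst s) \<and> fst s rW = 1 \<and> snd s = M3" for s
  proof -
    obtain R' where s: "s = (R', M3)" "ready F R'" "R' rW = 1" using h by (cases s) auto
    show ?thesis unfolding s(1)
      by (rule runs_mono[OF solvesD[OF solve s(2) enc] order_refl]) (use s(3) in \<open>simp add: returns_def\<close>)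
  qed
  have s4: "runs (comp extract) s (real (time extract K)) (\<lambda>s. fst s 0 = num_equitable_list_colorings3 ({..<n}, E) L)"
    if h: "ready F (fst s) \<and> fst s rW = w" for s
  proof -
    obtain R' M' where s: "s = (R', M')" "ready F R'" "R' rW = w" using h by (cases s) auto
    have R': "R' rK = K" "R' rN = n" using s(2) by (simp_all add: ready_def K_def)
    note dig = wcount_digits[where n = n and adj = adj and ls = ls, folded K_def w_def S_def]
    have fin: "finite S" unfolding S_def by (rule finite_cols) simp
    have "fst (sem extract (R', M')) 0 =
        (\<Sum>p<K. \<Sum>q<K. if balanced n p q then w div 2 ^ ((p * K + q) * K) mod 2 ^ K else 0)"
      by (rule sem_extract[OF R' s(3) dig(1)])
    also have "\<dots> = (\<Sum>p<K. \<Sum>q<K. if balanced n p q then card {\<phi> \<in> S. class_size n \<phi> 3 = p \<and> class_size n \<phi> 2 = q} else 0)"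
      by (rule sum.cong[OF refl], rule sum.cong[OF HOL.refl]) (use dig(2) in simp)
    also have "\<dots> = card {\<phi> \<in> S. balanced n (class_size n \<phi> 3) (class_size n \<phi> 2)}"
      by (rule card_balanced[OF fin]) (simp add: K_def)
    also have "{\<phi> \<in> S. balanced n (class_size n \<phi> 3) (class_size n \<phi> 2)} =
        {\<phi> \<in> list_colorings3 ({..<n}, E) L. equitable3 ({..<n}, E) \<phi>}"
    proof -
      \<comment> \<open>\<open>cols\<close> compares distinct vertices of the graph only,
        \<open>list_colorings3\<close> all pairs; since edges consist of two distinct vertices, the
        conditions coincide.\<close>
      have edge: "u < n \<and> v < n \<and> u \<noteq> v" if "{u, v} \<in> E" for u v
        using G(1) that card2[OF that] by (auto simp: simple_graph_def)
      have "\<phi> \<in> S \<longleftrightarrow> \<phi> \<in> list_colorings3 ({..<n}, E) L" for \<phi>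
        unfolding S_def cols_def list_colorings3_def ls_def adj_def using edge by auto
      moreover have "\<phi> \<in> {..<n} \<rightarrow>\<^sub>E {1, 2, 3}" if "\<phi> \<in> S" for \<phi> using that by (simp add: S_def cols_def)
      ultimately show ?thesis using balanced_iff_equitable by blast
    qed
    finally have res: "fst (sem extract (R', M')) 0 = num_equitable_list_colorings3 ({..<n}, E) L"
      by (simp add: num_equitable_list_colorings3_def)
    show ?thesis unfolding s(1)
    proof (rule runs_comp)
      show "wfs extract" "lims extract \<inter> mods extract = {}" "\<forall>l\<in>lims extract. R' l \<le> K"
        using R' by (simp_all add: extract_def next_digit_def compute_power_def far_def neq_def)
      fix R'' assume "agree R'' (fst (sem extract (R', M')))"
      then show "fst (R'', snd (sem extract (R', M'))) 0 = num_equitable_list_colorings3 ({..<n}, E) L"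
        using res by (simp add: agree_def)
    qed
  qed
  have "runs main (R, M) (real (time init_size 0) + (real (time (init_degree ;; init_frame) K) +
      (Tc + real (time extract K)))) (\<lambda>s. fst s 0 = num_equitable_list_colorings3 ({..<n}, E) L)"
    unfolding main_def by (intro runs_Seq[OF s1] runs_Seq[OF s2] runs_Seq[OF s3] s4)
  then have "runs (prog ! 0) (R, M) (real (time init_size 0) + (real (time (init_degree ;; init_frame) K) +
      (Tc + real (time extract K)))) (\<lambda>s. fst s 0 = num_equitable_list_colorings3 ({..<n}, E) L)"
    by (simp add: prog_def)
  then have "runs (Call 0) (R, M) (real (time init_size 0) + (real (time (init_degree ;; init_frame) K) +
      (Tc + real (time extract K))) + 1) (\<lambda>s. fst s 0 = num_equitable_list_colorings3 ({..<n}, E) L)"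
    by (intro runs_Call) (simp_all add: prog_def)
  then have "runs (Call 0) (input_state n E L) (real (time init_size 0) + (real (time (init_degree ;; init_frame) K) +
      (real (node_time K) * (Q * (3 * real n + 1) * 2 powr (6 * scale n)) + real (time extract K))) + 1)
      (\<lambda>s. fst s 0 = num_equitable_list_colorings3 ({..<n}, E) L)"
    unfolding input_state_def M_def[symmetric] R_def[symmetric] by (rule runs_mono) (use Tc in auto)
  then show ?thesis unfolding computes_within_def runs_def by blast
qed

lemma node_time_poly: "\<exists>p :: real poly. \<forall>X. real (node_time X) = poly p (real X)"
proof -
  let ?c = "(rX \<leftarrow> ANum 0 ;; find_mark 3) ;; find_color ;; (rX \<leftarrow> ANum 0 ;; find_mark 1 ;; find_mark 2) ;; split_off ;;
    rF \<leftarrow> AVar rF \<ominus> AVar rK ;; select ;; pre_branch 0 ;; pre_branch 2 ;; mid_branch ;; post_branch ;;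
    rW \<leftarrow> ANum 0 ;; Nop"
  obtain p :: "real poly" where p: "\<forall>X. real (time ?c X) = poly p (real X)" using time_poly by blast
  have "node_time X = time ?c X + 20" for X unfolding node_time_def time.simps(4) by simp
  then show ?thesis using p by (intro exI[of _ "p + [:20:]"]) (simp del: time.simps)
qed

lemma bud_le: "real (bud n (t * (9 * threshold n) + 1)) + 1 \<le> (real n + 2) * 2 powr (9 * real t * scale n + 18 * real t + 2)"
proof -
  have "real (t * (9 * threshold n)) \<le> 9 * real t * (scale n + 2)"
    using mult_left_mono[OF threshold_le_scale[of n], of "9 * real t"] by simp
  then have e: "real (t * (9 * threshold n) + 1 + 1) \<le> 9 * real t * scale n + 18 * real t + 2"
    by (simp add: algebra_simps)
  define B where "B = 2 powr (9 * real t * scale n + 18 * real t + 2)"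
  have "(2 :: real) ^ (t * (9 * threshold n) + 1 + 1) = 2 powr real (t * (9 * threshold n) + 1 + 1)"
    by (rule powr_realpow[symmetric]) simp
  also have "\<dots> \<le> B" unfolding B_def using e by (intro powr_mono) auto
  finally have p: "(2 :: real) ^ (t * (9 * threshold n) + 1 + 1) \<le> B" .
  have "real (bud n (t * (9 * threshold n) + 1)) = (real n + 1) * 2 ^ (t * (9 * threshold n) + 1 + 1)"
    unfolding bud_def by (simp only: of_nat_mult of_nat_add of_nat_power of_nat_numeral of_nat_1)
  also have "\<dots> \<le> (real n + 1) * B" using p by (intro mult_left_mono) auto
  finally have "real (bud n (t * (9 * threshold n) + 1)) \<le> (real n + 1) * B" .
  moreover have "1 \<le> B" unfolding B_def using scale_ge_0[of n] by (intro ge_one_powr_ge_zero) auto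
  ultimately show ?thesis unfolding B_def[symmetric] by (simp add: algebra_simps)
qed

theorem theorem1p4:
  fixes t :: nat
  assumes "t \<ge> 1"
  shows "\<exists>(P :: program) (f :: nat \<Rightarrow> real) (p :: real poly).
    f \<in> O(\<lambda>n. sqrt (real n * ln (real n))) \<and>
    (\<forall>(n :: nat) (E :: nat set set) (L :: nat \<Rightarrow> nat set).
      simple_graph ({..<n}, E) \<and> path_free t ({..<n}, E) \<and> list_assignment3 ({..<n}, E) L \<longrightarrow>
      computes_within P (input_state n E L)
        (num_equitable_list_colorings3 ({..<n}, E) L)
        (2 powr f n * poly p (real n)))"
proof -
  \<comment> \<open>The summand \<open>9 * t\<close> comes from the reserve for the pivots of phase
    2, the \<open>6\<close> from the branching of phase 1, and the constant from the rounding of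
    \<open>threshold\<close>.\<close>
  define f where "f n = (9 * real t + 6) * scale n + (18 * real t + 2)" for n
  obtain p1 :: "real poly" where p1: "\<forall>X. real (time (init_degree ;; init_frame) X) = poly p1 (real X)"
    using time_poly by blast
  obtain p2 :: "real poly" where p2: "\<forall>X. real (time extract X) = poly p2 (real X)" using time_poly by blast
  obtain p3 :: "real poly" where p3: "\<forall>X. real (node_time X) = poly p3 (real X)" using node_time_poly by blast
  \<comment> \<open>All blocks are timed at \<open>K = 4 * n + 1\<close>, hence the composition with
    \<open>[:1, 4:]\<close>; the factors \<open>[:2, 1:]\<close> and \<open>[:1, 3:]\<close> are the
    polynomial parts of the budget and of the bound for phase 1.\<close>
  define p where "p = [:real (time init_size 0) + 1:] + pcompose p1 [:1, 4:] +
    pcompose p3 [:1, 4:] * [:2, 1:] * [:1, 3:] + pcompose p2 [:1, 4:]"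
  have p: "poly p (real n) = real (time init_size 0) + 1 + real (time (init_degree ;; init_frame) (4 * n + 1)) +
    real (node_time (4 * n + 1)) * (real n + 2) * (3 * real n + 1) + real (time extract (4 * n + 1))" for n
    unfolding p_def p1[rule_format] p2[rule_format] p3[rule_format]
    by (simp add: poly_pcompose algebra_simps)
  have "(\<lambda>n. (9 * real t + 6) * scale n) \<in> O(\<lambda>n. sqrt (real n * ln (real n)))"
    using scale_bigo by simp
  moreover have "(\<lambda>n. 18 * real t + 2) \<in> O(\<lambda>n. sqrt (real n * ln (real n)))"
    by real_asymp
  ultimately have "f \<in> O(\<lambda>n. sqrt (real n * ln (real n)))"
    unfolding f_def by (rule sum_in_bigo)
  moreover have "computes_within prog (input_state n E L) (num_equitable_list_colorings3 ({..<n}, E) L)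
      (2 powr f n * poly p (real n))"
    if G: "simple_graph ({..<n}, E)" "path_free t ({..<n}, E)" for n E and L :: "nat \<Rightarrow> nat set"
  proof -
    define a b c d where "a = real (time init_size 0)" and "b = real (time (init_degree ;; init_frame) (4 * n + 1))"
      and "c = real (node_time (4 * n + 1))" and "d = real (time extract (4 * n + 1))"
    define Q where "Q = (real n + 2) * 2 powr (9 * real t * scale n + 18 * real t + 2)"
    have f: "2 powr (9 * real t * scale n + 18 * real t + 2) * 2 powr (6 * scale n) = 2 powr f n"
      by (simp add: f_def algebra_simps flip: powr_add)
    have "0 \<le> f n" unfolding f_def using scale_ge_0[of n] by simp
    \<comment> \<open>Allows the cost of initialisation and extraction to be absorbed into the
      product.\<close>
    then have ge1: "1 \<le> 2 powr f n" by (intro ge_one_powr_ge_zero) auto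
    have "a + (b + (c * (Q * (3 * real n + 1) * 2 powr (6 * scale n)) + d)) + 1 =
        1 * (a + 1 + b + d) + 2 powr f n * (c * (real n + 2) * (3 * real n + 1))"
      unfolding Q_def f[symmetric] by (simp add: algebra_simps)
    also have "\<dots> \<le> 2 powr f n * (a + 1 + b + d) + 2 powr f n * (c * (real n + 2) * (3 * real n + 1))"
      using ge1 by (intro add_right_mono mult_right_mono) (auto simp: a_def b_def d_def)
    also have "\<dots> = 2 powr f n * poly p (real n)"
      unfolding p a_def[symmetric] b_def[symmetric] c_def[symmetric] d_def[symmetric] by (simp add: algebra_simps)
    finally have le: "a + (b + (c * (Q * (3 * real n + 1) * 2 powr (6 * scale n)) + d)) + 1 \<le> 2 powr f n * poly p (real n)" .
    have "computes_within prog (input_state n E L) (num_equitable_list_colorings3 ({..<n}, E) L)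
      (a + (b + (c * (Q * (3 * real n + 1) * 2 powr (6 * scale n)) + d)) + 1)"
      unfolding a_def b_def c_def d_def by (rule runs_main[OF assms G]) (unfold Q_def, rule bud_le)
    then show ?thesis using le unfolding computes_within_def by (meson order_trans)
  qed
  ultimately show ?thesis by (intro exI[of _ prog] exI[of _ f] exI[of _ p]) blast
qed

end
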